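(* Let $n\geq 1$ be an integer, let $h:[0,1]^n\to\mathbb{R}$ be a linear combination of $n$-place lattice polynomials, let $\mathbf{X}$ be a random vector uniformly distributed on $[0,1]^n$, and set $Y_h:=h(\mathbf{X})$. For every permutation $\sigma$ of $\{1,\ldots,n\}$ and every $i\in\{0,\ldots,n\}$, let $h_i^\sigma:=h\big(\mathbf{1}_{\{\sigma(1),\ldots,\sigma(i)\}}\big)$. Then, for any function $g\in\mathcal{A}^{(n)}$, $$\mathbf{E}\big[g^{(n)}(Y_h)\big]=\sum_{\sigma\in\mathfrak{S}_n}\Delta[g:h_0^{\sigma},\ldots,h_n^{\sigma}],$$ where $\mathfrak{S}_n$ is the set of all permutations of $\{1,\ldots,n\}$ and $\Delta[g:a_0,\ldots,a_n]$ is the $n$th divided difference of $g$ at $a_0,\ldots,a_n$ (repeated arguments allowed).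
   Context: Lattice polynomials: an $n$-place lattice polynomial is a function $p:[0,1]^n\to[0,1]$ given by a well-formed expression in the real variables $x_1,\ldots,x_n$ linked by the lattice operations $\wedge=\min$ and $\vee=\max$ in an arbitrary combination of parentheses, e.g. $(x_1\wedge x_2)\vee x_3$. A linear combination of lattice polynomials is a function $h=\sum_{i=1}^m c_i\,p_i$ with $c_i\in\mathbb{R}$ and $p_i$ $n$-place lattice polynomials. On each simplex $S_\sigma:=\{\mathbf{x}\in[0,1]^n: x_{\sigma(1)}\geq\cdots\geq x_{\sigma(n)}\}$ such an $h$ is given by $h(\mathbf{x})=\sum_{i=1}^n(h_i^\sigma-h_{i-1}^\sigma)\,x_{\sigma(i)}$; in particular $h_0^\sigma=h(\mathbf{0})=0$. For $A\subseteq\{1,\ldots,n\}$, $\mathbf{1}_A\in\{0,1\}^n$ is the characteristic vector of $A$. $\mathcal{A}^{(n)}$ is the set of $n-1$ times differentiable functions $g$ of one real variable such that $g^{(n-1)}$ is absolutely continuous (on every compact interval). Here $g^{(0)}=g$, and $g^{(n)}$ is the derivative of $g^{(n-1)}$. Divided differences: for $g\in\mathcal{A}^{(n)}$, the $n$th divided difference is the symmetric function of $n+1$ arguments defined inductively by $\Delta[g:a_0]:=g(a_0)$ and $$\Delta[g:a_0,\ldots,a_n]:=\begin{cases}\dfrac{\Delta[g:a_1,\ldots,a_n]-\Delta[g:a_0,\ldots,a_{n-1}]}{a_n-a_0},&\text{if } a_0\neq a_n,\\[2mm] \dfrac{\partial}{\partial a_0}\Delta[g:a_0,\ldots,a_{n-1}],&\text{if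 } a_0=a_n.\end{cases}$$
   Formalization: If h vanishes identically on some simplex S_σ (all h_i^σ = 0), so that Y_h has an atom at 0, it is additionally assumed that g^{(n)}(0) exists; otherwise the expectation is undefined (e.g. n = 1, h = 0, g(x) = |x|). *)

theory Defs
  imports "HOL-Probability.Probability" "HOL-Combinatorics.Permutations"
begin

text \<open>
  Vectors of \<open>\<real>\<^sup>n\<close> are extensional functions on the index set \<open>{1..n}\<close>, as in the product
  measures of the library.
\<close>

definition unit_cube :: "nat \<Rightarrow> (nat \<Rightarrow> real) set" where
  "unit_cube n = PiE {1..n} (\<lambda>_. {0..1})"

definition char_vec :: "nat \<Rightarrow> nat set \<Rightarrow> (nat \<Rightarrow> real)" where
  "char_vec n A = restrict (indicator A) {1..n}"

inductive lattice_polynomial :: "nat \<Rightarrow> ((nat \<Rightarrow> real) \<Rightarrow> real) \<Rightarrow> bool" for n :: nat where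
  var: "i \<in> {1..n} \<Longrightarrow> lattice_polynomial n (\<lambda>x. x i)"
| meet: "lattice_polynomial n p \<Longrightarrow> lattice_polynomial n q \<Longrightarrow>
    lattice_polynomial n (\<lambda>x. min (p x) (q x))"
| join: "lattice_polynomial n p \<Longrightarrow> lattice_polynomial n q \<Longrightarrow>
    lattice_polynomial n (\<lambda>x. max (p x) (q x))"

text \<open>
  The values of \<open>h\<close> outside the cube are irrelevant: \<open>h\<close> stands for a function on \<open>[0,1]\<^sup>n\<close>.
\<close>

definition lattice_combination :: "nat \<Rightarrow> ((nat \<Rightarrow> real) \<Rightarrow> real) \<Rightarrow> bool" where
  "lattice_combination n h \<longleftrightarrow>
    (\<exists>(m::nat) c p. (\<forall>i\<in>{1..m}. lattice_polynomial n (p i)) \<and>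
      (\<forall>x\<in>unit_cube n. h x = (\<Sum>i=1..m. c i * p i x)))"

definition lebesgue_n :: "nat \<Rightarrow> (nat \<Rightarrow> real) measure" where
  "lebesgue_n n = PiM {1..n} (\<lambda>_. lborel)"

text \<open>
  The random vector takes its values in the cube everywhere, not only almost surely, because
  \<open>h\<close> is meaningful on the cube only.
\<close>

definition uniform_on_cube :: "nat \<Rightarrow> 'w measure \<Rightarrow> ('w \<Rightarrow> nat \<Rightarrow> real) \<Rightarrow> bool" where
  "uniform_on_cube n M X \<longleftrightarrow>
    X \<in> measurable M (lebesgue_n n) \<and> (\<forall>\<omega>\<in>space M. X \<omega> \<in> unit_cube n) \<and>
    distr M (lebesgue_n n) X = uniform_measure (lebesgue_n n) (unit_cube n)"

text \<open>
  Absolute continuity of a function on \<open>[a,b]\<close> (the library's \<open>absolutely_continuous\<close> is the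
  notion for measures).
\<close>

definition abs_continuous_on_interval :: "real \<Rightarrow> real \<Rightarrow> (real \<Rightarrow> real) \<Rightarrow> bool" where
  "abs_continuous_on_interval a b f \<longleftrightarrow>
    (\<forall>\<epsilon>>0. \<exists>\<delta>>0. \<forall>(m::nat) u v.
      (\<forall>i<m. a \<le> u i \<and> u i \<le> v i \<and> v i \<le> b) \<longrightarrow>
      disjoint_family_on (\<lambda>i. {u i<..<v i}) {..<m} \<longrightarrow>
      (\<Sum>i<m. v i - u i) < \<delta> \<longrightarrow>
      (\<Sum>i<m. \<bar>f (v i) - f (u i)\<bar>) < \<epsilon>)"

abbreviation nth_deriv :: "nat \<Rightarrow> (real \<Rightarrow> real) \<Rightarrow> real \<Rightarrow> real" where
  "nth_deriv k g \<equiv> (deriv ^^ k) g"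

definition class_A :: "nat \<Rightarrow> (real \<Rightarrow> real) set" where
  "class_A n = {g. (\<forall>k<n - 1. \<forall>x. nth_deriv k g field_differentiable at x) \<and>
    (\<forall>a b. a \<le> b \<longrightarrow> abs_continuous_on_interval a b (nth_deriv (n - 1) g))}"

text \<open>
  \<open>div_diff g [a\<^sub>0, \<dots>, a\<^sub>n]\<close> is \<open>\<Delta>[g : a\<^sub>0, \<dots>, a\<^sub>n]\<close>.  If \<open>a\<^sub>0 = a\<^sub>n\<close>, the derivative is taken with
  respect to the first argument of the divided difference at \<open>a\<^sub>0, \<dots>, a\<^bsub>n-1\<^esub>\<close>, the others being kept
  fixed even where they coincide with \<open>a\<^sub>0\<close>.  The value at the empty list is a dummy.
\<close>

fun div_diff :: "(real \<Rightarrow> real) \<Rightarrow> real list \<Rightarrow> real" where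
  "div_diff g [] = 0"
| "div_diff g [a] = g a"
| "div_diff g (a # b # as) =
    (if a \<noteq> last (b # as)
     then (div_diff g (b # as) - div_diff g (a # butlast (b # as))) / (last (b # as) - a)
     else deriv (\<lambda>x. div_diff g (x # butlast (b # as))) a)"

definition vertex_value ::
  "nat \<Rightarrow> ((nat \<Rightarrow> real) \<Rightarrow> real) \<Rightarrow> (nat \<Rightarrow> nat) \<Rightarrow> nat \<Rightarrow> real" where
  "vertex_value n h \<sigma> i = h (char_vec n (\<sigma> ` {1..i}))"

text \<open>
  For \<open>g\<close> in \<open>class_A n\<close> the \<open>n\<close>th derivative exists only almost everywhere.  The law of \<open>h(X)\<close> has
  an atom exactly when \<open>h\<close> vanishes identically on one of the simplices
  \<open>x\<^bsub>\<sigma>(1)\<^esub> \<ge> \<dots> \<ge> x\<^bsub>\<sigma>(n)\<^esub>\<close>, that is, when all \<open>vertex_value n h \<sigma> i\<close> are \<open>0\<close>; the atom is then at \<open>0\<close>, and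
  both the expectation and the term \<open>\<Delta>[g : 0, \<dots>, 0]\<close> involve the \<open>n\<close>th derivative of \<open>g\<close> at the
  point \<open>0\<close>.  The following condition says that this derivative exists if it is needed; if \<open>h\<close>
  vanishes on no simplex, the condition is void.
\<close>

definition nth_deriv_defined_at_atom ::
  "nat \<Rightarrow> ((nat \<Rightarrow> real) \<Rightarrow> real) \<Rightarrow> (real \<Rightarrow> real) \<Rightarrow> bool" where
  "nth_deriv_defined_at_atom n h g \<longleftrightarrow>
    ((\<exists>\<sigma>. \<sigma> permutes {1..n} \<and> (\<forall>i\<in>{0..n}. vertex_value n h \<sigma> i = 0)) \<longrightarrow>
      nth_deriv (n - 1) g field_differentiable at 0)"

end

theory Submission
  imports Defs
begin

text \<open>
  Write \<open>I \<phi> (a\<^sub>0, \<dots>, a\<^sub>n)\<close> for the integral of \<open>\<phi> (\<Sum>i\<le>n. a\<^sub>i w\<^sub>i)\<close> over the simplex \<open>1 \<ge> x\<^sub>1 \<ge> \<dots> \<ge> x\<^sub>n \<ge> 0\<close>,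
  where \<open>w\<^sub>i = x\<^sub>i - x\<^bsub>i+1\<^esub>\<close> are the barycentric coordinates (\<open>x\<^sub>0 = 1\<close>, \<open>x\<^bsub>n+1\<^esub> = 0\<close>).  If \<open>\<Phi>\<close> is a primitive
  of \<open>\<phi>\<close>, integrating out \<open>x\<^sub>j\<close> first gives
  \<open>(a\<^sub>j - a\<^bsub>j-1\<^esub>) I \<phi> a = I \<Phi> (a without a\<^bsub>j-1\<^esub>) - I \<Phi> (a without a\<^sub>j)\<close>, and telescoping over \<open>j\<close> gives the
  same relation for any two arguments.  By induction \<open>I \<phi>\<close> is symmetric and satisfies the recursion
  defining divided differences, which is the Hermite--Genocchi formula \<open>\<Delta>[g : a] = I (g\<^sup>(\<^sup>n\<^sup>)) a\<close>; this
  needs \<open>g\<^sup>(\<^sup>n\<^sup>)\<close> only as a locally integrable derivative of an absolutely continuous function, except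
  when all arguments coincide.  The cube is, up to a null set, the disjoint union of the simplices
  \<open>x\<^bsub>\<sigma>(1)\<^esub> \<ge> \<dots> \<ge> x\<^bsub>\<sigma>(n)\<^esub>\<close>, on each of which \<open>h\<close> is the barycentric interpolation of its vertex values.

  That an absolutely continuous \<open>f\<close> is differentiable almost everywhere is proved without a monotone
  decomposition: if small intervals of slope \<open>> r\<close> and of slope \<open>< p < r\<close> both cover a set \<open>E\<close> in the
  sense of Vitali, then finitely many intervals of the second kind almost exhaust finitely many of the
  first kind, and absolute continuity makes the increments over the gaps negligible.
\<close>

section \<open>Slopes and differentiability\<close>

text \<open>The obstacle is that the top derivative is only a locally integrable function, while the
  formula evaluates it along an affine function of x. This is harmless when two vertex values
  differ: some coordinate then moves the affine function with non-zero slope, and substitution along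
  it bounds the integral by one over an interval. When all values coincide, the affine function is
  constant and the derivative is evaluated at a single point. As h vanishes at the origin, that
  point is 0, which is where \<open>nth_deriv_defined_at_atom\<close> enters.
  \<open>has_primitive\<close> isolates what the substitution requires, so one computation serves
  the continuous lower derivatives and the top one. No factorial appears since the simplex has
  volume 1/n!, the factor that a divided difference of order n carries as well. Slopes are taken
  over intervals with x strictly inside rather than at an end: the exceptional sets are then Borel,
  and the intervals form a Vitali covering as they stand.\<close>

definition low_slope :: "(real \<Rightarrow> real) \<Rightarrow> real \<Rightarrow> real set" where
  "low_slope f p = {x. \<forall>d>0. \<exists>u v. u < x \<and> x < v \<and> v - u < d \<and> f v - f u < p * (v - u)}"

definition high_slope :: "(real \<Rightarrow> real) \<Rightarrow> real \<Rightarrow> real set" where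
  "high_slope f r = {x. \<forall>d>0. \<exists>u v. u < x \<and> x < v \<and> v - u < d \<and> f v - f u > r * (v - u)}"

lemma high_slope_eq: "high_slope f r = low_slope (\<lambda>x. - f x) (- r)"
proof -
  have "(f v - f u > r * (v - u)) = (- f v - - f u < - r * (v - u))" for u v
    by (auto simp: algebra_simps)
  then show ?thesis unfolding high_slope_def low_slope_def by simp
qed

text \<open>The point x lies strictly inside its interval, so each \<open>W m\<close>, a union of
  open intervals, is open whatever f is; \<open>low_slope f p\<close> is therefore a G-delta
  set.\<close>

lemma borel_low_slope [measurable]: "low_slope f p \<in> sets borel"
proof -
  define W where "W m = (\<Union>(u,v)\<in>{(u,v). v - u < 1 / real (Suc m) \<and> f v - f u < p * (v - u)}. {u<..<v})" for m
  have "low_slope f p = (\<Inter>m. W m)"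
  proof (intro set_eqI iffI)
    fix x assume x: "x \<in> low_slope f p"
    show "x \<in> (\<Inter>m. W m)"
    proof
      fix m
      have "(0::real) < 1 / real (Suc m)" by simp
      with x obtain u v where "u < x" "x < v" "v - u < 1 / real (Suc m)" "f v - f u < p * (v - u)"
        unfolding low_slope_def by blast
      then show "x \<in> W m" unfolding W_def by (intro UN_I[of "(u, v)"]) auto
    qed
  next
    fix x assume x: "x \<in> (\<Inter>m. W m)"
    show "x \<in> low_slope f p" unfolding low_slope_def
    proof (intro CollectI allI impI)
      fix d :: real assume "d > 0"
      then obtain m where m: "1 / real (Suc m) < d"
        using nat_approx_posE by blast
      have "x \<in> W m" using x by auto
      then obtain u v where "u < x" "x < v" "v - u < 1 / real (Suc m)" "f v - f u < p * (v - u)"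
        unfolding W_def by auto
      with m show "\<exists>u v. u < x \<and> x < v \<and> v - u < d \<and> f v - f u < p * (v - u)"
        by (meson less_trans)
    qed
  qed
  moreover have "open (W m)" for m unfolding W_def by auto
  ultimately show ?thesis by simp
qed

lemma borel_high_slope [measurable]: "high_slope f p \<in> sets borel"
  unfolding high_slope_eq by simp

text \<open>The error on [u, v] splits at x into the errors on [u, x] and [x, v], and their bounds
  add up because the lengths do.\<close>

lemma DERIV_straddle:
  fixes f :: "real \<Rightarrow> real"
  assumes "(f has_real_derivative L) (at x)" "e > 0"
  obtains d where "d > 0"
    "\<And>u v. u \<le> x \<Longrightarrow> x \<le> v \<Longrightarrow> v - u < d \<Longrightarrow> \<bar>f v - f u - L * (v - u)\<bar> \<le> e * (v - u)"
proof -
  obtain d where d: "d > 0" "\<And>y. \<bar>y - x\<bar> < d \<Longrightarrow> \<bar>f y - f x - L * (y - x)\<bar> \<le> e * \<bar>y - x\<bar>"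
    using assms unfolding has_field_derivative_def has_derivative_at_alt
    by (auto simp: real_norm_def)
  show thesis
  proof (rule that[OF d(1)])
    fix u v assume "u \<le> x" "x \<le> v" "v - u < d"
    then have "\<bar>f v - f x - L * (v - x)\<bar> \<le> e * (v - x)" "\<bar>f u - f x - L * (u - x)\<bar> \<le> e * (x - u)"
      using d(2)[of v] d(2)[of u] by auto
    then show "\<bar>f v - f u - L * (v - u)\<bar> \<le> e * (v - u)"
      by (auto simp: abs_le_iff algebra_simps)
  qed
qed

text \<open>The difference quotient at x is recovered by letting one end of a straddling interval
  tend to x. Continuity enters here: the second assumption says nothing about intervals ending at
  x.\<close>

lemma DERIV_if_straddle:
  fixes f :: "real \<Rightarrow> real"
  assumes cont: "isCont f x"
    and str: "\<And>e. e > 0 \<Longrightarrow> \<exists>d>0. \<forall>u v. u < x \<longrightarrow> x < v \<longrightarrow> v - u < d \<longrightarrow>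
      \<bar>f v - f u - L * (v - u)\<bar> \<le> e * (v - u)"
  shows "(f has_real_derivative L) (at x)"
  unfolding has_field_derivative_def has_derivative_at_alt
proof (intro conjI allI impI)
  show "bounded_linear ((*) L)" by (rule bounded_linear_mult_right)
  fix e :: real assume "e > 0"
  with str obtain d where d: "d > 0" "\<And>u v. u < x \<Longrightarrow> x < v \<Longrightarrow> v - u < d \<Longrightarrow>
      \<bar>f v - f u - L * (v - u)\<bar> \<le> e * (v - u)" by metis
  have fx: "(f \<longlongrightarrow> f x) (at x within A)" for A
    using cont continuous_at_imp_continuous_at_within continuous_within by blast
  have "\<bar>f y - f x - L * (y - x)\<bar> \<le> e * \<bar>y - x\<bar>" if "\<bar>y - x\<bar> < d" for y
  proof -
    consider "y = x" | "y > x" | "y < x" by linarith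
    then show ?thesis
    proof cases
      case 2
      have "((\<lambda>u. \<bar>f y - f u - L * (y - u)\<bar>) \<longlongrightarrow> \<bar>f y - f x - L * (y - x)\<bar>) (at_left x)"
        by (intro tendsto_intros fx)
      moreover have "((\<lambda>u. e * (y - u)) \<longlongrightarrow> e * (y - x)) (at_left x)"
        by (intro tendsto_intros)
      moreover have "\<forall>\<^sub>F u in at_left x. \<bar>f y - f u - L * (y - u)\<bar> \<le> e * (y - u)"
        unfolding eventually_at_left_field using 2 that
        by (intro exI[of _ "y - d"]) (auto intro!: d)
      ultimately have "\<bar>f y - f x - L * (y - x)\<bar> \<le> e * (y - x)"
        by (rule_tac tendsto_le[of "at_left x"]) auto
      with 2 show ?thesis by simp
    next
      case 3
      have "((\<lambda>v. \<bar>f v - f y - L * (v - y)\<bar>) \<longlongrightarrow> \<bar>f x - f y - L * (x - y)\<bar>) (at_right x)"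
        by (intro tendsto_intros fx)
      moreover have "((\<lambda>v. e * (v - y)) \<longlongrightarrow> e * (x - y)) (at_right x)"
        by (intro tendsto_intros)
      moreover have "\<forall>\<^sub>F v in at_right x. \<bar>f v - f y - L * (v - y)\<bar> \<le> e * (v - y)"
        unfolding eventually_at_right_field using 3 that
        by (intro exI[of _ "y + d"]) (auto intro!: d)
      ultimately have "\<bar>f x - f y - L * (x - y)\<bar> \<le> e * (x - y)"
        by (rule_tac tendsto_le[of "at_right x"]) auto
      with 3 show ?thesis by (simp add: abs_le_iff algebra_simps)
    qed simp
  qed
  then show "\<exists>d>0. \<forall>y. norm (y - x) < d \<longrightarrow> norm (f y - f x - L * (y - x)) \<le> e * norm (y - x)"
    using d(1) by (auto simp: real_norm_def)
qed

text \<open>The first condition excludes infinite slopes, the second an oscillation between two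
  slopes; rational p and r keep the union of exceptional sets countable. Conversely, the lower
  bounds for slopes near x form a bounded down-set, and its supremum is the derivative.\<close>

lemma differentiable_iff_slopes:
  fixes f :: "real \<Rightarrow> real"
  assumes cont: "isCont f x"
  shows "f field_differentiable (at x) \<longleftrightarrow>
    (\<exists>N. x \<notin> low_slope f (- real N) \<and> x \<notin> high_slope f (real N)) \<and>
    (\<forall>p\<in>\<rat>. \<forall>r\<in>\<rat>. p < r \<longrightarrow> \<not> (x \<in> low_slope f p \<and> x \<in> high_slope f r))" (is "_ \<longleftrightarrow> ?A \<and> ?B")
proof
  assume "f field_differentiable (at x)"
  then obtain L where L: "(f has_real_derivative L) (at x)"
    unfolding field_differentiable_def by auto
  have low: "x \<notin> low_slope f p" if "p < L" for p
  proof -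
    from that have "L - p > 0" by simp
    from DERIV_straddle[OF L this] obtain d where d: "d > 0"
      "\<And>u v. u \<le> x \<Longrightarrow> x \<le> v \<Longrightarrow> v - u < d \<Longrightarrow> \<bar>f v - f u - L * (v - u)\<bar> \<le> (L - p) * (v - u)"
      by blast
    have "\<not> f v - f u < p * (v - u)" if "u < x" "x < v" "v - u < d" for u v
      using d(2)[of u v] that by (auto simp: abs_le_iff algebra_simps)
    then show ?thesis unfolding low_slope_def using d(1) by blast
  qed
  have high: "x \<notin> high_slope f p" if "p > L" for p
  proof -
    from that have "p - L > 0" by simp
    from DERIV_straddle[OF L this] obtain d where d: "d > 0"
      "\<And>u v. u \<le> x \<Longrightarrow> x \<le> v \<Longrightarrow> v - u < d \<Longrightarrow> \<bar>f v - f u - L * (v - u)\<bar> \<le> (p - L) * (v - u)"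
      by blast
    have "\<not> f v - f u > p * (v - u)" if "u < x" "x < v" "v - u < d" for u v
      using d(2)[of u v] that by (auto simp: abs_le_iff algebra_simps)
    then show ?thesis unfolding high_slope_def using d(1) by blast
  qed
  obtain N where "real N > \<bar>L\<bar>" using reals_Archimedean2 by blast
  then have ?A by (intro exI[of _ N]) (auto intro!: low high)
  moreover have ?B
  proof (intro ballI impI)
    fix p r :: real assume "p < r"
    then have "p < L \<or> r > L" by linarith
    then show "\<not> (x \<in> low_slope f p \<and> x \<in> high_slope f r)" using low high by blast
  qed
  ultimately show "?A \<and> ?B" by blast
next
  assume AB: "?A \<and> ?B"
  then obtain N where N: "x \<notin> low_slope f (- real N)" "x \<notin> high_slope f (real N)" by blast
  have below: "\<exists>d>0. \<forall>u v. u < x \<longrightarrow> x < v \<longrightarrow> v - u < d \<longrightarrow> f v - f u \<ge> p * (v - u)"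
    if "x \<notin> low_slope f p" for p
    using that unfolding low_slope_def mem_Collect_eq by (metis not_less)
  have above: "\<exists>d>0. \<forall>u v. u < x \<longrightarrow> x < v \<longrightarrow> v - u < d \<longrightarrow> f v - f u \<le> p * (v - u)"
    if "x \<notin> high_slope f p" for p
    using that unfolding high_slope_def mem_Collect_eq by (metis not_less)
  define S where "S = {p. x \<notin> low_slope f p}"
  have bound: "p \<le> real N" if "p \<in> S" for p
  proof -
    obtain d where d: "d > 0" "\<And>u v. u < x \<Longrightarrow> x < v \<Longrightarrow> v - u < d \<Longrightarrow> f v - f u \<ge> p * (v - u)"
      using below[of p] \<open>p \<in> S\<close> unfolding S_def by blast
    obtain d' where d': "d' > 0" "\<And>u v. u < x \<Longrightarrow> x < v \<Longrightarrow> v - u < d' \<Longrightarrow> f v - f u \<le> real N * (v - u)"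
      using above[OF N(2)] by blast
    \<comment> \<open>The interval [x - m, x + m] is short enough for both estimates, which bound
      its slope by p from below and by N from above.\<close>
    define m where "m = min d d' / 4"
    have m: "m > 0" "2 * m < d" "2 * m < d'" using d(1) d'(1) by (auto simp: m_def)
    have "p * (x + m - (x - m)) \<le> f (x + m) - f (x - m)" by (rule d(2)) (use m in auto)
    also have "\<dots> \<le> real N * (x + m - (x - m))" by (rule d'(2)) (use m in auto)
    finally have "p * (2 * m) \<le> real N * (2 * m)" by simp
    then show ?thesis using m by simp
  qed
  have mono: "p' \<in> S" if "p \<in> S" "p' \<le> p" for p p'
  proof -
    have "low_slope f p' \<subseteq> low_slope f p"
    proof
      fix y assume y: "y \<in> low_slope f p'"
      have "f v - f u < p * (v - u)" if "u < y" "y < v" "f v - f u < p' * (v - u)" for u v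
        using that mult_right_mono[OF \<open>p' \<le> p\<close>, of "v - u"] by linarith
      with y show "y \<in> low_slope f p" unfolding low_slope_def by blast
    qed
    with \<open>p \<in> S\<close> show ?thesis unfolding S_def by blast
  qed
  have S: "S \<noteq> {}" "bdd_above S" using N(1) bound unfolding S_def bdd_above_def by auto
  define L where "L = Sup S"
  have "(f has_real_derivative L) (at x)"
  proof (rule DERIV_if_straddle[OF cont])
    fix e :: real assume e: "e > 0"
    obtain q where q: "q \<in> S" "L - e < q"
      using less_cSup_iff[OF S, of "L - e"] e unfolding L_def by auto
    then have "L - e \<in> S" using mono by auto
    then obtain d where d: "d > 0" "\<And>u v. u < x \<Longrightarrow> x < v \<Longrightarrow> v - u < d \<Longrightarrow> f v - f u \<ge> (L - e) * (v - u)"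
      using below[of "L - e"] unfolding S_def by blast
    \<comment> \<open>Since p > Sup S, slopes below p occur arbitrarily close to x; the second
      condition then rules out slopes above r. The point L + e/2 keeps p below r.\<close>
    obtain p where p: "p \<in> \<rat>" "L < p" "p < L + e / 2" using Rats_dense_in_real[of L "L + e/2"] e by auto
    obtain r where r: "r \<in> \<rat>" "L + e/2 < r" "r < L + e" using Rats_dense_in_real[of "L + e/2" "L + e"] e by auto
    have "p \<notin> S" using cSup_upper[OF _ S(2), of p] p unfolding L_def by auto
    then have "x \<notin> high_slope f r" using AB p r unfolding S_def by force
    then obtain d' where d': "d' > 0" "\<And>u v. u < x \<Longrightarrow> x < v \<Longrightarrow> v - u < d' \<Longrightarrow> f v - f u \<le> r * (v - u)"
      using above[of r] by blast
    have "\<bar>f v - f u - L * (v - u)\<bar> \<le> e * (v - u)" if uv: "u < x" "x < v" "v - u < min d d'" for u v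
    proof -
      have "f v - f u \<ge> (L - e) * (v - u)" using d(2) uv by auto
      moreover have "f v - f u \<le> r * (v - u)" using d'(2) uv by auto
      moreover have "r * (v - u) \<le> (L + e) * (v - u)" using r uv by (intro mult_right_mono) auto
      ultimately show ?thesis by (auto simp: abs_le_iff algebra_simps)
    qed
    then show "\<exists>d>0. \<forall>u v. u < x \<longrightarrow> x < v \<longrightarrow> v - u < d \<longrightarrow> \<bar>f v - f u - L * (v - u)\<bar> \<le> e * (v - u)"
      using d(1) d'(1) by (intro exI[of _ "min d d'"]) auto
  qed
  then show "f field_differentiable (at x)" unfolding field_differentiable_def by blast
qed

lemma non_differentiable_eq:
  fixes f :: "real \<Rightarrow> real"
  assumes "continuous_on UNIV f"
  shows "{x. \<not> f field_differentiable (at x)} =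
    (\<Inter>N. low_slope f (- real N) \<union> high_slope f (real N)) \<union>
    (\<Union>p\<in>\<rat>. \<Union>r\<in>\<rat> \<inter> {p<..}. low_slope f p \<inter> high_slope f r)"
proof -
  have "isCont f x" for x using assms continuous_on_eq_continuous_at by blast
  from differentiable_iff_slopes[OF this] show ?thesis by auto
qed

section \<open>Borel measurability of the derivative\<close>

lemma borel_non_differentiable [measurable]:
  fixes f :: "real \<Rightarrow> real"
  assumes "continuous_on UNIV f"
  shows "{x. \<not> f field_differentiable (at x)} \<in> sets borel"
  unfolding non_differentiable_eq[OF assms]
  by (intro sets.Un sets.countable_INT sets.countable_UN'' countable_rat countable_Int1 sets.Int[OF borel_low_slope borel_high_slope]) auto

lemma borel_measurable_deriv:
  fixes f :: "real \<Rightarrow> real"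
  assumes cont: "continuous_on UNIV f"
  shows "deriv f \<in> borel_measurable borel"
proof -
  let ?D = "{x. f field_differentiable (at x)}"
  have D: "?D \<in> sets borel"
    using borel_non_differentiable[OF cont] sets.compl_sets[of "{x. \<not> f field_differentiable (at x)}" borel]
    by (auto simp: Compl_eq_Diff_UNIV[symmetric] Collect_neg_eq[symmetric])
  have [measurable]: "f \<in> borel_measurable borel" using cont by (rule borel_measurable_continuous_onI)
  \<comment> \<open>\<open>deriv\<close> is a choice over the possible derivatives; where there are
    none the predicate is constantly false, so all non-differentiable points share this one default
    value.\<close>
  define c where "c = (SOME D :: real. False)"
  define s where "s n x = (if x \<in> ?D then (f (x + inverse (real (Suc n))) - f x) / inverse (real (Suc n)) else c)" for n x
  show ?thesis
  proof (rule borel_measurable_LIMSEQ_real)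
    show "s n \<in> borel_measurable borel" for n
      unfolding s_def by (rule measurable_If_set) (use D in simp_all)
    fix x
    show "(\<lambda>n. s n x) \<longlonglongrightarrow> deriv f x"
    proof (cases "x \<in> ?D")
      case True
      then have "(f has_real_derivative deriv f x) (at x)"
        by (simp add: DERIV_deriv_iff_field_differentiable)
      then have "((\<lambda>h. (f (x + h) - f x) / h) \<longlongrightarrow> deriv f x) (at 0)"
        by (simp add: DERIV_def)
      moreover have "filterlim (\<lambda>n. inverse (real (Suc n))) (at 0) sequentially"
        unfolding filterlim_at using LIMSEQ_inverse_real_of_nat by auto
      ultimately show ?thesis
        unfolding s_def using True by (auto dest: filterlim_compose)
    next
      case False
      then have "(\<lambda>D. DERIV f x :> D) = (\<lambda>D. False)" by (auto simp: field_differentiable_def)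
      then have "deriv f x = c" unfolding deriv_def c_def by simp
      then show ?thesis using False by (simp add: s_def)
    qed
  qed
qed

section \<open>Absolute continuity and coverings by intervals\<close>

text \<open>Increments are attached to the interval as a set, so that sums over divisions need no
  enumeration of end points; with f the identity they are lengths.\<close>

definition increment :: "(real \<Rightarrow> real) \<Rightarrow> real set \<Rightarrow> real" where
  "increment f K = f (Sup K) - f (Inf K)"

lemma increment_Icc [simp]: "u \<le> v \<Longrightarrow> increment f {u..v} = f v - f u"
  by (simp add: increment_def)

lemma measure_Icc_eq_increment: "u \<le> v \<Longrightarrow> K = {u..v} \<Longrightarrow> measure lebesgue K = increment (\<lambda>x. x) K"
  by simp

lemma sum_increment_division:
  assumes "D division_of {a..b}" "a \<le> b"
  shows "(\<Sum>K\<in>D. increment f K) = f b - f a"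
proof -
  note D = division_ofD[OF assms(1)]
  have I: "Inf K \<in> K" if "K \<in> D" for K
    using D(3,4)[OF that] by auto
  \<comment> \<open>The left end point serves as tag, so that additivity over tagged divisions
    applies.\<close>
  have "(\<lambda>K. (Inf K, K)) ` D tagged_division_of {a..b}"
  proof (rule tagged_division_ofI)
    fix x K x' K' assume "(x, K) \<in> (\<lambda>K. (Inf K, K)) ` D" "(x', K') \<in> (\<lambda>K. (Inf K, K)) ` D" "(x, K) \<noteq> (x', K')"
    then show "interior K \<inter> interior K' = {}" using D(5)[of K K'] by auto
  next
    show "\<Union>{K. \<exists>x. (x, K) \<in> (\<lambda>K. (Inf K, K)) ` D} = {a..b}" unfolding D(6)[symmetric] by blast
  qed (use D(1,2,4) I in auto)
  from additive_tagged_division_1[OF assms(2) this, of f] show ?thesis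
    by (subst (asm) sum.reindex) (auto simp: inj_on_def increment_def)
qed

text \<open>The families in the definition of absolute continuity, as sets instead of sequences;
  degenerate intervals and common end points are allowed, as in divisions.\<close>

definition nonoverlapping_in :: "real \<Rightarrow> real \<Rightarrow> real set set \<Rightarrow> bool" where
  "nonoverlapping_in a b R \<longleftrightarrow> finite R \<and>
    (\<forall>K\<in>R. K \<subseteq> {a..b} \<and> (\<exists>u v. u \<le> v \<and> K = {u..v})) \<and>
    (\<forall>K\<in>R. \<forall>L\<in>R. K \<noteq> L \<longrightarrow> interior K \<inter> interior L = {})"

lemma abs_continuous_on_intervalD:
  assumes "abs_continuous_on_interval a b f" "e > 0"
  obtains d where "d > 0"
    "\<And>R. nonoverlapping_in a b R \<Longrightarrow> (\<Sum>K\<in>R. increment (\<lambda>x. x) K) < d \<Longrightarrow> (\<Sum>K\<in>R. \<bar>increment f K\<bar>) < e"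
proof -
  obtain d where d: "d > 0" "\<And>(m::nat) u v. (\<forall>i<m. a \<le> u i \<and> u i \<le> v i \<and> v i \<le> b) \<Longrightarrow>
      disjoint_family_on (\<lambda>i. {u i<..<v i}) {..<m} \<Longrightarrow>
      (\<Sum>i<m. v i - u i) < d \<Longrightarrow> (\<Sum>i<m. \<bar>f (v i) - f (u i)\<bar>) < e"
    using assms unfolding abs_continuous_on_interval_def by blast
  show thesis
  proof (rule that[OF d(1)])
    fix R :: "real set set"
    assume "nonoverlapping_in a b R" and small: "(\<Sum>K\<in>R. increment (\<lambda>x. x) K) < d"
    then have R: "finite R" "\<And>K. K \<in> R \<Longrightarrow> K \<subseteq> {a..b} \<and> (\<exists>u v. u \<le> v \<and> K = {u..v})"
      "\<And>K L. K \<in> R \<Longrightarrow> L \<in> R \<Longrightarrow> K \<noteq> L \<Longrightarrow> interior K \<inter> interior L = {}"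
      unfolding nonoverlapping_in_def by auto
    obtain h where h: "bij_betw h {..<card R} R"
      using ex_bij_betw_nat_finite[OF R(1)] by (auto simp: lessThan_atLeast0)
    have hR: "h i \<in> R" if "i < card R" for i using h that by (auto simp: bij_betw_def)
    have form: "h i = {Inf (h i)..Sup (h i)} \<and> Inf (h i) \<le> Sup (h i) \<and> a \<le> Inf (h i) \<and> Sup (h i) \<le> b"
      if "i < card R" for i
      using R(2)[OF hR[OF that]] by auto
    have "(\<Sum>i<card R. \<bar>f (Sup (h i)) - f (Inf (h i))\<bar>) < e"
    proof (rule d(2))
      show "\<forall>i<card R. a \<le> Inf (h i) \<and> Inf (h i) \<le> Sup (h i) \<and> Sup (h i) \<le> b" using form by blast
      show "disjoint_family_on (\<lambda>i. {Inf (h i)<..<Sup (h i)}) {..<card R}"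
        unfolding disjoint_family_on_def
      proof (intro ballI impI)
        fix i j assume ij: "i \<in> {..<card R}" "j \<in> {..<card R}" "i \<noteq> j"
        then have "h i \<noteq> h j" using h by (auto simp: bij_betw_def inj_on_def)
        then have "interior (h i) \<inter> interior (h j) = {}" using R(3) hR ij by simp
        moreover have "interior (h i) = {Inf (h i)<..<Sup (h i)}" if "i < card R" for i
          using form[OF that] interior_atLeastAtMost_real by metis
        ultimately show "{Inf (h i)<..<Sup (h i)} \<inter> {Inf (h j)<..<Sup (h j)} = {}" using ij by auto
      qed
      show "(\<Sum>i<card R. Sup (h i) - Inf (h i)) < d"
        using small sum.reindex_bij_betw[OF h, of "increment (\<lambda>x. x)"] by (simp add: increment_def)
    qed
    then show "(\<Sum>K\<in>R. \<bar>increment f K\<bar>) < e"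
      using sum.reindex_bij_betw[OF h, of "\<lambda>K. \<bar>increment f K\<bar>"] by (simp add: increment_def)
  qed
qed

text \<open>Closed intervals are balls given by centre and radius, so Vitali's theorem yields
  countably many disjoint ones covering E up to a null set. Since E has finite measure, finitely
  many of them miss less than e.\<close>

lemma Vitali_covering_intervals:
  fixes E :: "real set"
  assumes E: "E \<in> lmeasurable" and e: "e > 0"
    and cov: "\<And>x d. x \<in> E \<Longrightarrow> d > 0 \<Longrightarrow> \<exists>u v. u < x \<and> x < v \<and> v - u < d \<and> P u v"
  obtains F where "finite F" "\<And>K. K \<in> F \<Longrightarrow> \<exists>u v. u < v \<and> K = {u..v} \<and> P u v"
    "pairwise disjnt F" "measure lebesgue (E \<inter> \<Union>F) > measure lebesgue E - e"
proof -
  define I where "I = {(c, r). r > 0 \<and> P (c - r) (c + r)}"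
  have I_pos: "snd i > 0" if "i \<in> I" for i using that by (auto simp: I_def)
  have "\<exists>i. i \<in> I \<and> x \<in> cball (fst i) (snd i) \<and> snd i < d" if xd: "x \<in> E" "d > 0" for x d
  proof -
    obtain u v where uv: "u < x" "x < v" "v - u < d" "P u v" using cov[OF xd] by blast
    have "(u + v) / 2 - (v - u) / 2 = u" "(u + v) / 2 + (v - u) / 2 = v" by (auto simp: field_simps)
    with uv show ?thesis
      by (intro exI[of _ "((u + v) / 2, (v - u) / 2)"])
        (auto simp: I_def dist_real_def abs_le_iff field_simps)
  qed
  then obtain C where C: "countable C" "C \<subseteq> I"
     "pairwise (\<lambda>i j. disjnt (cball (fst i) (snd i)) (cball (fst j) (snd j))) C"
     "negligible (E - (\<Union>i\<in>C. cball (fst i) (snd i)))"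
    using Vitali_covering_theorem_cballs[of I snd E fst] I_pos by blast
  let ?c = "\<lambda>i::real \<times> real. cball (fst i) (snd i)"
  \<comment> \<open>The balls are cut down to E, so that every finite union has measure at most that
    of E, as the approximation by finite subfamilies demands.\<close>
  define D where "D = (\<lambda>i. E \<inter> ?c i) ` C"
  have UD: "\<Union>D = E \<inter> (\<Union>i\<in>C. ?c i)" by (auto simp: D_def)
  have "measure lebesgue (\<Union>D) = measure lebesgue E"
    by (rule measure_negligible_symdiff[OF E], rule negligible_subset[OF C(4)]) (auto simp: UD)
  moreover obtain D' where D': "D' \<subseteq> D" "finite D'" "measure lebesgue (\<Union>D) - e < measure lebesgue (\<Union>D')"
  proof (rule measure_countable_Union_approachable[of D e "measure lebesgue E"])
    show "countable D" using C(1) by (simp add: D_def)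
    show m: "d \<in> lmeasurable" if "d \<in> D" for d
      using that E by (auto simp: D_def intro!: fmeasurable.Int)
    show "measure lebesgue (\<Union> D') \<le> measure lebesgue E" if "D' \<subseteq> D" "finite D'" for D'
    proof (rule measure_mono_fmeasurable[OF _ _ E])
      show "\<Union> D' \<in> sets lebesgue" using that m by (auto intro!: sets.finite_Union fmeasurableD)
    qed (use that in \<open>auto simp: D_def\<close>)
  qed (use e in auto)
  moreover obtain C' where C': "C' \<subseteq> C" "finite C'" "D' = (\<lambda>i. E \<inter> ?c i) ` C'"
    using finite_subset_image[of D' "\<lambda>i. E \<inter> ?c i" C] D' unfolding D_def by metis
  ultimately have *: "measure lebesgue (E \<inter> \<Union>(?c ` C')) > measure lebesgue E - e"
    by (simp only: Int_UN_distrib)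
  show thesis
  proof (rule that[of "?c ` C'"])
    show "finite (?c ` C')" using C' by simp
    show "\<exists>u v. u < v \<and> K = {u..v} \<and> P u v" if K: "K \<in> ?c ` C'" for K
    proof -
      obtain i where i: "i \<in> C'" "K = ?c i" using K by blast
      then have "i \<in> I" using C' C by blast
      then show ?thesis using i unfolding I_def
        by (intro exI[of _ "fst i - snd i"] exI[of _ "fst i + snd i"]) (auto simp: cball_eq_atLeastAtMost)
    qed
    show "pairwise disjnt (?c ` C')"
    proof (rule pairwiseI)
      fix K K' assume "K \<in> ?c ` C'" "K' \<in> ?c ` C'" "K \<noteq> K'"
      then obtain i j where ij: "i \<in> C'" "j \<in> C'" "i \<noteq> j" "K = ?c i" "K' = ?c j" by blast
      then have "i \<in> C" "j \<in> C" using C'(1) by auto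
      with ij show "disjnt K K'" using pairwiseD[OF C(3)] by blast
    qed
  qed (use * in auto)
qed

text \<open>In each K of F the members of G inside K are completed to a division of K, and R
  collects the added gaps. One R serves all f, so it can be used for f and for lengths
  simultaneously.\<close>

lemma extend_to_nonoverlapping:
  fixes F G :: "real set set"
  assumes F: "finite F" "\<And>K. K \<in> F \<Longrightarrow> \<exists>u v. u \<le> v \<and> K = {u..v}" "pairwise disjnt F"
    and G: "finite G" "\<And>J. J \<in> G \<Longrightarrow> \<exists>u v. u \<le> v \<and> J = {u..v}" "pairwise disjnt G"
    and GF: "\<And>J. J \<in> G \<Longrightarrow> \<exists>K\<in>F. J \<subseteq> K"
  obtains R where "finite R" "\<And>L. L \<in> R \<Longrightarrow> \<exists>K\<in>F. L \<subseteq> K" "\<And>L. L \<in> R \<Longrightarrow> \<exists>u v. u \<le> v \<and> L = {u..v}"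
    "\<And>K L. K \<in> R \<Longrightarrow> L \<in> R \<Longrightarrow> K \<noteq> L \<Longrightarrow> interior K \<inter> interior L = {}"
    "\<And>f. (\<Sum>K\<in>F. increment f K) = (\<Sum>J\<in>G. increment f J) + (\<Sum>L\<in>R. increment f L)"
proof -
  have "\<exists>D. D division_of K \<and> {J\<in>G. J \<subseteq> K} \<subseteq> D" if K: "K \<in> F" for K
  proof -
    obtain u v where uv: "K = cbox u v" using F(2)[OF K] by auto
    have "{J\<in>G. J \<subseteq> K} division_of \<Union>{J\<in>G. J \<subseteq> K}"
    proof (rule division_ofI)
      fix J J' assume J: "J \<in> {J\<in>G. J \<subseteq> K}" "J' \<in> {J\<in>G. J \<subseteq> K}" "J \<noteq> J'"
      then have "J \<inter> J' = {}" using G(3) by (auto simp: pairwise_def disjnt_def)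
      then show "interior J \<inter> interior J' = {}" using interior_subset by blast
    next
      fix J assume "J \<in> {J\<in>G. J \<subseteq> K}"
      then show "J \<subseteq> \<Union>{J\<in>G. J \<subseteq> K}" "J \<noteq> {}" "\<exists>a b. J = cbox a b" using G(2)[of J] by auto
    qed (use G(1) in auto)
    then obtain q where "{J\<in>G. J \<subseteq> K} \<subseteq> q" "q division_of cbox u v"
      by (rule partial_division_extend_interval) (auto simp: uv)
    then show ?thesis using uv by blast
  qed
  then obtain D where D: "\<And>K. K \<in> F \<Longrightarrow> D K division_of K" "\<And>K. K \<in> F \<Longrightarrow> {J\<in>G. J \<subseteq> K} \<subseteq> D K"
    by metis
  define R where "R K = D K - {J\<in>G. J \<subseteq> K}" for K
  have disjF: "K = K'" if "K \<in> F" "K' \<in> F" "x \<in> K" "x \<in> K'" for K K' x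
    using that F(3) by (auto simp: pairwise_def disjnt_def)
  have fin: "finite (D K)" if "K \<in> F" for K using D(1)[OF that] by auto
  have ne: "L \<noteq> {}" "L \<subseteq> K" if "K \<in> F" "L \<in> D K" for L K
    using division_ofD(2,3)[OF D(1)[OF that(1)] that(2)] by auto
  show thesis
  proof (rule that[of "\<Union>K\<in>F. R K"])
    show "finite (\<Union>K\<in>F. R K)" using F(1) fin by (auto simp: R_def)
    show "\<exists>K\<in>F. L \<subseteq> K" if "L \<in> (\<Union>K\<in>F. R K)" for L using that ne(2) unfolding R_def by blast
    show "\<exists>u v. u \<le> v \<and> L = {u..v}" if L: "L \<in> (\<Union>K\<in>F. R K)" for L
    proof -
      obtain K where K: "K \<in> F" "L \<in> D K" using L by (auto simp: R_def)
      then obtain u v where "L = cbox u v" using division_ofD(4)[OF D(1)] by blast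
      with ne(1)[OF K] show ?thesis by auto
    qed
    show "interior L \<inter> interior L' = {}" if L: "L \<in> (\<Union>K\<in>F. R K)" "L' \<in> (\<Union>K\<in>F. R K)" "L \<noteq> L'" for L L'
    proof -
      obtain K K' where K: "K \<in> F" "L \<in> D K" "K' \<in> F" "L' \<in> D K'" using L by (auto simp: R_def)
      show ?thesis
      proof (cases "K = K'")
        case True
        then show ?thesis using division_ofD(5)[OF D(1)] K L(3) by blast
      next
        case False
        then have "L \<inter> L' = {}" using ne(2)[OF K(1,2)] ne(2)[OF K(3,4)] disjF K by blast
        then show ?thesis using interior_subset by blast
      qed
    qed
    fix f :: "real \<Rightarrow> real"
    \<comment> \<open>Pieces are non-empty and the members of F are disjoint, so no gap belongs to
      two of them; the double sum is thus a sum over the union.\<close>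
    have R_disj: "R K \<inter> R K' = {}" if "K \<in> F" "K' \<in> F" "K \<noteq> K'" for K K'
    proof (rule ccontr)
      assume "R K \<inter> R K' \<noteq> {}"
      then obtain L where L: "L \<in> D K" "L \<in> D K'" by (auto simp: R_def)
      with ne[OF that(1)] ne[OF that(2)] have "L \<noteq> {}" "L \<subseteq> K" "L \<subseteq> K'" by auto
      with disjF that show False by blast
    qed
    have Geq: "G = (\<Union>K\<in>F. {J\<in>G. J \<subseteq> K})" using GF by blast
    have "(\<Sum>K\<in>F. increment f K) = (\<Sum>K\<in>F. (\<Sum>J\<in>{J\<in>G. J \<subseteq> K}. increment f J) + (\<Sum>L\<in>R K. increment f L))"
    proof (rule sum.cong[OF refl])
      fix K assume K: "K \<in> F"
      then obtain u v where uv: "u \<le> v" "K = {u..v}" using F(2) by blast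
      have "increment f K = (\<Sum>L\<in>D K. increment f L)"
        using sum_increment_division[of "D K" u v f] D(1)[OF K] uv by simp
      also have "\<dots> = (\<Sum>L\<in>R K. increment f L) + (\<Sum>J\<in>{J\<in>G. J \<subseteq> K}. increment f J)"
        unfolding R_def using sum.subset_diff[OF D(2)[OF K] fin[OF K]] by blast
      finally show "increment f K = (\<Sum>J\<in>{J\<in>G. J \<subseteq> K}. increment f J) + (\<Sum>L\<in>R K. increment f L)" by simp
    qed
    also have "\<dots> = (\<Sum>K\<in>F. (\<Sum>J\<in>{J\<in>G. J \<subseteq> K}. increment f J)) + (\<Sum>K\<in>F. (\<Sum>L\<in>R K. increment f L))"
      by (rule sum.distrib)
    also have "(\<Sum>K\<in>F. (\<Sum>J\<in>{J\<in>G. J \<subseteq> K}. increment f J)) = (\<Sum>J\<in>(\<Union>K\<in>F. {J\<in>G. J \<subseteq> K}). increment f J)"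
    proof (rule sum.UNION_disjoint[symmetric])
      show "\<forall>K\<in>F. \<forall>K'\<in>F. K \<noteq> K' \<longrightarrow> {J\<in>G. J \<subseteq> K} \<inter> {J\<in>G. J \<subseteq> K'} = {}"
      proof (intro ballI impI, rule ccontr)
        fix K K' assume K: "K \<in> F" "K' \<in> F" "K \<noteq> K'" "{J\<in>G. J \<subseteq> K} \<inter> {J\<in>G. J \<subseteq> K'} \<noteq> {}"
        then obtain J where J: "J \<in> G" "J \<subseteq> K" "J \<subseteq> K'" by blast
        then have "J \<noteq> {}" using G(2)[of J] by auto
        then obtain x where "x \<in> J" by blast
        then show False using disjF K J by blast
      qed
    qed (use F G in auto)
    also have "(\<Sum>K\<in>F. (\<Sum>L\<in>R K. increment f L)) = (\<Sum>L\<in>(\<Union>K\<in>F. R K). increment f L)"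
    proof (rule sum.UNION_disjoint[symmetric])
      show "\<forall>K\<in>F. finite (R K)" using fin by (auto simp: R_def)
      show "\<forall>K\<in>F. \<forall>K'\<in>F. K \<noteq> K' \<longrightarrow> R K \<inter> R K' = {}" using R_disj by blast
    qed (use F in auto)
    finally show "(\<Sum>K\<in>F. increment f K) = (\<Sum>J\<in>G. increment f J) + (\<Sum>L\<in>(\<Union>K\<in>F. R K). increment f L)"
      by (simp only: Geq[symmetric])
  qed
qed

lemma measure_Union_intervals:
  fixes F :: "real set set"
  assumes "finite F" "\<And>K. K \<in> F \<Longrightarrow> \<exists>u v. u \<le> v \<and> K = {u..v}" "pairwise disjnt F"
  shows "\<Union>F \<in> lmeasurable" "measure lebesgue (\<Union>F) = (\<Sum>K\<in>F. increment (\<lambda>x. x) K)"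
proof -
  have m: "K \<in> lmeasurable" if "K \<in> F" for K using assms(2)[OF that] by auto
  then show "\<Union>F \<in> lmeasurable" using assms(1) by (auto intro: fmeasurable.finite_Union)
  have "measure lebesgue (\<Union>F) = (\<Sum>K\<in>F. measure lebesgue K)"
    using measure_Union'[OF assms(1) m assms(3)] .
  also have "\<dots> = (\<Sum>K\<in>F. increment (\<lambda>x. x) K)"
    using assms(2) by (intro sum.cong refl) (auto intro: measure_Icc_eq_increment)
  finally show "measure lebesgue (\<Union>F) = (\<Sum>K\<in>F. increment (\<lambda>x. x) K)" .
qed

section \<open>Null sets of exceptional slopes\<close>

lemma open_interval_around:
  fixes x :: real
  assumes "open G" "x \<in> G" "d > 0"
  obtains e where "e > 0" "e \<le> d" "\<And>u v. u < x \<Longrightarrow> x < v \<Longrightarrow> v - u < e \<Longrightarrow> {u..v} \<subseteq> G"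
proof -
  obtain e where e: "e > 0" "ball x e \<subseteq> G" using assms openE by blast
  show thesis
    by (rule that[of "min e d"]) (use e assms(3) in \<open>auto simp: subset_iff dist_real_def abs_less_iff\<close>)
qed

text \<open>A bound in the style of Chebyshev: disjoint intervals of slope above N that nearly
  exhaust E have total increment at least N times their length, while B bounds this
  increment.\<close>

lemma measure_le_if_steep:
  assumes E: "E \<in> lmeasurable" "E \<subseteq> {a<..<b}" "E \<subseteq> high_slope f N" and N: "N > 0"
    and bound: "\<And>R. nonoverlapping_in a b R \<Longrightarrow> (\<Sum>K\<in>R. \<bar>increment f K\<bar>) \<le> B"
  shows "N * measure lebesgue E \<le> B"
proof (rule field_le_epsilon)
  fix e :: real assume e: "e > 0"
  obtain F where F: "finite F" "\<And>K. K \<in> F \<Longrightarrow> \<exists>u v. u < v \<and> K = {u..v} \<and>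
      (f v - f u > N * (v - u) \<and> {u..v} \<subseteq> {a<..<b})"
    "pairwise disjnt F" "measure lebesgue (E \<inter> \<Union>F) > measure lebesgue E - e / N"
  proof (rule Vitali_covering_intervals[OF E(1), of "e / N" "\<lambda>u v. f v - f u > N * (v - u) \<and> {u..v} \<subseteq> {a<..<b}"])
    show "e / N > 0" using e N by simp
    fix x d :: real assume x: "x \<in> E" and d: "d > 0"
    obtain d' where d': "d' > 0" "d' \<le> d" "\<And>u v. u < x \<Longrightarrow> x < v \<Longrightarrow> v - u < d' \<Longrightarrow> {u..v} \<subseteq> {a<..<b}"
      using open_interval_around[of "{a<..<b}" x d] x E(2) d by (metis open_greaterThanLessThan subsetD)
    obtain u v where "u < x" "x < v" "v - u < d'" "f v - f u > N * (v - u)"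
      using E(3) x d'(1) unfolding high_slope_def by blast
    with d' show "\<exists>u v. u < x \<and> x < v \<and> v - u < d \<and> (f v - f u > N * (v - u) \<and> {u..v} \<subseteq> {a<..<b})"
      by (meson less_le_trans)
  qed blast
  have F': "\<exists>u v. u \<le> v \<and> K = {u..v}" if "K \<in> F" for K using F(2)[OF that] less_imp_le by blast
  note U = measure_Union_intervals[OF F(1) F' F(3)]
  have "N * (measure lebesgue E - e / N) \<le> N * measure lebesgue (\<Union>F)"
  proof -
    have "measure lebesgue (E \<inter> \<Union>F) \<le> measure lebesgue (\<Union>F)"
      by (rule measure_mono_fmeasurable) (use E(1) U(1) in auto)
    with F(4) N show ?thesis by (intro mult_left_mono) auto
  qed
  also have "\<dots> = (\<Sum>K\<in>F. N * increment (\<lambda>x. x) K)" using U(2) by (simp add: sum_distrib_left)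
  also have "\<dots> \<le> (\<Sum>K\<in>F. \<bar>increment f K\<bar>)"
  proof (rule sum_mono)
    fix K assume "K \<in> F"
    then obtain u v where "u < v" "K = {u..v}" "f v - f u > N * (v - u)" using F(2) by blast
    then show "N * increment (\<lambda>x. x) K \<le> \<bar>increment f K\<bar>" by simp
  qed
  also have "\<dots> \<le> B"
  proof (rule bound)
    have "K \<subseteq> {a..b}" if "K \<in> F" for K
      using F(2)[OF that] by fastforce
    moreover have "interior K \<inter> interior L = {}" if "K \<in> F" "L \<in> F" "K \<noteq> L" for K L
    proof -
      have "K \<inter> L = {}" using F(3) that by (auto simp: pairwise_def disjnt_def)
      then show ?thesis using interior_subset by blast
    qed
    ultimately show "nonoverlapping_in a b F" unfolding nonoverlapping_in_def using F(1) F' by blast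
  qed
  finally show "N * measure lebesgue E \<le> B + e" using N by (simp add: right_diff_distrib)
qed

lemma lmeasurable_Int_interval:
  fixes A :: "real set"
  assumes "A \<in> sets borel" shows "A \<inter> {a<..<b} \<in> lmeasurable"
proof -
  have "{a<..<b} \<inter> A \<in> lmeasurable"
    by (rule fmeasurable_Int_fmeasurable) (use assms in auto)
  then show ?thesis by (simp add: Int_commute)
qed

text \<open>For every N > 0 the set is covered by the points of slope above N and those of slope
  below -N, each of measure at most B / N; the latter are points of high slope for -f.\<close>

lemma negligible_infinite_slope:
  assumes bound: "\<And>R. nonoverlapping_in a b R \<Longrightarrow> (\<Sum>K\<in>R. \<bar>increment f K\<bar>) \<le> B"
  shows "negligible ((\<Inter>N. low_slope f (- real N) \<union> high_slope f (real N)) \<inter> {a<..<b})"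
proof -
  let ?E = "(\<Inter>N. low_slope f (- real N) \<union> high_slope f (real N)) \<inter> {a<..<b}"
  have meas: "?E \<in> lmeasurable" by (rule lmeasurable_Int_interval) auto
  have "real N * measure lebesgue ?E \<le> 2 * B" if N: "N > 0" for N
  proof -
    have H: "high_slope f N \<inter> {a<..<b} \<in> lmeasurable" "low_slope f (- real N) \<inter> {a<..<b} \<in> lmeasurable"
      by (rule lmeasurable_Int_interval; simp)+
    have "real N * measure lebesgue (high_slope f N \<inter> {a<..<b}) \<le> B"
      by (rule measure_le_if_steep[OF H(1), where f = f]) (use N bound in auto)
    moreover have "real N * measure lebesgue (low_slope f (- real N) \<inter> {a<..<b}) \<le> B"
    proof (rule measure_le_if_steep[OF H(2), where f = "\<lambda>x. - f x"])
      fix R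
      assume "nonoverlapping_in a b R"
      then have "(\<Sum>K\<in>R. \<bar>increment f K\<bar>) \<le> B" by (rule bound)
      then show "(\<Sum>K\<in>R. \<bar>increment (\<lambda>x. - f x) K\<bar>) \<le> B"
        by (simp add: increment_def abs_minus_commute)
    qed (use N in \<open>auto simp: high_slope_eq\<close>)
    moreover have "measure lebesgue ?E \<le>
        measure lebesgue (high_slope f N \<inter> {a<..<b} \<union> low_slope f (- real N) \<inter> {a<..<b})"
      by (rule measure_mono_fmeasurable) (use meas H in \<open>auto intro: fmeasurable.Un\<close>)
    moreover have "\<dots> \<le> measure lebesgue (high_slope f N \<inter> {a<..<b}) + measure lebesgue (low_slope f (- real N) \<inter> {a<..<b})"
      by (rule measure_Un_le) (use H in auto)
    ultimately have "real N * measure lebesgue ?E \<le> real N * (measure lebesgue (high_slope f N \<inter> {a<..<b}) + measure lebesgue (low_slope f (- real N) \<inter> {a<..<b}))"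
      by (intro mult_left_mono) auto
    with \<open>real N * measure lebesgue (high_slope f N \<inter> {a<..<b}) \<le> B\<close>
      \<open>real N * measure lebesgue (low_slope f (- real N) \<inter> {a<..<b}) \<le> B\<close>
    show ?thesis by (simp add: distrib_left)
  qed
  have "measure lebesgue ?E \<le> 0"
  proof (rule ccontr)
    assume "\<not> measure lebesgue ?E \<le> 0"
    then obtain N where "2 * B < real N * measure lebesgue ?E" by (metis not_le reals_Archimedean3)
    \<comment> \<open>The empty family shows that B is non-negative, which excludes N = 0.\<close>
    moreover have "0 \<le> B" using bound[of "{}"] by (simp add: nonoverlapping_in_def)
    ultimately show False using \<open>\<And>N. N > 0 \<Longrightarrow> real N * measure lebesgue ?E \<le> 2 * B\<close>[of N]
      by (cases "N = 0") auto
  qed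
  with meas show ?thesis
    by (simp add: negligible_iff_measure order_antisym[OF _ measure_nonneg])
qed

lemma negligible_oscillating_slope:
  assumes ac: "abs_continuous_on_interval a b f" and pr: "p < r"
  shows "negligible (low_slope f p \<inter> high_slope f r \<inter> {a<..<b})"
proof -
  define E where "E = low_slope f p \<inter> high_slope f r \<inter> {a<..<b}"
  have E: "E \<in> lmeasurable" unfolding E_def by (rule lmeasurable_Int_interval) auto
  define m where "m = measure lebesgue E"
  have "m \<le> 0"
  proof (rule ccontr)
    assume "\<not> m \<le> 0"
    then have m: "m > 0" by simp
    then have "(r - p) * m / 4 > 0" using pr by simp
    from abs_continuous_on_intervalD[OF ac this] obtain \<delta> where \<delta>: "\<delta> > 0"
      "\<And>R. nonoverlapping_in a b R \<Longrightarrow> (\<Sum>K\<in>R. increment (\<lambda>x. x) K) < \<delta> \<Longrightarrow> (\<Sum>K\<in>R. \<bar>increment f K\<bar>) < (r - p) * m / 4"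
      by blast
    \<comment> \<open>The gaps will have total length below 3e, so the first bound makes their
      increments small. The second keeps the total length of the low intervals above m/2. The third
      bounds r times the gap length by (r - p) * m / 4 in absolute value; the summand 1 covers r =
      0.\<close>
    define e where "e = min (\<delta> / 3) (min (m / 4) ((r - p) * m / (12 * (\<bar>r\<bar> + 1))))"
    have e: "e > 0" "3 * e \<le> \<delta>" "e \<le> m / 4" "e \<le> (r - p) * m / (12 * (\<bar>r\<bar> + 1))"
      using \<delta>(1) m pr unfolding e_def by (simp, linarith, linarith, linarith)
    obtain T where T: "open T" "E \<subseteq> T" "T - E \<in> lmeasurable" "emeasure lebesgue (T - E) < ennreal e"
      using sets_lebesgue_outer_open[OF fmeasurableD[OF E] e(1)] .
    \<comment> \<open>Disjoint intervals inside G have total length below m + e, and they stay where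
      the absolute continuity of f is known.\<close>
    define G where "G = T \<inter> {a<..<b}"
    have G: "open G" "E \<subseteq> G" "G \<subseteq> {a<..<b}" using T by (auto simp: G_def E_def)
    have Gm: "G \<in> lmeasurable" unfolding G_def using T(1) by (intro lmeasurable_Int_interval) auto
    have "measure lebesgue G < m + e"
    proof -
      have "measure lebesgue G \<le> measure lebesgue (E \<union> (T - E))"
        by (rule measure_mono_fmeasurable) (use Gm fmeasurable.Un[OF E T(3)] in \<open>auto simp: G_def\<close>)
      also have "\<dots> \<le> measure lebesgue E + measure lebesgue (T - E)"
        by (rule measure_Un_le) (use E T(3) in auto)
      also have "measure lebesgue (T - E) < e"
        using T(3,4) e(1) by (simp add: emeasure_eq_measure2 ennreal_less_iff)
      finally show ?thesis by (simp add: m_def)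
    qed
    obtain F where F: "finite F" "\<And>K. K \<in> F \<Longrightarrow> \<exists>u v. u < v \<and> K = {u..v} \<and>
        (f v - f u > r * (v - u) \<and> {u..v} \<subseteq> G)"
      "pairwise disjnt F" "measure lebesgue (E \<inter> \<Union>F) > measure lebesgue E - e"
    proof (rule Vitali_covering_intervals[OF E e(1), of "\<lambda>u v. f v - f u > r * (v - u) \<and> {u..v} \<subseteq> G"])
      fix x d :: real assume x: "x \<in> E" and d: "d > 0"
      obtain d' where d': "d' > 0" "d' \<le> d" "\<And>u v. u < x \<Longrightarrow> x < v \<Longrightarrow> v - u < d' \<Longrightarrow> {u..v} \<subseteq> G"
        using open_interval_around[OF G(1) _ d] x G(2) by (metis subsetD)
      have "x \<in> high_slope f r" using x by (simp add: E_def)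
      then obtain u v where "u < x" "x < v" "v - u < d'" "f v - f u > r * (v - u)"
        using d'(1) unfolding high_slope_def by blast
      with d' show "\<exists>u v. u < x \<and> x < v \<and> v - u < d \<and> (f v - f u > r * (v - u) \<and> {u..v} \<subseteq> G)"
        by (meson less_le_trans)
    qed blast
    have F': "\<exists>u v. u \<le> v \<and> K = {u..v}" if "K \<in> F" for K using F(2)[OF that] less_imp_le by blast
    note UF = measure_Union_intervals[OF F(1) F' F(3)]
    \<comment> \<open>Interior points leave room for small intervals inside a member of F; only
      finitely many end points are lost.\<close>
    define E1 where "E1 = E \<inter> (\<Union>K\<in>F. interior K)"
    have op: "open (\<Union>K\<in>F. interior K)" by auto
    have E1: "E1 \<in> lmeasurable" unfolding E1_def
      by (rule fmeasurable_Int_fmeasurable[OF E]) (use op in auto)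
    have "measure lebesgue E1 = measure lebesgue (E \<inter> \<Union>F)"
    proof (rule measure_negligible_symdiff)
      show "E \<inter> \<Union>F \<in> lmeasurable" using E UF(1) by (rule fmeasurable.Int)
      have "negligible (K - interior K)" if K: "K \<in> F" for K
      proof -
        obtain u v where "K = {u..v}" using F'[OF K] by blast
        then have "K - interior K \<subseteq> {u, v}" by auto
        then show ?thesis by (meson finite.emptyI finite.insertI finite_subset negligible_finite)
      qed
      then have "negligible (\<Union>K\<in>F. K - interior K)" using F(1) by (intro negligible_Union) auto
      then show "negligible (E \<inter> \<Union> F - E1 \<union> (E1 - E \<inter> \<Union> F))"
        by (rule negligible_subset) (use interior_subset in \<open>auto simp: E1_def\<close>)
    qed
    with F(4) have mE1: "measure lebesgue E1 > m - e" by (simp add: m_def)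
    obtain H where H: "finite H" "\<And>J. J \<in> H \<Longrightarrow> \<exists>u v. u < v \<and> J = {u..v} \<and>
        (f v - f u < p * (v - u) \<and> (\<exists>K\<in>F. {u..v} \<subseteq> K))"
      "pairwise disjnt H" "measure lebesgue (E1 \<inter> \<Union>H) > measure lebesgue E1 - e"
    proof (rule Vitali_covering_intervals[OF E1 e(1), of "\<lambda>u v. f v - f u < p * (v - u) \<and> (\<exists>K\<in>F. {u..v} \<subseteq> K)"])
      fix x d :: real assume x: "x \<in> E1" and d: "d > 0"
      then obtain K where K: "K \<in> F" "x \<in> interior K" by (auto simp: E1_def)
      obtain d' where d': "d' > 0" "d' \<le> d" "\<And>u v. u < x \<Longrightarrow> x < v \<Longrightarrow> v - u < d' \<Longrightarrow> {u..v} \<subseteq> interior K"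
        using open_interval_around[OF open_interior K(2) d] by metis
      have "x \<in> low_slope f p" using x by (simp add: E_def E1_def)
      then obtain u v where uv: "u < x" "x < v" "v - u < d'" "f v - f u < p * (v - u)"
        using d'(1) unfolding low_slope_def by blast
      moreover have "{u..v} \<subseteq> K" using d'(3)[OF uv(1-3)] interior_subset by blast
      ultimately show "\<exists>u v. u < x \<and> x < v \<and> v - u < d \<and> (f v - f u < p * (v - u) \<and> (\<exists>K\<in>F. {u..v} \<subseteq> K))"
        using d'(2) K(1) by (meson less_le_trans)
    qed blast
    have H': "\<exists>u v. u \<le> v \<and> J = {u..v}" if "J \<in> H" for J using H(2)[OF that] less_imp_le by blast
    have HF: "\<exists>K\<in>F. J \<subseteq> K" if "J \<in> H" for J using H(2)[OF that] by blast
    note UH = measure_Union_intervals[OF H(1) H' H(3)]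
    obtain R where R: "finite R" "\<And>L. L \<in> R \<Longrightarrow> \<exists>K\<in>F. L \<subseteq> K" "\<And>L. L \<in> R \<Longrightarrow> \<exists>u v. u \<le> v \<and> L = {u..v}"
      "\<And>K L. K \<in> R \<Longrightarrow> L \<in> R \<Longrightarrow> K \<noteq> L \<Longrightarrow> interior K \<inter> interior L = {}"
      "\<And>f. (\<Sum>K\<in>F. increment f K) = (\<Sum>J\<in>H. increment f J) + (\<Sum>L\<in>R. increment f L)"
      using extend_to_nonoverlapping[OF F(1) F' F(3) H(1) H' H(3) HF] by blast
    define LF LH where "LF = (\<Sum>K\<in>F. increment (\<lambda>x. x) K)" and "LH = (\<Sum>J\<in>H. increment (\<lambda>x. x) J)"
    have LF: "LF < m + e"
    proof -
      have "LF = measure lebesgue (\<Union>F)" using UF(2) by (simp add: LF_def)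
      also have "\<dots> \<le> measure lebesgue G"
        by (rule measure_mono_fmeasurable) (use UF(1) Gm F(2) in auto)
      finally show ?thesis using \<open>measure lebesgue G < m + e\<close> by simp
    qed
    have LH: "LH > m - 2 * e"
    proof -
      have "measure lebesgue (E1 \<inter> \<Union>H) \<le> measure lebesgue (\<Union>H)"
        by (rule measure_mono_fmeasurable) (use UH(1) E1 in auto)
      then show ?thesis using H(4) mE1 UH(2) by (simp add: LH_def)
    qed
    have RL: "(\<Sum>L\<in>R. increment (\<lambda>x. x) L) = LF - LH" using R(5)[of "\<lambda>x. x"] by (simp add: LF_def LH_def)
    have "(\<Sum>L\<in>R. \<bar>increment f L\<bar>) < (r - p) * m / 4"
    proof (rule \<delta>(2))
      have "L \<subseteq> {a..b}" if L: "L \<in> R" for L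
      proof -
        obtain K where "K \<in> F" "L \<subseteq> K" using R(2)[OF L] by blast
        moreover from this have "K \<subseteq> G" using F(2) by blast
        moreover have "{a<..<b} \<subseteq> {a..b}" by auto
        ultimately show ?thesis using G(3) by blast
      qed
      then show "nonoverlapping_in a b R" unfolding nonoverlapping_in_def using R(1,3,4) by blast
      show "(\<Sum>L\<in>R. increment (\<lambda>x. x) L) < \<delta>" unfolding RL using LF LH e(2) by linarith
    qed
    moreover have "(\<Sum>L\<in>R. increment f L) \<le> (\<Sum>L\<in>R. \<bar>increment f L\<bar>)" by (intro sum_mono) auto
    moreover have "(\<Sum>K\<in>F. increment f K) \<ge> r * LF"
      unfolding LF_def sum_distrib_left
    proof (rule sum_mono)
      fix K assume "K \<in> F"
      then obtain u v where "u < v" "K = {u..v}" "f v - f u > r * (v - u)" using F(2) by blast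
      then show "r * increment (\<lambda>x. x) K \<le> increment f K" by simp
    qed
    moreover have "(\<Sum>J\<in>H. increment f J) \<le> p * LH"
      unfolding LH_def sum_distrib_left
    proof (rule sum_mono)
      fix K assume "K \<in> H"
      then obtain u v where "u < v" "K = {u..v}" "f v - f u < p * (v - u)" using H(2) by blast
      then show "increment f K \<le> p * increment (\<lambda>x. x) K" by simp
    qed
    \<comment> \<open>The rise over F is the rise over H plus that over the gaps; the first is at
      least r times \<open>LF\<close>, the second at most p times \<open>LH\<close>. Both lengths
      lie within 2e of m, so the left side is close to (r - p) * m, a contradiction.\<close>
    ultimately have 1: "r * LF - p * LH < (r - p) * m / 4" using R(5)[of f] by linarith
    have nn: "LF - LH \<ge> 0" unfolding RL[symmetric]
    proof (rule sum_nonneg)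
      fix L assume "L \<in> R"
      then obtain u v where "u \<le> v" "L = {u..v}" using R(3) by blast
      then show "0 \<le> increment (\<lambda>x. x) L" by simp
    qed
    have "\<bar>r\<bar> * (LF - LH) \<le> \<bar>r\<bar> * (3 * e)" using LF LH by (intro mult_left_mono) auto
    moreover have "- (\<bar>r\<bar> * (LF - LH)) \<le> r * (LF - LH)"
      using mult_right_mono[OF _ nn, of "- \<bar>r\<bar>" r] by simp
    moreover have "\<bar>r\<bar> * (3 * e) \<le> (\<bar>r\<bar> + 1) * (3 * e)" using e(1) by (intro mult_right_mono) auto
    moreover have "(\<bar>r\<bar> + 1) * (3 * e) \<le> (r - p) * m / 4"
      using e(4) by (simp add: field_simps)
    moreover have "(r - p) * (m / 2) \<le> (r - p) * LH" using pr LH e(3) by (intro mult_left_mono) auto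
    moreover have "r * LF - p * LH = (r - p) * LH + r * (LF - LH)" by (simp add: algebra_simps)
    moreover have "(r - p) * (m / 2) = (r - p) * m / 2" by simp
    ultimately show False using 1 by linarith
  qed
  then show ?thesis using E unfolding m_def E_def
    by (simp add: negligible_iff_measure order_antisym[OF _ measure_nonneg])
qed

section \<open>The fundamental theorem of calculus for absolutely continuous functions\<close>

text \<open>The relation is stated by integrals instead of derivatives, so that the top derivative
  of a member of \<open>class_A\<close> qualifies as well as the continuous ones below it.\<close>

definition has_primitive :: "(real \<Rightarrow> real) \<Rightarrow> (real \<Rightarrow> real) \<Rightarrow> bool" where
  "has_primitive \<phi> \<Phi> \<longleftrightarrow> \<phi> \<in> borel_measurable borel \<and> continuous_on UNIV \<Phi> \<and>
    (\<forall>a b. a \<le> b \<longrightarrow> set_integrable lborel {a..b} \<phi> \<and> (LINT x:{a..b}|lborel. \<phi> x) = \<Phi> b - \<Phi> a)"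

lemma has_primitiveD:
  assumes "has_primitive \<phi> \<Phi>"
  shows "\<phi> \<in> borel_measurable borel" "continuous_on UNIV \<Phi>"
    "a \<le> b \<Longrightarrow> set_integrable lborel {a..b} \<phi>"
    "a \<le> b \<Longrightarrow> (LINT x:{a..b}|lborel. \<phi> x) = \<Phi> b - \<Phi> a"
  using assms unfolding has_primitive_def by auto

lemma has_primitive_continuous:
  assumes "continuous_on UNIV \<phi>" "\<And>x. (\<Phi> has_real_derivative \<phi> x) (at x)"
  shows "has_primitive \<phi> \<Phi>"
  unfolding has_primitive_def
proof (intro conjI allI impI)
  show "\<phi> \<in> borel_measurable borel" using assms(1) by (rule borel_measurable_continuous_onI)
  show "continuous_on UNIV \<Phi>" using assms(2) by (meson DERIV_isCont continuous_at_imp_continuous_on)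
  fix a b :: real assume ab: "a \<le> b"
  have c: "continuous_on {a..b} \<phi>" using assms(1) continuous_on_subset by blast
  then show "set_integrable lborel {a..b} \<phi>" by (rule borel_integrable_atLeastAtMost')
  then show "(LINT x:{a..b}|lborel. \<phi> x) = \<Phi> b - \<Phi> a"
    using integral_FTC_Icc[of a b \<Phi> \<phi>, OF ab _ c] assms(2)
    by (simp add: set_lebesgue_integral_def has_real_derivative_iff_has_vector_derivative has_vector_derivative_at_within)
qed

text \<open>Supplies the primitives that the symmetry of simplex integrals asks for at every level
  of its induction.\<close>

lemma continuous_has_primitive:
  fixes \<phi> :: "real \<Rightarrow> real"
  assumes "continuous_on UNIV \<phi>"
  obtains \<Phi> where "has_primitive \<phi> \<Phi>"
proof -
  obtain \<Phi> where "\<And>x. (\<Phi> has_vector_derivative \<phi> x) (at x)"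
    using einterval_antiderivative[of "- \<infinity>" "\<infinity>" \<phi>] assms continuous_on_eq_continuous_at[of UNIV \<phi>]
    by auto
  then have "has_primitive \<phi> \<Phi>"
    by (intro has_primitive_continuous[OF assms]) (simp add: has_real_derivative_iff_has_vector_derivative)
  then show thesis by (rule that)
qed

section \<open>Almost everywhere differentiability and integration of the derivative\<close>

lemma nonoverlapping_inI:
  assumes "finite R" "\<And>K. K \<in> R \<Longrightarrow> K \<subseteq> {a..b}" "\<And>K. K \<in> R \<Longrightarrow> \<exists>u v. u \<le> v \<and> K = {u..v}"
    "\<And>K L. K \<in> R \<Longrightarrow> L \<in> R \<Longrightarrow> K \<noteq> L \<Longrightarrow> interior K \<inter> interior L = {}"
  shows "nonoverlapping_in a b R"
  unfolding nonoverlapping_in_def by (intro conjI ballI impI assms)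

lemma abs_continuous_imp_continuous:
  assumes "\<And>a b. a \<le> b \<Longrightarrow> abs_continuous_on_interval a b f"
  shows "continuous_on UNIV f"
proof (intro continuous_at_imp_continuous_on ballI)
  fix x :: real
  show "isCont f x" unfolding continuous_at_eps_delta
  proof (intro allI impI)
    fix e :: real assume "e > 0"
    then obtain d where d: "d > 0" "\<And>(m::nat) u v. (\<forall>i<m. x - 1 \<le> u i \<and> u i \<le> v i \<and> v i \<le> x + 1) \<Longrightarrow>
      disjoint_family_on (\<lambda>i. {u i<..<v i}) {..<m} \<Longrightarrow>
      (\<Sum>i<m. v i - u i) < d \<Longrightarrow> (\<Sum>i<m. \<bar>f (v i) - f (u i)\<bar>) < e"
      using assms[of "x - 1" "x + 1"] unfolding abs_continuous_on_interval_def by force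
    \<comment> \<open>The family consists of the single interval between x and y.\<close>
    have "\<bar>f y - f x\<bar> < e" if "\<bar>y - x\<bar> < min d 1" for y
      using d(2)[of 1 "\<lambda>_. min x y" "\<lambda>_. max x y"] that
      by (cases "x \<le> y") (auto simp: disjoint_family_on_def abs_minus_commute)
    then show "\<exists>d>0. \<forall>y. dist y x < d \<longrightarrow> dist (f y) (f x) < e"
      using d(1) by (intro exI[of _ "min d 1"]) (auto simp: dist_real_def)
  qed
qed

lemma negligible_countable_UN:
  assumes "countable A" "\<And>x. x \<in> A \<Longrightarrow> negligible (S x)"
  shows "negligible (\<Union>x\<in>A. S x)"
  using assms by (intro negligible_countable_Union) auto

text \<open>Being negligible is a local property. On an interval shorter than the \<delta> belonging
  to \<epsilon> = 1, every non-overlapping family has variation at most 1, which is the bound that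
  \<open>negligible_infinite_slope\<close> requires.\<close>

lemma negligible_non_differentiable:
  assumes ac: "\<And>a b. a \<le> b \<Longrightarrow> abs_continuous_on_interval a b f"
  shows "negligible {x. \<not> f field_differentiable (at x)}"
proof (rule locally_negligible_alt[THEN iffD2], rule ballI)
  fix x :: real assume x: "x \<in> {x. \<not> f field_differentiable (at x)}"
  have ac1: "abs_continuous_on_interval (x - 1) (x + 1) f" by (rule ac) simp
  obtain d where d: "d > 0" "\<And>R. nonoverlapping_in (x - 1) (x + 1) R \<Longrightarrow>
      (\<Sum>K\<in>R. increment (\<lambda>x. x) K) < d \<Longrightarrow> (\<Sum>K\<in>R. \<bar>increment f K\<bar>) < 1"
    using abs_continuous_on_intervalD[OF ac1 zero_less_one] by blast
  define h where "h = min 1 (d / 3)"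
  have h: "h > 0" "h \<le> 1" "2 * h < d" using d(1) by (auto simp: h_def)
  let ?a = "x - h" and ?b = "x + h"
  have bound: "(\<Sum>K\<in>R. \<bar>increment f K\<bar>) \<le> 1" if R: "nonoverlapping_in ?a ?b R" for R
  proof -
    have "nonoverlapping_in (x - 1) (x + 1) R" using R h(2) unfolding nonoverlapping_in_def
      by (meson atLeastatMost_subset_iff diff_left_mono add_left_mono order_trans)
    moreover have "(\<Sum>K\<in>R. increment (\<lambda>x. x) K) < d"
    proof -
      have K: "\<exists>u v. u \<le> v \<and> K = {u..v}" if "K \<in> R" for K
        using R that unfolding nonoverlapping_in_def by blast
      have "(\<Sum>K\<in>R. increment (\<lambda>x. x) K) = (\<Sum>K\<in>R. measure lborel K)"
        using K by (intro sum.cong refl) force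
      also have "\<dots> \<le> measure lborel (cbox ?a ?b)"
      proof (rule subadditive_content_division)
        show "R division_of \<Union>R"
          by (rule division_ofI) (use R K in \<open>auto simp: nonoverlapping_in_def, force, force\<close>)
        show "\<Union>R \<subseteq> cbox ?a ?b" using R by (auto simp: nonoverlapping_in_def)
      qed
      also have "\<dots> < d" using h by simp
      finally show ?thesis .
    qed
    ultimately show ?thesis using d(2) by force
  qed
  have neg1: "negligible ((\<Inter>N. low_slope f (- real N) \<union> high_slope f (real N)) \<inter> {?a<..<?b})"
    by (rule negligible_infinite_slope[OF bound])
  have neg2: "negligible (\<Union>p\<in>\<rat>. \<Union>r\<in>\<rat> \<inter> {p<..}. low_slope f p \<inter> high_slope f r \<inter> {?a<..<?b})"
  proof (rule negligible_countable_UN[OF countable_rat])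
    fix p :: real
    show "negligible (\<Union>r\<in>\<rat> \<inter> {p<..}. low_slope f p \<inter> high_slope f r \<inter> {?a<..<?b})"
    proof (rule negligible_countable_UN[OF countable_Int1[OF countable_rat]])
      fix r :: real assume "r \<in> \<rat> \<inter> {p<..}"
      then have "p < r" by simp
      have "?a \<le> ?b" using h by simp
      from negligible_oscillating_slope[OF ac[OF this] \<open>p < r\<close>]
      show "negligible (low_slope f p \<inter> high_slope f r \<inter> {?a<..<?b})" .
    qed
  qed
  have "{x. \<not> f field_differentiable (at x)} \<inter> {?a<..<?b} =
    ((\<Inter>N. low_slope f (- real N) \<union> high_slope f (real N)) \<inter> {?a<..<?b}) \<union>
    (\<Union>p\<in>\<rat>. \<Union>r\<in>\<rat> \<inter> {p<..}. low_slope f p \<inter> high_slope f r \<inter> {?a<..<?b})"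
    by (simp only: non_differentiable_eq[OF abs_continuous_imp_continuous[OF ac]] Int_Un_distrib2 UN_simps)
  then have "negligible ({x. \<not> f field_differentiable (at x)} \<inter> {?a<..<?b})"
    using negligible_Un[OF neg1 neg2] by (simp only:)
  moreover have "openin (top_of_set {x. \<not> f field_differentiable (at x)})
      ({x. \<not> f field_differentiable (at x)} \<inter> {?a<..<?b})"
    by (rule openin_open_Int) auto
  ultimately show "\<exists>U. openin (top_of_set {x. \<not> f field_differentiable (at x)}) U \<and> x \<in> U \<and> negligible U"
    using x h(1) by (intro exI[of _ "{x. \<not> f field_differentiable (at x)} \<inter> {?a<..<?b}"]) auto
qed

text \<open>The gauge integral allows a direct proof. At tags where f is differentiable, the
  increment is close to the derivative times the length; intervals with tags in N are confined to an
  open set so small that absolute continuity makes their increments negligible.\<close>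

lemma deriv_has_integral:
  assumes ac: "\<And>a b. a \<le> b \<Longrightarrow> abs_continuous_on_interval a b f" and ab: "a \<le> b"
  shows "(deriv f has_integral f b - f a) {a..b}"
proof -
  define N where "N = {x. \<not> f field_differentiable (at x)}"
  have negN: "negligible N" unfolding N_def by (rule negligible_non_differentiable[OF ac])
  \<comment> \<open>With value 0 on N the Riemann terms with tags in N vanish, and only increments
    of f are left there.\<close>
  define \<phi> where "\<phi> x = (if x \<in> N then 0 else deriv f x)" for x
  have "(\<phi> has_integral f b - f a) {a..b}"
    unfolding has_integral_real
  proof (intro allI impI)
    fix e :: real assume e: "e > 0"
    obtain \<delta> where \<delta>: "\<delta> > 0" "\<And>R. nonoverlapping_in a b R \<Longrightarrow>
        (\<Sum>K\<in>R. increment (\<lambda>x. x) K) < \<delta> \<Longrightarrow> (\<Sum>K\<in>R. \<bar>increment f K\<bar>) < e / 2"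
      using abs_continuous_on_intervalD[OF ac[OF ab] half_gt_zero[OF e]] by blast
    obtain G where G: "open G" "N \<subseteq> G" "G - N \<in> lmeasurable" "emeasure lebesgue (G - N) < ennreal \<delta>"
      using sets_lebesgue_outer_open[OF negligible_imp_sets[OF negN] \<delta>(1)] .
    have Gm: "G \<in> lmeasurable"
      using G negN by (metis Diff_partition fmeasurable.Un negligible_imp_measurable)
    have mG: "measure lebesgue G < \<delta>"
    proof -
      have "measure lebesgue G = measure lebesgue (G - N)"
        using measure_Diff_null_set[of G lebesgue N] negN Gm by (simp add: negligible_iff_null_sets fmeasurableD)
      then show ?thesis using G(3,4) \<delta>(1) by (simp add: emeasure_eq_measure2 ennreal_less_iff)
    qed
    \<comment> \<open>Chosen so that errors adding up to c * (b - a) stay below e/2, also for a =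
      b.\<close>
    define c where "c = e / (2 * (b - a + 1))"
    have c: "c > 0" "c * (b - a) < e / 2"
      using e ab by (auto simp: c_def field_simps)
    have "\<exists>d>0. \<forall>u v. u \<le> x \<longrightarrow> x \<le> v \<longrightarrow> v - u < d \<longrightarrow> \<bar>f v - f u - deriv f x * (v - u)\<bar> \<le> c * (v - u)"
      if "x \<notin> N" for x
    proof -
      have "(f has_real_derivative deriv f x) (at x)"
        using that by (simp add: N_def DERIV_deriv_iff_field_differentiable)
      from DERIV_straddle[OF this c(1)] show ?thesis by metis
    qed
    then obtain d where d: "\<And>x. x \<notin> N \<Longrightarrow> d x > 0"
      "\<And>x u v. x \<notin> N \<Longrightarrow> u \<le> x \<Longrightarrow> x \<le> v \<Longrightarrow> v - u < d x \<Longrightarrow> \<bar>f v - f u - deriv f x * (v - u)\<bar> \<le> c * (v - u)"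
      by metis
    define \<gamma> where "\<gamma> x = (if x \<in> N then G else ball x (d x / 2))" for x
    have "gauge \<gamma>" unfolding gauge_def \<gamma>_def using G d(1) by auto
    moreover have "norm ((\<Sum>(x,k)\<in>\<D>. measure lborel k *\<^sub>R \<phi> x) - (f b - f a)) < e"
      if \<D>: "\<D> tagged_division_of {a..b}" "\<gamma> fine \<D>" for \<D>
    proof -
      note T = tagged_division_ofD[OF \<D>(1)]
      have form: "\<exists>u v. u \<le> x \<and> x \<le> v \<and> K = {u..v}" if "(x, K) \<in> \<D>" for x K
        using T(2)[OF that] T(4)[OF that] by auto
      define \<D>1 where "\<D>1 = {(x, K) \<in> \<D>. x \<in> N}"
      have sub: "\<D>1 \<subseteq> \<D>" by (auto simp: \<D>1_def)
      have fin: "finite \<D>" "finite \<D>1" using T(1) finite_subset[OF sub] by auto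
      have ne: "(x, {}) \<notin> \<D>1" for x using T(2)[of x "{}"] sub by auto
      have "f b - f a = (\<Sum>(x,K)\<in>\<D>. increment f K)"
        using additive_tagged_division_1[OF ab \<D>(1), of f] by (simp add: increment_def)
      then have "(\<Sum>(x,k)\<in>\<D>. measure lborel k *\<^sub>R \<phi> x) - (f b - f a) = (\<Sum>(x,k)\<in>\<D>. measure lborel k *\<^sub>R \<phi> x - increment f k)"
        by (simp add: sum_subtractf split_def)
      also have "\<bar>\<dots>\<bar> \<le> (\<Sum>(x,k)\<in>\<D>. \<bar>measure lborel k *\<^sub>R \<phi> x - increment f k\<bar>)"
        unfolding split_def by (rule sum_abs)
      also have "\<dots> = (\<Sum>(x,k)\<in>\<D> - \<D>1. \<bar>measure lborel k *\<^sub>R \<phi> x - increment f k\<bar>) + (\<Sum>(x,k)\<in>\<D>1. \<bar>measure lborel k *\<^sub>R \<phi> x - increment f k\<bar>)"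
        by (rule sum.subset_diff[OF sub fin(1)])
      also have "(\<Sum>(x,k)\<in>\<D> - \<D>1. \<bar>measure lborel k *\<^sub>R \<phi> x - increment f k\<bar>) \<le> (\<Sum>(x,k)\<in>\<D> - \<D>1. c * measure lborel k)"
      proof (rule sum_mono, clarify)
        fix x K assume xK: "(x, K) \<in> \<D>" "(x, K) \<notin> \<D>1"
        then have x: "x \<notin> N" by (auto simp: \<D>1_def)
        obtain u v where uv: "u \<le> x" "x \<le> v" "K = {u..v}" using form[OF xK(1)] by blast
        have "K \<subseteq> ball x (d x / 2)" using \<D>(2) xK(1) x unfolding fine_def \<gamma>_def by fastforce
        moreover have "u \<in> K" "v \<in> K" using uv by auto
        ultimately have "\<bar>u - x\<bar> < d x / 2" "\<bar>v - x\<bar> < d x / 2"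
          by (auto simp: dist_real_def abs_minus_commute subset_iff)
        then have "\<bar>f v - f u - deriv f x * (v - u)\<bar> \<le> c * (v - u)"
          using uv by (intro d(2)[OF x]) auto
        then show "\<bar>measure lborel K *\<^sub>R \<phi> x - increment f K\<bar> \<le> c * measure lborel K"
          using uv x by (simp add: \<phi>_def abs_minus_commute mult.commute)
      qed
      also have "\<dots> \<le> (\<Sum>(x,k)\<in>\<D>. c * measure lborel k)"
        by (rule sum_mono2) (use fin c(1) in auto)
      also have "\<dots> = c * (b - a)"
        using additive_content_tagged_division[of \<D> a b] \<D>(1) ab
        by (simp add: split_def sum_distrib_left[symmetric])
      also have "(\<Sum>(x,k)\<in>\<D>1. \<bar>measure lborel k *\<^sub>R \<phi> x - increment f k\<bar>) = (\<Sum>(x,k)\<in>\<D>1. \<bar>increment f k\<bar>)"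
        by (rule sum.cong) (auto simp: \<D>1_def \<phi>_def)
      \<comment> \<open>Passing from tagged pairs to a set of intervals requires the value 0 on all
        boxes with empty interior. The increment of the empty set involves its unspecified supremum,
        hence the case distinction.\<close>
      also have "\<dots> = (\<Sum>(x,k)\<in>\<D>1. if k = {} then 0 else \<bar>increment f k\<bar>)"
        using ne by (intro sum.cong) auto
      also have "\<dots> = (\<Sum>k\<in>snd ` \<D>1. if k = {} then 0 else \<bar>increment f k\<bar>)"
      proof (rule sum.over_tagged_division_lemma)
        show "\<D>1 tagged_division_of \<Union>(snd ` \<D>1)"
          using tagged_partial_division_subset[OF _ sub] \<D>(1)
          by (intro tagged_partial_division_of_Union_self) (auto simp: tagged_division_of_def)
        show "(if cbox u v = {} then 0 else \<bar>increment f (cbox u v)\<bar>) = 0" if "box u v = {}" for u v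
          using that by (cases "u = v") (auto simp: increment_def)
      qed
      also have "\<dots> = (\<Sum>k\<in>snd ` \<D>1. \<bar>increment f k\<bar>)"
        using ne by (intro sum.cong) auto
      also have "\<dots> < e / 2"
      proof (rule \<delta>(2))
        have form': "\<exists>u v. u \<le> v \<and> K = {u..v}" if "K \<in> snd ` \<D>1" for K
          using form sub that by fastforce
        have no: "interior K \<inter> interior L = {}" if KL: "K \<in> snd ` \<D>1" "L \<in> snd ` \<D>1" "K \<noteq> L" for K L
        proof -
          obtain x y where "(x, K) \<in> \<D>1" "(y, L) \<in> \<D>1" using KL(1,2) by auto
          with sub have "(x, K) \<in> \<D>" "(y, L) \<in> \<D>" by auto
          then show ?thesis using T(5) KL(3) by blast
        qed
        have "K \<subseteq> {a..b}" if "K \<in> snd ` \<D>1" for K using T(3) sub that by fastforce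
        then show "nonoverlapping_in a b (snd ` \<D>1)"
          using form' no fin by (intro nonoverlapping_inI) simp_all
        have div: "snd ` \<D>1 division_of \<Union>(snd ` \<D>1)"
          using tagged_partial_division_subset[OF _ sub] \<D>(1)
          by (intro division_of_tagged_division tagged_partial_division_of_Union_self) (auto simp: tagged_division_of_def)
        have "(\<Sum>K\<in>snd ` \<D>1. increment (\<lambda>x. x) K) = (\<Sum>K\<in>snd ` \<D>1. measure lebesgue K)"
          using form' by (intro sum.cong refl) force
        also have "\<dots> = measure lebesgue (\<Union>(snd ` \<D>1))" by (rule content_division[OF div])
        also have "\<dots> \<le> measure lebesgue G"
        proof (rule measure_mono_fmeasurable[OF _ _ Gm])
          show "\<Union>(snd ` \<D>1) \<subseteq> G" using \<D>(2) unfolding fine_def \<gamma>_def \<D>1_def by fastforce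
          show "\<Union>(snd ` \<D>1) \<in> sets lebesgue" using lmeasurable_division[OF div] by blast
        qed
        finally show "(\<Sum>K\<in>snd ` \<D>1. increment (\<lambda>x. x) K) < \<delta>" using mG by simp
      qed
      finally show ?thesis using c(2) by simp
    qed
    ultimately show "\<exists>\<gamma>. gauge \<gamma> \<and> (\<forall>\<D>. \<D> tagged_division_of {a..b} \<and> \<gamma> fine \<D> \<longrightarrow>
        norm ((\<Sum>(x,k)\<in>\<D>. measure lborel k *\<^sub>R \<phi> x) - (f b - f a)) < e)"
      by (intro exI[of _ \<gamma>] conjI allI impI) simp_all
  qed
  then show ?thesis
    by (rule has_integral_spike[OF negN, rotated]) (auto simp: \<phi>_def)
qed

text \<open>On an interval shorter than d, the gauge integrals over the pieces of any division are
  increments of f with absolute sum below 1, and bounded variation gives absolute integrability.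
  Finitely many such intervals cover [a, b].\<close>

lemma set_integrable_deriv:
  assumes ac: "\<And>a b. a \<le> b \<Longrightarrow> abs_continuous_on_interval a b f" and ab: "a \<le> b"
  shows "set_integrable lborel {a..b} (deriv f)"
proof -
  have meas: "deriv f \<in> borel_measurable borel"
    by (rule borel_measurable_deriv[OF abs_continuous_imp_continuous[OF ac]])
  obtain d where d: "d > 0" "\<And>R. nonoverlapping_in a b R \<Longrightarrow>
      (\<Sum>K\<in>R. increment (\<lambda>x. x) K) < d \<Longrightarrow> (\<Sum>K\<in>R. \<bar>increment f K\<bar>) < 1"
    using abs_continuous_on_intervalD[OF ac[OF ab] zero_less_one] by blast
  have short: "set_integrable lborel {u..v} (deriv f)" if uv: "a \<le> u" "u \<le> v" "v \<le> b" "v - u < d" for u v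
  proof -
    have "deriv f absolutely_integrable_on cbox u v"
    proof (rule bounded_variation_absolutely_integrable_interval[where B = 1])
      show "deriv f integrable_on cbox u v" using deriv_has_integral[OF ac uv(2)] by auto
      fix D assume D: "D division_of cbox u v"
      have K: "\<exists>u v. u \<le> v \<and> K = {u..v}" if "K \<in> D" for K
        using division_ofD(3,4)[OF D that] by (metis atLeastatMost_empty_iff box_real(2))
      have "(\<Sum>K\<in>D. norm (integral K (deriv f))) = (\<Sum>K\<in>D. \<bar>increment f K\<bar>)"
        using K integral_unique[OF deriv_has_integral[OF ac]] by (intro sum.cong refl) fastforce
      also have "\<dots> < 1"
      proof (rule d(2))
        show "nonoverlapping_in a b D"
        proof (rule nonoverlapping_inI)
          show "L \<subseteq> {a..b}" if "L \<in> D" for L using division_ofD(2)[OF D that] uv by auto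
        qed (use K division_ofD(1,5)[OF D] in simp_all)
        show "(\<Sum>K\<in>D. increment (\<lambda>x. x) K) < d"
          using sum_increment_division[of D u v "\<lambda>x. x"] D uv by simp
      qed
      finally show "(\<Sum>K\<in>D. norm (integral K (deriv f))) \<le> 1" by simp
    qed
    then have "integrable lebesgue (\<lambda>x. indicator {u..v} x *\<^sub>R deriv f x)"
      by (simp add: set_integrable_def)
    then show ?thesis unfolding set_integrable_def
      by (subst (asm) integrable_completion) (use meas in auto)
  qed
  \<comment> \<open>Consecutive intervals of length at most d/2 stay below the length d required by
    \<open>short\<close>.\<close>
  have "set_integrable lborel {a..min b (a + real k * (d / 2))} (deriv f)" for k
  proof (induction k)
    case 0
    then show ?case using short[of a a] ab d(1) by (simp add: min_def)
  next
    case (Suc k)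
    let ?u = "min b (a + real k * (d / 2))" and ?v = "min b (a + real (Suc k) * (d / 2))"
    have uv: "a \<le> ?u" "?u \<le> ?v" "?v \<le> b" "?v - ?u < d"
      using ab d(1) by (auto simp: min_def field_simps)
    have "set_integrable lborel ({a..?u} \<union> {?u..?v}) (deriv f)"
      by (rule set_integrable_Un[OF Suc short]) (use uv in auto)
    then show ?case using uv by (simp only: ivl_disj_un_two_touch)
  qed
  moreover obtain k where "b - a < real k * (d / 2)"
    using reals_Archimedean3[of "d / 2"] d(1) by (metis half_gt_zero)
  then have "min b (a + real k * (d / 2)) = b" by simp
  ultimately show ?thesis by metis
qed

lemma abs_continuous_has_primitive:
  assumes ac: "\<And>a b. a \<le> b \<Longrightarrow> abs_continuous_on_interval a b f"
  shows "has_primitive (deriv f) f"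
  unfolding has_primitive_def
proof (intro conjI allI impI)
  show c: "continuous_on UNIV f" by (rule abs_continuous_imp_continuous[OF ac])
  show "deriv f \<in> borel_measurable borel" by (rule borel_measurable_deriv[OF c])
  fix a b :: real assume ab: "a \<le> b"
  show i: "set_integrable lborel {a..b} (deriv f)" by (rule set_integrable_deriv[OF ac ab])
  show "(LINT x:{a..b}|lborel. deriv f x) = f b - f a"
    using set_borel_integral_eq_integral(2)[OF i] integral_unique[OF deriv_has_integral[OF ac ab]] by simp
qed

section \<open>Integrals over the ordered simplex\<close>

definition unif :: "real measure" where
  "unif = uniform_measure lborel {0..1}"

lemma sets_unif [simp]: "sets unif = sets borel"
  by (simp add: unif_def)

lemma space_unif [simp]: "space unif = UNIV"
  by (simp add: unif_def)

lemma borel_measurable_unif [simp]: "borel_measurable unif = borel_measurable borel"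
  by (rule measurable_cong_sets) simp_all

lemma prob_space_unif: "prob_space unif"
  unfolding unif_def by (rule prob_space_uniform_measure) auto

interpretation unif: prob_space unif
  by (rule prob_space_unif)

interpretation unif_prod: product_prob_space "\<lambda>_::nat. unif" UNIV
  by (rule product_prob_spaceI) (rule prob_space_unif)

text \<open>The index set is a parameter since integrating out coordinate j leaves
  \<open>{1..Suc m} - {j}\<close>.\<close>

abbreviation cube_measure :: "nat set \<Rightarrow> (nat \<Rightarrow> real) measure" where
  "cube_measure I \<equiv> PiM I (\<lambda>_. unif)"

lemma unif_eq_density: "unif = density lborel (\<lambda>x. ennreal (indicator {0..1} x))"
  unfolding unif_def uniform_measure_def by (intro density_cong) (auto simp: divide_ennreal_def indicator_def)

definition extend :: "nat \<Rightarrow> (nat \<Rightarrow> real) \<Rightarrow> nat \<Rightarrow> real" where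
  "extend n x i = (if i = 0 then 1 else if i \<le> n then x i else 0)"

text \<open>The sentinels of \<open>extend\<close> turn the conditions for i = 0 and i = n into the
  bounds of the unit interval.\<close>

definition ordered_simplex :: "nat \<Rightarrow> (nat \<Rightarrow> real) set" where
  "ordered_simplex n = {x. \<forall>i\<le>n. extend n x (Suc i) \<le> extend n x i}"

text \<open>The affine function with value \<open>a i\<close> at the vertex whose first i
  coordinates are 1 and whose others are 0.\<close>

definition bary :: "nat \<Rightarrow> (nat \<Rightarrow> real) \<Rightarrow> (nat \<Rightarrow> real) \<Rightarrow> real" where
  "bary n a x = (\<Sum>i\<le>n. a i * (extend n x i - extend n x (Suc i)))"

text \<open>Not normalised: the simplex has mass 1/n!, so a constant is multiplied by this
  factor.\<close>

definition simplex_integral :: "nat \<Rightarrow> (real \<Rightarrow> real) \<Rightarrow> (nat \<Rightarrow> real) \<Rightarrow> real" where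
  "simplex_integral n \<phi> a =
    (\<integral>x. indicator (ordered_simplex n) x * \<phi> (bary n a x) \<partial>cube_measure {1..n})"

lemma measurable_extend [measurable]: "(\<lambda>x. extend n x i) \<in> borel_measurable (cube_measure {1..n})"
proof (cases "i \<in> {1..n}")
  case True
  then have "(\<lambda>x. x i) \<in> measurable (cube_measure {1..n}) unif" by (rule measurable_component_singleton)
  then show ?thesis using True by (simp add: extend_def measurable_cong_sets[OF refl sets_unif])
next
  case False
  then have "extend n x i = (if i = 0 then 1 else 0)" for x by (auto simp: extend_def)
  then show ?thesis by simp
qed

lemma measurable_bary [measurable]: "(\<lambda>x. bary n a x) \<in> borel_measurable (cube_measure {1..n})"
  unfolding bary_def by measurable

lemma measurable_indicator_ordered_simplex [measurable]:
  "(\<lambda>x. indicator (ordered_simplex n) x :: real) \<in> borel_measurable (cube_measure {1..n})"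
proof -
  have "indicator (ordered_simplex n) x = (if \<forall>i\<in>{..n}. extend n x (Suc i) \<le> extend n x i then 1 else 0 :: real)" for x
    by (auto simp: ordered_simplex_def indicator_def)
  moreover have [measurable]: "Measurable.pred (cube_measure {1..n}) (\<lambda>x. extend n x (Suc i) \<le> extend n x i)" for i
    using borel_measurable_le[OF measurable_extend[where i = "Suc i"] measurable_extend[where i = i]]
    by (simp add: pred_def)
  ultimately show ?thesis by (simp only:) measurable
qed

lemma bary_cong: "(\<And>i. i \<le> n \<Longrightarrow> a i = b i) \<Longrightarrow> bary n a x = bary n b x"
  unfolding bary_def by (intro sum.cong) auto

lemma simplex_integral_cong:
  "(\<And>i. i \<le> n \<Longrightarrow> a i = b i) \<Longrightarrow> simplex_integral n \<phi> a = simplex_integral n \<phi> b"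
  unfolding simplex_integral_def using bary_cong[of n a b] by simp

lemma sum_weights: "(\<Sum>i\<le>n. extend n x i - extend n x (Suc i)) = 1"
  by (subst sum_telescope) (simp add: extend_def)

text \<open>The weights are non-negative with sum 1, so each is at most 1.\<close>

lemma abs_bary_le:
  assumes "x \<in> ordered_simplex n"
  shows "\<bar>bary n a x\<bar> \<le> (\<Sum>i\<le>n. \<bar>a i\<bar>)"
proof -
  let ?w = "\<lambda>i. extend n x i - extend n x (Suc i)"
  have w0: "?w i \<ge> 0" if "i \<le> n" for i using assms that by (simp add: ordered_simplex_def)
  have w1: "?w i \<le> 1" if "i \<le> n" for i
    using member_le_sum[of i "{..n}" ?w] that w0 sum_weights[of n x] by auto
  have "\<bar>bary n a x\<bar> \<le> (\<Sum>i\<le>n. \<bar>a i * ?w i\<bar>)" unfolding bary_def by (rule sum_abs)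
  also have "\<dots> \<le> (\<Sum>i\<le>n. \<bar>a i\<bar>)"
  proof (rule sum_mono)
    fix i assume "i \<in> {..n}"
    then show "\<bar>a i * ?w i\<bar> \<le> \<bar>a i\<bar>" using w0[of i] w1[of i] by (simp add: abs_mult mult_left_le)
  qed
  finally show ?thesis .
qed

lemma bary_const: "bary n (\<lambda>_. c) x = c"
  unfolding bary_def using sum_weights[of n x] by (simp add: sum_distrib_left[symmetric])

section \<open>Omitting one coordinate or one vertex\<close>

definition skip :: "nat \<Rightarrow> nat \<Rightarrow> nat" where
  "skip j i = (if i < j then i else Suc i)"

lemma skip_bij: "j \<le> Suc m \<Longrightarrow> bij_betw (skip j) {..m} ({..Suc m} - {j})"
proof (rule bij_betw_imageI)
  show "inj_on (skip j) {..m}" by (auto simp: inj_on_def skip_def split: if_splits)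
  assume j: "j \<le> Suc m"
  show "skip j ` {..m} = {..Suc m} - {j}"
  proof (intro equalityI subsetI)
    fix i assume i: "i \<in> {..Suc m} - {j}"
    show "i \<in> skip j ` {..m}"
    proof (cases "i < j")
      case True
      then show ?thesis using j by (intro image_eqI[of _ _ i]) (auto simp: skip_def)
    next
      case False
      then show ?thesis using i by (intro image_eqI[of _ _ "i - 1"]) (auto simp: skip_def)
    qed
  qed (auto simp: skip_def)
qed

definition drop_coord :: "nat \<Rightarrow> nat \<Rightarrow> (nat \<Rightarrow> real) \<Rightarrow> (nat \<Rightarrow> real)" where
  "drop_coord m j x = (\<lambda>i\<in>{1..m}. x (skip j i))"

context
  fixes m j :: nat
  assumes j: "1 \<le> j" "j \<le> Suc m"
begin

lemma extend_drop_coord: "extend m (drop_coord m j x) i = extend (Suc m) x (skip j i)"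
  using j by (auto simp: extend_def drop_coord_def skip_def)

text \<open>Raising \<open>x j\<close> from \<open>x (j + 1)\<close> moves weight from vertex j - 1
  to vertex j. At the lower end vertex j has weight 0, which leaves the interpolation with
  \<open>a j\<close> omitted.\<close>

lemma bary_Suc:
  "bary (Suc m) a x = bary m (a \<circ> skip j) (drop_coord m j x)
    + (a j - a (j - 1)) * (extend (Suc m) x j - extend (Suc m) x (Suc j))"
proof -
  let ?e = "extend (Suc m) x"
  let ?f = "\<lambda>i. a i * (?e i - ?e (Suc i))"
  have "bary (Suc m) a x = ?f j + (\<Sum>i\<in>{..Suc m} - {j}. ?f i)"
    unfolding bary_def using j by (intro sum.remove) auto
  also have "(\<Sum>i\<in>{..Suc m} - {j}. ?f i) = (\<Sum>i\<le>m. ?f (skip j i))"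
    using sum.reindex_bij_betw[OF skip_bij[OF j(2)], of ?f] by simp
  also have "\<dots> = bary m (a \<circ> skip j) (drop_coord m j x)
      + (\<Sum>i\<le>m. ?f (skip j i) - a (skip j i) * (?e (skip j i) - ?e (skip j (Suc i))))"
    unfolding bary_def by (simp add: extend_drop_coord sum_subtractf)
  \<comment> \<open>Omitting \<open>x j\<close> merges two consecutive differences into one, and
    only the index j - 1 sees this.\<close>
  also have "(\<Sum>i\<le>m. ?f (skip j i) - a (skip j i) * (?e (skip j i) - ?e (skip j (Suc i))))
      = (\<Sum>i\<le>m. if i = j - 1 then a (j - 1) * (?e (Suc j) - ?e j) else 0)"
  proof (rule sum.cong[OF refl])
    fix i
    show "?f (skip j i) - a (skip j i) * (?e (skip j i) - ?e (skip j (Suc i)))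
      = (if i = j - 1 then a (j - 1) * (?e (Suc j) - ?e j) else 0)"
      using j by (cases "i = j - 1") (auto simp: skip_def algebra_simps)
  qed
  also have "\<dots> = a (j - 1) * (?e (Suc j) - ?e j)"
    using j by (subst sum.delta) auto
  finally show ?thesis by (simp add: algebra_simps o_def)
qed

text \<open>At the upper end of the range of \<open>x j\<close>, namely \<open>x (j - 1)\<close>,
  vertex j - 1 has weight 0. The two omissions \<open>skip (j - 1)\<close> and \<open>skip j\<close>
  differ only at the index j - 1.\<close>

lemma bary_skip_pred:
  "bary m (a \<circ> skip (j - 1)) (drop_coord m j x) = bary m (a \<circ> skip j) (drop_coord m j x)
    + (a j - a (j - 1)) * (extend (Suc m) x (j - 1) - extend (Suc m) x (Suc j))"
proof -
  let ?e = "extend (Suc m) x"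
  have "bary m (a \<circ> skip (j - 1)) (drop_coord m j x) - bary m (a \<circ> skip j) (drop_coord m j x)
    = (\<Sum>i\<le>m. (a (skip (j - 1) i) - a (skip j i)) * (?e (skip j i) - ?e (skip j (Suc i))))"
    unfolding bary_def by (simp add: extend_drop_coord sum_subtractf[symmetric] left_diff_distrib)
  also have "\<dots> = (\<Sum>i\<le>m. if i = j - 1 then (a j - a (j - 1)) * (?e (j - 1) - ?e (Suc j)) else 0)"
  proof (rule sum.cong[OF refl])
    fix i
    show "(a (skip (j - 1) i) - a (skip j i)) * (?e (skip j i) - ?e (skip j (Suc i)))
      = (if i = j - 1 then (a j - a (j - 1)) * (?e (j - 1) - ?e (Suc j)) else 0)"
      using j by (cases "i = j - 1") (auto simp: skip_def)
  qed
  also have "\<dots> = (a j - a (j - 1)) * (?e (j - 1) - ?e (Suc j))"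
    using j by (subst sum.delta) auto
  finally show ?thesis by (simp add: algebra_simps)
qed

text \<open>This gives the limits of integration for \<open>x j\<close> with the other coordinates
  fixed; the sentinels make it valid for j = 1 and j = Suc m as well.\<close>

lemma ordered_simplex_Suc_iff:
  "x \<in> ordered_simplex (Suc m) \<longleftrightarrow> drop_coord m j x \<in> ordered_simplex m \<and>
    extend (Suc m) x j \<in> {extend (Suc m) x (Suc j)..extend (Suc m) x (j - 1)}"
proof -
  let ?e = "extend (Suc m) x"
  have "(\<forall>i\<le>Suc m. ?e (Suc i) \<le> ?e i) \<longleftrightarrow> (\<forall>i\<le>m. ?e (skip j (Suc i)) \<le> ?e (skip j i)) \<and>
    ?e (Suc j) \<le> ?e j \<and> ?e j \<le> ?e (j - 1)" (is "?L \<longleftrightarrow> ?R")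
  proof
    assume L: ?L
    have 1: "?e (Suc j) \<le> ?e j" using L j by auto
    have 2: "?e j \<le> ?e (j - 1)" using L[rule_format, of "j - 1"] j by auto
    have "?e (skip j (Suc i)) \<le> ?e (skip j i)" if "i \<le> m" for i
    proof (cases "i = j - 1")
      case True
      then show ?thesis using 1 2 j by (simp add: skip_def)
    next
      case False
      then show ?thesis using L that j by (auto simp: skip_def)
    qed
    with 1 2 show ?R by blast
  next
    assume R: ?R
    show ?L
    proof (intro allI impI)
      fix i assume i: "i \<le> Suc m"
      consider "i = j" | "i = j - 1" | "i < j - 1" | "i > j" by linarith
      then show "?e (Suc i) \<le> ?e i"
      proof cases
        case 3
        then have "skip j i = i" "skip j (Suc i) = Suc i" "i \<le> m" using j by (auto simp: skip_def)
        then show ?thesis using R by metis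
      next
        case 4
        then have "skip j (i - 1) = i" "skip j (Suc (i - 1)) = Suc i" "i - 1 \<le> m" using j i by (auto simp: skip_def)
        then show ?thesis using R by metis
      qed (use R j in auto)
    qed
  qed
  then show ?thesis unfolding ordered_simplex_def by (auto simp: extend_drop_coord)
qed

end

lemma extend_antimono:
  assumes "x \<in> ordered_simplex n" "i \<le> k" "k \<le> Suc n"
  shows "extend n x k \<le> extend n x i"
  using assms(2,3)
proof (induction k rule: dec_induct)
  case (step k)
  then show ?case using assms(1) by (auto simp: ordered_simplex_def intro: order_trans)
qed simp

lemma extend_in_unit:
  assumes "x \<in> ordered_simplex n" "i \<le> Suc n"
  shows "extend n x i \<in> {0..1}"
  using extend_antimono[OF assms(1) _ assms(2), of 0] extend_antimono[OF assms(1) assms(2) order_refl]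
  by (simp add: extend_def)

text \<open>Substitution in one variable. For d < 0 the ends of the image interval are exchanged,
  and this sign turns the absolute value of d in the denominator into d.\<close>

lemma integral_unif_affine:
  assumes prim: "has_primitive \<phi> \<Phi>" and d: "d \<noteq> 0" and lh: "0 \<le> lo" "lo \<le> hi" "hi \<le> 1"
  shows "(\<integral>t. indicator {lo..hi} t * \<phi> (c + d * (t - lo)) \<partial>unif) = (\<Phi> (c + d * (hi - lo)) - \<Phi> c) / d"
proof -
  have [measurable]: "\<phi> \<in> borel_measurable borel" by (rule has_primitiveD[OF prim])
  define J where "J = (if d > 0 then {c..c + d * (hi - lo)} else {c + d * (hi - lo)..c})"
  have J: "c + d * (t - lo) \<in> J \<longleftrightarrow> t \<in> {lo..hi}" for t
  proof (cases "d > 0")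
    case True
    then show ?thesis by (auto simp: J_def zero_le_mult_iff)
  next
    case False
    then have "d < 0" using d by simp
    then show ?thesis by (auto simp: J_def mult_le_0_iff)
  qed
  have "(\<integral>t. indicator {lo..hi} t * \<phi> (c + d * (t - lo)) \<partial>unif)
      = (\<integral>t. indicator {0..1} t * (indicator {lo..hi} t * \<phi> (c + d * (t - lo))) \<partial>lborel)"
    unfolding unif_eq_density by (subst integral_density) auto
  also have "\<dots> = (\<integral>t. indicator J ((c - d * lo) + d * t) * \<phi> ((c - d * lo) + d * t) \<partial>lborel)"
  proof (rule Bochner_Integration.integral_cong[OF refl])
    fix t
    have eq: "c - d * lo + d * t = c + d * (t - lo)" by (simp add: algebra_simps)
    show "indicator {0..1} t * (indicator {lo..hi} t * \<phi> (c + d * (t - lo))) =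
      indicator J (c - d * lo + d * t) * \<phi> (c - d * lo + d * t)"
      unfolding eq using J[of t] lh by (cases "t \<in> {lo..hi}") auto
  qed
  also have "\<dots> = (\<integral>t. indicator J t * \<phi> t \<partial>lborel) / \<bar>d\<bar>"
    using lborel_integral_real_affine[OF d, of "\<lambda>t. indicator J t * \<phi> t" "c - d * lo"] d by simp
  also have "(\<integral>t. indicator J t * \<phi> t \<partial>lborel) = (LINT t:J|lborel. \<phi> t)"
    by (simp add: set_lebesgue_integral_def)
  also have "\<dots> / \<bar>d\<bar> = (\<Phi> (c + d * (hi - lo)) - \<Phi> c) / d"
  proof (cases "d > 0")
    case True
    then have "c \<le> c + d * (hi - lo)" using lh by simp
    from has_primitiveD(4)[OF prim this] show ?thesis using True by (simp add: J_def)
  next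
    case False
    then have "d < 0" using d by simp
    then have "c + d * (hi - lo) \<le> c" using lh by (simp add: mult_le_0_iff)
    from has_primitiveD(4)[OF prim this] show ?thesis using \<open>d < 0\<close> by (simp add: J_def field_simps)
  qed
  finally show ?thesis .
qed

lemma nn_integral_unif_affine_le:
  assumes [measurable]: "\<psi> \<in> borel_measurable borel" and d: "d \<noteq> 0"
  shows "(\<integral>\<^sup>+t. \<psi> (c + d * t) \<partial>unif) \<le> (\<integral>\<^sup>+t. \<psi> t \<partial>lborel) / ennreal \<bar>d\<bar>"
proof -
  have "(\<integral>\<^sup>+t. \<psi> (c + d * t) \<partial>unif) = (\<integral>\<^sup>+t. ennreal (indicator {0..1} t) * \<psi> (c + d * t) \<partial>lborel)"
    unfolding unif_eq_density by (subst nn_integral_density) auto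
  also have "\<dots> \<le> (\<integral>\<^sup>+t. \<psi> (c + d * t) \<partial>lborel)"
    by (rule nn_integral_mono) (auto simp: indicator_def)
  also have "\<dots> = (\<integral>\<^sup>+t. \<psi> t \<partial>lborel) / ennreal \<bar>d\<bar>"
    using nn_integral_real_affine[OF assms, of c] d
    by (simp add: mult_divide_eq_ennreal mult.commute[of "ennreal _"])
  finally show ?thesis .
qed

lemma prob_space_cube: "prob_space (cube_measure I)"
  by (intro prob_space_PiM prob_space_unif)

lemma continuous_bounded_on_Icc:
  fixes \<Phi> :: "real \<Rightarrow> real"
  assumes "continuous_on UNIV \<Phi>"
  obtains C where "\<And>y. \<bar>y\<bar> \<le> R \<Longrightarrow> \<bar>\<Phi> y\<bar> \<le> C"
proof -
  have "bounded (\<Phi> ` {-R..R})"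
    using assms continuous_on_subset by (intro compact_imp_bounded compact_continuous_image) auto
  then obtain C where "\<And>y. y \<in> \<Phi> ` {-R..R} \<Longrightarrow> norm y \<le> C" unfolding bounded_iff by blast
  then show thesis by (intro that[of C]) (auto simp: abs_le_iff)
qed

lemma simplex_integrand_bound:
  fixes \<Phi> :: "real \<Rightarrow> real"
  assumes "\<And>y. \<bar>y\<bar> \<le> R \<Longrightarrow> \<bar>\<Phi> y\<bar> \<le> C" "(\<Sum>i\<le>n. \<bar>a i\<bar>) \<le> R"
  shows "\<bar>indicator (ordered_simplex n) x * \<Phi> (bary n a x)\<bar> \<le> C"
proof -
  have "0 \<le> R" using assms(2) by (meson abs_ge_zero order_trans sum_nonneg)
  then have "0 \<le> C" using assms(1)[of 0] by simp
  then show ?thesis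
    using assms(1)[of "bary n a x"] abs_bary_le[of x n a] assms(2)
    by (cases "x \<in> ordered_simplex n") auto
qed

lemma integrable_simplex_continuous:
  fixes \<Phi> :: "real \<Rightarrow> real"
  assumes "continuous_on UNIV \<Phi>"
  shows "integrable (cube_measure {1..n}) (\<lambda>x. indicator (ordered_simplex n) x * \<Phi> (bary n a x))"
proof -
  interpret P: prob_space "cube_measure {1..n}" by (rule prob_space_cube)
  have [measurable]: "\<Phi> \<in> borel_measurable borel" using assms by (rule borel_measurable_continuous_onI)
  obtain C where "\<And>y. \<bar>y\<bar> \<le> (\<Sum>i\<le>n. \<bar>a i\<bar>) \<Longrightarrow> \<bar>\<Phi> y\<bar> \<le> C" using continuous_bounded_on_Icc[OF assms] by blast
  then have "\<bar>indicator (ordered_simplex n) x * \<Phi> (bary n a x)\<bar> \<le> C" for x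
    by (rule simplex_integrand_bound[OF _ order_refl])
  moreover have "(\<lambda>x. indicator (ordered_simplex n) x * \<Phi> (bary n a x)) \<in> borel_measurable (cube_measure {1..n})"
    by measurable
  ultimately show ?thesis
    by (intro P.integrable_const_bound[of _ C] AE_I2) (simp_all only: real_norm_def)
qed

lemma cube_measure_skip:
  assumes "1 \<le> j" "j \<le> Suc m"
  shows "distr (cube_measure ({1..Suc m} - {j})) (cube_measure {1..m}) (drop_coord m j) = cube_measure {1..m}"
    "drop_coord m j \<in> measurable (cube_measure ({1..Suc m} - {j})) (cube_measure {1..m})"
proof -
  have sk: "inj_on (skip j) {1..m}" "skip j \<in> {1..m} \<rightarrow> {1..Suc m} - {j}"
    using assms by (auto simp: inj_on_def skip_def split: if_splits)
  show "distr (cube_measure ({1..Suc m} - {j})) (cube_measure {1..m}) (drop_coord m j) = cube_measure {1..m}"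
    using distr_PiM_reindex[of "{1..Suc m} - {j}" "\<lambda>_. unif" "skip j" "{1..m}"] prob_space_unif sk
    by (simp add: drop_coord_def[abs_def])
  show "drop_coord m j \<in> measurable (cube_measure ({1..Suc m} - {j})) (cube_measure {1..m})"
    unfolding drop_coord_def[abs_def]
    by (rule measurable_restrict) (use sk in \<open>auto intro!: measurable_component_singleton\<close>)
qed

context
  fixes m j :: nat and a :: "nat \<Rightarrow> real" and \<phi> \<Phi> :: "real \<Rightarrow> real"
  assumes j: "1 \<le> j" "j \<le> Suc m" and neq: "a j \<noteq> a (j - 1)" and prim: "has_primitive \<phi> \<Phi>"
begin

lemma drop_coord_upd: "drop_coord m j (z(j := t)) = drop_coord m j z"
  by (auto simp: drop_coord_def skip_def)

lemma extend_upd: "extend (Suc m) (z(j := t)) i = (if i = j then t else extend (Suc m) z i)"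
  using j by (auto simp: extend_def)

lemma bary_upd:
  "bary (Suc m) a (z(j := t)) = bary m (a \<circ> skip j) (drop_coord m j z)
    + (a j - a (j - 1)) * (t - extend (Suc m) z (Suc j))"
  using bary_Suc[OF j, of a "z(j := t)"] by (simp add: drop_coord_upd extend_upd)

lemma insert_coord: "insert j ({1..Suc m} - {j}) = {1..Suc m}"
  using j by auto

text \<open>\<phi> may be unbounded. Along coordinate j its argument has slope d \<noteq> 0, and
  substitution bounds the integral over every fibre by the same constant, the integral of
  \<open>\<psi>\<close> divided by the absolute value of d.\<close>

lemma integrable_simplex_nonconstant:
  "integrable (cube_measure {1..Suc m}) (\<lambda>x. indicator (ordered_simplex (Suc m)) x * \<phi> (bary (Suc m) a x))"
proof (rule integrableI_bounded)
  have [measurable]: "\<phi> \<in> borel_measurable borel" by (rule has_primitiveD[OF prim])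
  show "(\<lambda>x. indicator (ordered_simplex (Suc m)) x * \<phi> (bary (Suc m) a x)) \<in> borel_measurable (cube_measure {1..Suc m})"
    by measurable
  define d where "d = a j - a (j - 1)"
  have d: "d \<noteq> 0" using neq by (simp add: d_def)
  define R where "R = (\<Sum>i\<le>Suc m. \<bar>a i\<bar>)"
  \<comment> \<open>The cut-off makes the integral over the whole line finite; on the simplex
    \<open>bary\<close> has values in [-R, R] by \<open>abs_bary_le\<close>.\<close>
  define \<psi> where "\<psi> y = ennreal \<bar>indicator {-R..R} y * \<phi> y\<bar>" for y
  have [measurable]: "\<psi> \<in> borel_measurable borel" unfolding \<psi>_def[abs_def] by measurable
  have "0 \<le> R" unfolding R_def by (intro sum_nonneg) auto
  then have "integrable lborel (\<lambda>y. indicator {-R..R} y * \<phi> y)"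
    using has_primitiveD(3)[OF prim, of "-R" R] by (simp add: set_integrable_def)
  then have K: "(\<integral>\<^sup>+y. \<psi> y \<partial>lborel) < \<infinity>"
    unfolding integrable_iff_bounded \<psi>_def by (simp add: real_norm_def)
  have "(\<integral>\<^sup>+x. norm (indicator (ordered_simplex (Suc m)) x * \<phi> (bary (Suc m) a x)) \<partial>cube_measure {1..Suc m})
      \<le> (\<integral>\<^sup>+x. \<psi> (bary (Suc m) a x) \<partial>cube_measure {1..Suc m})"
  proof (rule nn_integral_mono)
    fix x
    show "ennreal (norm (indicator (ordered_simplex (Suc m)) x * \<phi> (bary (Suc m) a x))) \<le> \<psi> (bary (Suc m) a x)"
      using abs_bary_le[of x "Suc m" a] unfolding \<psi>_def R_def
      by (cases "x \<in> ordered_simplex (Suc m)") (auto simp: abs_le_iff)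
  qed
  also have "\<dots> = (\<integral>\<^sup>+z. (\<integral>\<^sup>+t. \<psi> (bary (Suc m) a (z(j := t))) \<partial>unif) \<partial>cube_measure ({1..Suc m} - {j}))"
  proof (rule unif_prod.product_nn_integral_insert[of "{1..Suc m} - {j}" j, unfolded insert_coord])
    show "(\<lambda>x. \<psi> (bary (Suc m) a x)) \<in> borel_measurable (cube_measure {1..Suc m})" by measurable
  qed auto
  also have "\<dots> \<le> (\<integral>\<^sup>+z. (\<integral>\<^sup>+y. \<psi> y \<partial>lborel) / ennreal \<bar>d\<bar> \<partial>cube_measure ({1..Suc m} - {j}))"
  proof (rule nn_integral_mono)
    fix z
    define c where "c = bary m (a \<circ> skip j) (drop_coord m j z) - d * extend (Suc m) z (Suc j)"
    have "bary (Suc m) a (z(j := t)) = c + d * t" for t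
      unfolding bary_upd c_def d_def by (simp add: algebra_simps)
    then show "(\<integral>\<^sup>+t. \<psi> (bary (Suc m) a (z(j := t))) \<partial>unif) \<le> (\<integral>\<^sup>+y. \<psi> y \<partial>lborel) / ennreal \<bar>d\<bar>"
      using nn_integral_unif_affine_le[of \<psi> d c] d by simp
  qed
  also have "\<dots> = (\<integral>\<^sup>+y. \<psi> y \<partial>lborel) / ennreal \<bar>d\<bar>"
    using prob_space.emeasure_space_1[OF prob_space_cube] by simp
  also have "\<dots> < \<infinity>" using K d by (simp add: ennreal_divide_eq_top_iff less_top[symmetric])
  finally show "(\<integral>\<^sup>+x. norm (indicator (ordered_simplex (Suc m)) x * \<phi> (bary (Suc m) a x)) \<partial>cube_measure {1..Suc m}) < \<infinity>" .
qed

text \<open>The two terms are the values of \<Phi> at the ends of the range of \<open>x j\<close>,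
  which \<open>bary_upd\<close> and \<open>bary_skip_pred\<close> identify as interpolations with
  one vertex omitted.\<close>

lemma simplex_integral_adjacent:
  "(a j - a (j - 1)) * simplex_integral (Suc m) \<phi> a
    = simplex_integral m \<Phi> (a \<circ> skip (j - 1)) - simplex_integral m \<Phi> (a \<circ> skip j)"
proof -
  define d where "d = a j - a (j - 1)"
  have d: "d \<noteq> 0" using neq by (simp add: d_def)
  note cont = has_primitiveD(2)[OF prim]
  have [measurable]: "\<Phi> \<in> borel_measurable borel" using cont by (rule borel_measurable_continuous_onI)
  let ?G = "\<lambda>y. indicator (ordered_simplex m) y * ((\<Phi> (bary m (a \<circ> skip (j - 1)) y) - \<Phi> (bary m (a \<circ> skip j) y)) / d)"
  have "simplex_integral (Suc m) \<phi> a = (\<integral>z. (\<integral>t. indicator (ordered_simplex (Suc m)) (z(j := t)) *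
      \<phi> (bary (Suc m) a (z(j := t))) \<partial>unif) \<partial>cube_measure ({1..Suc m} - {j}))"
    unfolding simplex_integral_def
    using unif_prod.product_integral_insert[of "{1..Suc m} - {j}" j
        "\<lambda>x. indicator (ordered_simplex (Suc m)) x * \<phi> (bary (Suc m) a x)"] integrable_simplex_nonconstant
    by (simp only: insert_coord) simp
  also have "\<dots> = (\<integral>z. ?G (drop_coord m j z) \<partial>cube_measure ({1..Suc m} - {j}))"
  proof (rule Bochner_Integration.integral_cong[OF refl])
    fix z
    define y where "y = drop_coord m j z"
    define lo hi where "lo = extend (Suc m) z (Suc j)" and "hi = extend (Suc m) z (j - 1)"
    have simplex: "z(j := t) \<in> ordered_simplex (Suc m) \<longleftrightarrow> y \<in> ordered_simplex m \<and> t \<in> {lo..hi}" for t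
      unfolding ordered_simplex_Suc_iff[OF j] drop_coord_upd extend_upd y_def lo_def hi_def using j by auto
    show "(\<integral>t. indicator (ordered_simplex (Suc m)) (z(j := t)) * \<phi> (bary (Suc m) a (z(j := t))) \<partial>unif) = ?G (drop_coord m j z)"
    proof (cases "y \<in> ordered_simplex m")
      case True
      define i where "i = j - 1"
      have ii: "skip j i = j - 1" "skip j (Suc i) = Suc j" "i \<le> m" using j by (auto simp: i_def skip_def)
      have e: "hi = extend m y i" "lo = extend m y (Suc i)"
        using extend_drop_coord[OF j, of z] ii by (auto simp: y_def lo_def hi_def)
      have "extend m y i \<in> {0..1}" "extend m y (Suc i) \<in> {0..1}"
        using extend_in_unit[OF True] ii by auto
      moreover have "extend m y (Suc i) \<le> extend m y i" using extend_antimono[OF True] ii by auto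
      ultimately have lh: "0 \<le> lo" "lo \<le> hi" "hi \<le> 1" by (auto simp: e)
      have "(\<integral>t. indicator (ordered_simplex (Suc m)) (z(j := t)) * \<phi> (bary (Suc m) a (z(j := t))) \<partial>unif)
          = (\<integral>t. indicator {lo..hi} t * \<phi> (bary m (a \<circ> skip j) y + d * (t - lo)) \<partial>unif)"
        unfolding bary_upd using simplex True
        by (intro Bochner_Integration.integral_cong refl) (auto simp: indicator_def y_def lo_def d_def)
      also have "\<dots> = (\<Phi> (bary m (a \<circ> skip j) y + d * (hi - lo)) - \<Phi> (bary m (a \<circ> skip j) y)) / d"
        by (rule integral_unif_affine[OF prim d lh])
      also have "bary m (a \<circ> skip j) y + d * (hi - lo) = bary m (a \<circ> skip (j - 1)) y"
        unfolding y_def lo_def hi_def d_def by (rule bary_skip_pred[OF j, symmetric])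
      finally show ?thesis using True by (simp add: y_def o_def fun_upd_def)
    next
      case False
      then show ?thesis using simplex by (simp add: y_def)
    qed
  qed
  also have "\<dots> = (\<integral>y. ?G y \<partial>distr (cube_measure ({1..Suc m} - {j})) (cube_measure {1..m}) (drop_coord m j))"
    by (rule integral_distr[symmetric, OF cube_measure_skip(2)[OF j]]) measurable
  also have "\<dots> = (\<integral>y. ?G y \<partial>cube_measure {1..m})" unfolding cube_measure_skip(1)[OF j] ..
  also have "\<dots> = (\<integral>y. (indicator (ordered_simplex m) y * \<Phi> (bary m (a \<circ> skip (j - 1)) y) -
      indicator (ordered_simplex m) y * \<Phi> (bary m (a \<circ> skip j) y)) / d \<partial>cube_measure {1..m})"
    by (simp add: right_diff_distrib)
  also have "\<dots> = (simplex_integral m \<Phi> (a \<circ> skip (j - 1)) - simplex_integral m \<Phi> (a \<circ> skip j)) / d"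
    unfolding simplex_integral_def
    by (simp add: Bochner_Integration.integral_diff integrable_simplex_continuous[OF cont, simplified])
  finally show ?thesis using d by (simp add: d_def)
qed

end

lemma simplex_integral_recurrence_le:
  assumes prim: "has_primitive \<phi> \<Phi>" and pq: "p \<le> q" "q \<le> Suc m"
  shows "(a q - a p) * simplex_integral (Suc m) \<phi> a
    = simplex_integral m \<Phi> (a \<circ> skip p) - simplex_integral m \<Phi> (a \<circ> skip q)"
  using pq
proof (induction q rule: dec_induct)
  case (step q)
  have "(a (Suc q) - a q) * simplex_integral (Suc m) \<phi> a
    = simplex_integral m \<Phi> (a \<circ> skip q) - simplex_integral m \<Phi> (a \<circ> skip (Suc q))"
  \<comment> \<open>If neighbouring values agree, omitting one or the other gives the same sequence,
    and both sides are 0.\<close>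
  proof (cases "a (Suc q) = a q")
    case True
    have "a \<circ> skip q = a \<circ> skip (Suc q)"
      using True by (auto simp: fun_eq_iff skip_def less_Suc_eq)
    then show ?thesis using True by simp
  next
    case False
    then show ?thesis using simplex_integral_adjacent[of "Suc q" m a \<phi> \<Phi>] prim step.prems by simp
  qed
  then show ?case using step.IH step.prems by (simp add: algebra_simps o_def)
qed simp

lemma simplex_integral_recurrence:
  assumes prim: "has_primitive \<phi> \<Phi>" and "p \<le> Suc m" "q \<le> Suc m"
  shows "(a q - a p) * simplex_integral (Suc m) \<phi> a
    = simplex_integral m \<Phi> (a \<circ> skip p) - simplex_integral m \<Phi> (a \<circ> skip q)"
proof (cases "p \<le> q")
  case True
  then show ?thesis using simplex_integral_recurrence_le[OF prim] assms by blast
next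
  case False
  then have "(a p - a q) * simplex_integral (Suc m) \<phi> a
    = simplex_integral m \<Phi> (a \<circ> skip q) - simplex_integral m \<Phi> (a \<circ> skip p)"
    using simplex_integral_recurrence_le[OF prim] assms by simp
  then show ?thesis by (simp add: algebra_simps)
qed

text \<open>As soon as some value differs from the first, some two neighbouring values
  differ.\<close>

lemma integrable_simplex:
  assumes prim: "has_primitive \<phi> \<Phi>" and p: "p \<le> n" "a p \<noteq> a 0"
  shows "integrable (cube_measure {1..n}) (\<lambda>x. indicator (ordered_simplex n) x * \<phi> (bary n a x))"
proof -
  have "\<exists>j. 1 \<le> j \<and> j \<le> p \<and> a j \<noteq> a (j - 1)"
  proof (rule ccontr)
    assume *: "\<not> ?thesis"
    have "a i = a 0" if "i \<le> p" for i using that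
    proof (induction i)
      case (Suc i)
      then show ?case using * by force
    qed simp
    with p show False by blast
  qed
  then obtain j where j: "1 \<le> j" "j \<le> p" "a j \<noteq> a (j - 1)" by blast
  then obtain m where "n = Suc m" using p by (cases n) auto
  then show ?thesis using integrable_simplex_nonconstant[of j m a \<phi> \<Phi>] j p prim by simp
qed

lemma simplex_integral_0: "simplex_integral 0 \<phi> a = \<phi> (a 0)"
proof -
  interpret P: prob_space "cube_measure {}" by (rule prob_space_cube)
  have "indicator (ordered_simplex 0) x * \<phi> (bary 0 a x) = \<phi> (a 0)" for x
    by (simp add: ordered_simplex_def bary_def extend_def)
  then show ?thesis unfolding simplex_integral_def using P.prob_space by simp
qed

section \<open>Symmetry in the arguments\<close>

lemma image_mset_skip:
  assumes "p \<le> Suc m"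
  shows "image_mset (a \<circ> skip p) (mset_set {..m}) = image_mset a (mset_set {..Suc m}) - {#a p#}"
proof -
  have "image_mset (a \<circ> skip p) (mset_set {..m}) = image_mset a (image_mset (skip p) (mset_set {..m}))"
    by (simp add: multiset.map_comp)
  also have "image_mset (skip p) (mset_set {..m}) = mset_set ({..Suc m} - {p})"
    using skip_bij[OF assms] by (simp add: bij_betw_def image_mset_mset_set)
  also have "mset_set ({..Suc m} - {p}) = mset_set {..Suc m} - {#p#}"
    using assms by (simp add: mset_set_Diff)
  also have "image_mset a (mset_set {..Suc m} - {#p#}) = image_mset a (mset_set {..Suc m}) - {#a p#}"
    using assms by (subst image_mset_Diff) auto
  finally show ?thesis .
qed

text \<open>If two values differ, the recurrence for them expresses the integral through integrals
  of lower dimension with one value deleted, whichever positions the two occupy. If all agree, the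
  sequences are equal. With multisets the hypothesis survives the deletion of a value.\<close>

lemma simplex_integral_symmetric:
  assumes "has_primitive \<phi> \<Phi>"
    and "image_mset a (mset_set {..n}) = image_mset b (mset_set {..n})"
  shows "simplex_integral n \<phi> a = simplex_integral n \<phi> b"
  using assms
proof (induction n arbitrary: \<phi> \<Phi> a b)
  case 0
  then show ?case by (simp add: simplex_integral_0)
next
  case (Suc m)
  have img: "a ` {..Suc m} = b ` {..Suc m}"
  proof -
    have "set_mset (image_mset a (mset_set {..Suc m})) = set_mset (image_mset b (mset_set {..Suc m}))"
      by (simp only: Suc.prems(2))
    then show ?thesis by simp
  qed
  show ?case
  proof (cases "\<exists>p\<le>Suc m. \<exists>q\<le>Suc m. a p \<noteq> a q")
    case True
    then obtain p q where pq: "p \<le> Suc m" "q \<le> Suc m" "a p \<noteq> a q" by blast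
    have "a p \<in> b ` {..Suc m}" "a q \<in> b ` {..Suc m}" using img pq(1,2) by blast+
    then obtain p' q' where p': "p' \<le> Suc m" "b p' = a p" and q': "q' \<le> Suc m" "b q' = a q" by auto
    \<comment> \<open>The induction hypothesis, applied to \<Phi>, requires a primitive of \<Phi> in
      turn.\<close>
    obtain \<Psi> where \<Psi>: "has_primitive \<Phi> \<Psi>"
      using continuous_has_primitive[OF has_primitiveD(2)[OF Suc.prems(1)]] by blast
    have "simplex_integral m \<Phi> (a \<circ> skip p) = simplex_integral m \<Phi> (b \<circ> skip p')"
      using Suc.prems(2) p' pq(1) by (intro Suc.IH[OF \<Psi>]) (simp only: image_mset_skip)
    moreover have "simplex_integral m \<Phi> (a \<circ> skip q) = simplex_integral m \<Phi> (b \<circ> skip q')"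
      using Suc.prems(2) q' pq(2) by (intro Suc.IH[OF \<Psi>]) (simp only: image_mset_skip)
    ultimately have "(a q - a p) * simplex_integral (Suc m) \<phi> a = (a q - a p) * simplex_integral (Suc m) \<phi> b"
      using simplex_integral_recurrence[OF Suc.prems(1) pq(1,2), of a]
        simplex_integral_recurrence[OF Suc.prems(1) p'(1) q'(1), of b] p' q' by simp
    then show ?thesis using pq(3) by simp
  next
    case False
    then have "a i = b i" if "i \<le> Suc m" for i
    proof -
      have "b i \<in> a ` {..Suc m}" using img that by auto
      then show ?thesis using False that by (metis atMost_iff imageE)
    qed
    then show ?thesis by (rule simplex_integral_cong)
  qed
qed

text \<open>The lists match the arguments of \<open>div_diff\<close>; n + 1 values belong to
  dimension n, hence the \<open>- 1\<close>.\<close>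

definition simplex_mean :: "(real \<Rightarrow> real) \<Rightarrow> real list \<Rightarrow> real" where
  "simplex_mean \<phi> xs = simplex_integral (length xs - 1) \<phi> ((!) xs)"

lemma simplex_mean_singleton [simp]: "simplex_mean \<phi> [a] = \<phi> a"
  by (simp add: simplex_mean_def simplex_integral_0)

lemma simplex_mean_perm:
  assumes "has_primitive \<phi> \<Phi>" "mset xs = mset ys"
  shows "simplex_mean \<phi> xs = simplex_mean \<phi> ys"
proof (cases "xs = []")
  case False
  have len: "length xs = length ys" using assms(2) by (rule mset_eq_length)
  have img: "image_mset ((!) zs) (mset_set {..length zs - 1}) = mset zs" if "zs \<noteq> []" for zs :: "real list"
  proof -
    have "{..length zs - 1} = {0..<length zs}" using that by (cases zs) auto
    then have "image_mset ((!) zs) (mset_set {..length zs - 1}) = mset (map ((!) zs) [0..<length zs])"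
      by simp
    then show ?thesis by (simp only: map_nth)
  qed
  have "ys \<noteq> []" using False len by auto
  then show ?thesis unfolding simplex_mean_def len
    using img[of xs] img[of ys] False assms(2) len by (intro simplex_integral_symmetric[OF assms(1)]) simp
qed (use assms in simp)

lemma simplex_mean_recurrence:
  assumes "has_primitive \<phi> \<Phi>"
  shows "(v - u) * simplex_mean \<phi> (u # v # zs) = simplex_mean \<Phi> (v # zs) - simplex_mean \<Phi> (u # zs)"
proof -
  let ?a = "(!) (u # v # zs)"
  have "simplex_integral (length zs) \<Phi> (?a \<circ> skip 0) = simplex_mean \<Phi> (v # zs)"
    unfolding simplex_mean_def by (auto simp: skip_def intro!: simplex_integral_cong)
  moreover have "simplex_integral (length zs) \<Phi> (?a \<circ> skip 1) = simplex_mean \<Phi> (u # zs)"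
    unfolding simplex_mean_def by (auto simp: skip_def nth_Cons' intro!: simplex_integral_cong)
  ultimately show ?thesis
    using simplex_integral_recurrence[OF assms, of 0 "length zs" 1 ?a] by (simp add: simplex_mean_def)
qed

text \<open>Dominated convergence: converging arguments are bounded, so on the simplex the values of
  \<open>bary\<close> stay in one compact interval, where \<phi> is bounded.\<close>

lemma simplex_integral_tendsto:
  assumes cont: "continuous_on UNIV \<phi>" and A: "\<And>i. i \<le> n \<Longrightarrow> (\<lambda>k. A k i) \<longlonglongrightarrow> a i"
  shows "(\<lambda>k. simplex_integral n \<phi> (A k)) \<longlonglongrightarrow> simplex_integral n \<phi> a"
proof -
  interpret P: prob_space "cube_measure {1..n}" by (rule prob_space_cube)
  have [measurable]: "\<phi> \<in> borel_measurable borel" using cont by (rule borel_measurable_continuous_onI)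
  have "(\<lambda>k. \<Sum>i\<le>n. \<bar>A k i\<bar>) \<longlonglongrightarrow> (\<Sum>i\<le>n. \<bar>a i\<bar>)"
    by (intro tendsto_sum tendsto_rabs A) auto
  then have "convergent (\<lambda>k. \<Sum>i\<le>n. \<bar>A k i\<bar>)" by (auto simp: convergent_def)
  then have "Bseq (\<lambda>k. \<Sum>i\<le>n. \<bar>A k i\<bar>)" by (rule convergent_imp_Bseq)
  then obtain R where "\<And>k. norm (\<Sum>i\<le>n. \<bar>A k i\<bar>) \<le> R" by (auto simp: Bseq_def)
  then have R: "(\<Sum>i\<le>n. \<bar>A k i\<bar>) \<le> R" for k by (metis real_norm_def abs_le_D1)
  obtain C where C: "\<And>y. \<bar>y\<bar> \<le> R \<Longrightarrow> \<bar>\<phi> y\<bar> \<le> C" using continuous_bounded_on_Icc[OF cont] by blast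
  show ?thesis unfolding simplex_integral_def
  proof (rule integral_dominated_convergence[where w = "\<lambda>_. C"])
    show "(\<lambda>x. indicator (ordered_simplex n) x * \<phi> (bary n a x)) \<in> borel_measurable (cube_measure {1..n})"
      by measurable
    show "(\<lambda>x. indicator (ordered_simplex n) x * \<phi> (bary n (A k) x)) \<in> borel_measurable (cube_measure {1..n})" for k
      by measurable
    have "(\<lambda>k. \<phi> (bary n (A k) x)) \<longlonglongrightarrow> \<phi> (bary n a x)" for x
    proof (rule isCont_tendsto_compose[where g = \<phi>])
      show "isCont \<phi> (bary n a x)" using cont continuous_on_eq_continuous_at by blast
      show "(\<lambda>k. bary n (A k) x) \<longlonglongrightarrow> bary n a x" unfolding bary_def
        by (intro tendsto_sum tendsto_mult A tendsto_const) auto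
    qed
    then show "AE x in cube_measure {1..n}. (\<lambda>k. indicator (ordered_simplex n) x * \<phi> (bary n (A k) x))
        \<longlonglongrightarrow> indicator (ordered_simplex n) x * \<phi> (bary n a x)"
      by (intro AE_I2 tendsto_mult tendsto_const)
    show "AE x in cube_measure {1..n}. norm (indicator (ordered_simplex n) x * \<phi> (bary n (A k) x)) \<le> C" for k
      unfolding real_norm_def using simplex_integrand_bound[OF C R] by (intro AE_I2)
    show "integrable (cube_measure {1..n}) (\<lambda>_. C)" by (rule P.integrable_const)
  qed
qed

text \<open>By the recurrence the difference quotient is itself a simplex mean, with x and y as
  first arguments; continuity of \<phi> permits y to tend to x.\<close>

lemma simplex_mean_has_derivative:
  assumes prim: "has_primitive \<phi> \<Phi>" and cont: "continuous_on UNIV \<phi>"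
  shows "((\<lambda>y. simplex_mean \<Phi> (y # zs)) has_real_derivative simplex_mean \<phi> (x # x # zs)) (at x)"
  unfolding has_field_derivative_iff
proof (rule Lim_transform_eventually)
  show "((\<lambda>y. simplex_mean \<phi> (x # y # zs)) \<longlongrightarrow> simplex_mean \<phi> (x # x # zs)) (at x)"
    unfolding tendsto_at_iff_sequentially
  proof (intro allI impI)
    fix Y :: "nat \<Rightarrow> real" assume Y: "Y \<longlonglongrightarrow> x"
    have "(\<lambda>k. (x # Y k # zs) ! i) \<longlonglongrightarrow> (x # x # zs) ! i" for i
      using Y by (auto simp: nth_Cons')
    then show "((\<lambda>y. simplex_mean \<phi> (x # y # zs)) \<circ> Y) \<longlonglongrightarrow> simplex_mean \<phi> (x # x # zs)"
      unfolding simplex_mean_def o_def by (auto intro!: simplex_integral_tendsto[OF cont])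
  qed
  show "\<forall>\<^sub>F y in at x. simplex_mean \<phi> (x # y # zs) = (simplex_mean \<Phi> (y # zs) - simplex_mean \<Phi> (x # zs)) / (y - x)"
    unfolding eventually_at_filter
    using simplex_mean_recurrence[OF prim, of _ x zs] by (auto simp: field_simps)
qed

section \<open>Divided differences as simplex integrals\<close>

lemma nth_deriv_has_primitive:
  assumes diff: "\<And>k x. k < N \<Longrightarrow> nth_deriv k g field_differentiable at x"
    and cont: "continuous_on UNIV (nth_deriv N g)"
  shows "k \<le> N \<Longrightarrow> continuous_on UNIV (nth_deriv k g)"
    "k < N \<Longrightarrow> has_primitive (nth_deriv (Suc k) g) (nth_deriv k g)"
proof -
  show c: "continuous_on UNIV (nth_deriv k g)" if "k \<le> N" for k
  proof (cases "k = N")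
    case False
    then have "isCont (nth_deriv k g) x" for x
      using diff[of k x] that field_differentiable_imp_continuous_at by force
    then show ?thesis by (simp add: continuous_at_imp_continuous_on)
  qed (use cont in simp)
  show "has_primitive (nth_deriv (Suc k) g) (nth_deriv k g)" if "k < N"
  proof (rule has_primitive_continuous)
    show "continuous_on UNIV (nth_deriv (Suc k) g)" by (rule c) (use that in simp)
    show "(nth_deriv k g has_real_derivative nth_deriv (Suc k) g x) (at x)" for x
      using diff[OF that, of x] by (simp add: DERIV_deriv_iff_field_differentiable)
  qed
qed

lemma butlast_last_perm:
  "ys \<noteq> [] \<Longrightarrow> mset ys = mset (last ys # butlast ys)"
  by (induction ys rule: rev_induct) auto

text \<open>The two cases of the recursion are the recurrence and its limit. \<open>div_diff\<close>
  compares the first argument with the last, whereas the recurrence is used on the first two, so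
  symmetry moves the last one forward.\<close>

lemma div_diff_eq_simplex_mean:
  assumes diff: "\<And>k x. k < N \<Longrightarrow> nth_deriv k g field_differentiable at x"
    and cont: "continuous_on UNIV (nth_deriv N g)"
    and "length xs = Suc k" "k \<le> N"
  shows "div_diff g xs = simplex_mean (nth_deriv k g) xs"
  using assms(3,4)
proof (induction k arbitrary: xs)
  case 0
  then obtain a where "xs = [a]" by (auto simp: length_Suc_conv)
  then show ?case by simp
next
  case (Suc k)
  then obtain a b as where xs: "xs = a # b # as" "length as = k" by (auto simp: length_Suc_conv)
  define ys l zs where "ys = b # as" and "l = last ys" and "zs = butlast ys"
  have len: "length ys = Suc k" "length (x # zs) = Suc k" for x using xs by (auto simp: ys_def zs_def)
  have ys: "mset ys = mset (l # zs)" unfolding l_def zs_def by (rule butlast_last_perm) (simp add: ys_def)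
  note prim = nth_deriv_has_primitive(2)[OF diff cont, of k]
  have prim: "has_primitive (nth_deriv (Suc k) g) (nth_deriv k g)" using prim Suc.prems(2) by simp
  have c: "continuous_on UNIV (nth_deriv k g)" "continuous_on UNIV (nth_deriv (Suc k) g)"
    by (rule nth_deriv_has_primitive(1)[OF diff cont]; use Suc.prems(2) in simp)+
  obtain \<Psi> where \<Psi>: "has_primitive (nth_deriv (Suc k) g) \<Psi>" using continuous_has_primitive[OF c(2)] by blast
  obtain \<Psi>' where \<Psi>': "has_primitive (nth_deriv k g) \<Psi>'" using continuous_has_primitive[OF c(1)] by blast
  have perm: "simplex_mean (nth_deriv (Suc k) g) xs = simplex_mean (nth_deriv (Suc k) g) (a # l # zs)"
    by (rule simplex_mean_perm[OF \<Psi>]) (simp add: xs ys_def[symmetric] ys)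
  have IH: "div_diff g ys = simplex_mean (nth_deriv k g) (l # zs)"
    "div_diff g (x # zs) = simplex_mean (nth_deriv k g) (x # zs)" for x
    using Suc.IH[OF len(1)] Suc.IH[OF len(2)] Suc.prems(2) simplex_mean_perm[OF \<Psi>' ys] by auto
  have step: "div_diff g xs = (if a \<noteq> l then (div_diff g ys - div_diff g (a # zs)) / (l - a)
      else deriv (\<lambda>x. div_diff g (x # zs)) a)"
    by (simp only: xs ys_def l_def zs_def div_diff.simps)
  show ?case
  proof (cases "a = l")
    case False
    then show ?thesis unfolding step perm IH
      using simplex_mean_recurrence[OF prim, of l a zs] by (simp add: field_simps)
  next
    case True
    then show ?thesis unfolding step perm IH
      using DERIV_imp_deriv[OF simplex_mean_has_derivative[OF prim c(2), of zs a]] by simp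
  qed
qed

section \<open>Differentiation where all arguments coincide\<close>

lemma simplex_integral_bound:
  assumes int: "integrable (cube_measure {1..n}) (\<lambda>x. indicator (ordered_simplex n) x * \<xi> (bary n a x))"
    and bound: "\<And>x. x \<in> ordered_simplex n \<Longrightarrow> \<bar>\<xi> (bary n a x)\<bar> \<le> C" and C: "0 \<le> C"
  shows "\<bar>simplex_integral n \<xi> a\<bar> \<le> C"
proof -
  interpret P: prob_space "cube_measure {1..n}" by (rule prob_space_cube)
  have "\<bar>simplex_integral n \<xi> a\<bar> \<le> (\<integral>x. \<bar>indicator (ordered_simplex n) x * \<xi> (bary n a x)\<bar> \<partial>cube_measure {1..n})"
    unfolding simplex_integral_def by (rule integral_abs_bound)
  also have "\<dots> \<le> C"
  proof (rule P.integral_le_const)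
    show "integrable (cube_measure {1..n}) (\<lambda>x. \<bar>indicator (ordered_simplex n) x * \<xi> (bary n a x)\<bar>)"
      using int by (rule integrable_abs)
    show "AE x in cube_measure {1..n}. \<bar>indicator (ordered_simplex n) x * \<xi> (bary n a x)\<bar> \<le> C"
      using bound C by (intro AE_I2) (auto simp: indicator_def abs_mult)
  qed
  finally show ?thesis .
qed

lemma simplex_mean_eq_at_const:
  assumes "\<phi> c = \<psi> c" "\<And>x. x \<in> set xs \<Longrightarrow> x = c" "xs \<noteq> []"
  shows "simplex_mean \<phi> xs = simplex_mean \<psi> xs"
proof -
  have "bary (length xs - 1) ((!) xs) x = c" for x
  proof -
    have "bary (length xs - 1) ((!) xs) x = bary (length xs - 1) (\<lambda>_. c) x"
    proof (rule bary_cong)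
      fix i assume "i \<le> length xs - 1"
      then have "i < length xs" using assms(3) by (cases xs) auto
      then show "xs ! i = c" using assms(2) by simp
    qed
    then show ?thesis by (simp add: bary_const)
  qed
  then show ?thesis unfolding simplex_mean_def simplex_integral_def using assms(1) by simp
qed

text \<open>Only vertex 0 may depart from c, and its weight lies between 0 and 1.\<close>

lemma bary_perturb:
  assumes x: "x \<in> ordered_simplex n" and a: "\<And>i. 1 \<le> i \<Longrightarrow> i \<le> n \<Longrightarrow> a i = c"
  shows "\<bar>bary n a x - c\<bar> \<le> \<bar>a 0 - c\<bar>"
proof -
  have "bary n a x - c = bary n a x - bary n (\<lambda>_. c) x" by (simp add: bary_const)
  also have "\<dots> = bary n (\<lambda>i. a i - c) x" unfolding bary_def by (simp add: sum_subtractf left_diff_distrib)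
  also have "\<bar>\<dots>\<bar> \<le> (\<Sum>i\<le>n. \<bar>a i - c\<bar>)" by (rule abs_bary_le[OF x])
  also have "\<dots> = (\<Sum>i\<le>n. if i = 0 then \<bar>a 0 - c\<bar> else 0)"
    using a by (intro sum.cong) (auto simp: Suc_le_eq)
  also have "\<dots> = \<bar>a 0 - c\<bar>" by (simp add: sum.delta)
  finally show ?thesis .
qed

text \<open>\<phi> may be discontinuous, so the tangent line at c is split off. Its slope is
  constant, hence \<open>simplex_mean_has_derivative\<close> applies to it. By
  \<open>bary_perturb\<close> the arguments of the remainder stay within distance |y - c| of c, so
  its mean is o(|y - c|).\<close>

lemma simplex_mean_has_derivative_const:
  assumes cont: "continuous_on UNIV \<Phi>" and D: "(\<Phi> has_real_derivative D) (at c)" "\<phi> c = D"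
    and zs: "\<And>z. z \<in> set zs \<Longrightarrow> z = c"
  shows "((\<lambda>x. simplex_mean \<Phi> (x # zs)) has_real_derivative simplex_mean \<phi> (c # c # zs)) (at c)"
proof -
  define lin where "lin y = \<Phi> c + D * (y - c)" for y
  have lin: "has_primitive (\<lambda>_. D) lin"
  proof (rule has_primitive_continuous)
    show "(lin has_real_derivative D) (at x)" for x
      unfolding lin_def by (auto intro!: derivative_eq_intros)
  qed simp
  note lin_cont = has_primitiveD(2)[OF lin]
  have "((\<lambda>x. simplex_mean lin (x # zs)) has_real_derivative simplex_mean (\<lambda>_. D) (c # c # zs)) (at c)"
    by (rule simplex_mean_has_derivative[OF lin]) simp
  moreover have "simplex_mean (\<lambda>_. D) (c # c # zs) = simplex_mean \<phi> (c # c # zs)"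
    by (rule simplex_mean_eq_at_const[of _ c]) (use D(2) zs in auto)
  moreover define r where "r x = simplex_mean \<Phi> (x # zs) - simplex_mean lin (x # zs)" for x
  have "(r has_real_derivative 0) (at c)"
    unfolding has_field_derivative_def has_derivative_at_alt
  proof (intro conjI allI impI)
    show "bounded_linear ((*) (0::real))" by (rule bounded_linear_mult_right)
    fix e :: real assume e: "e > 0"
    then obtain d where d: "d > 0" "\<And>y. \<bar>y - c\<bar> < d \<Longrightarrow> \<bar>\<Phi> y - \<Phi> c - D * (y - c)\<bar> \<le> e * \<bar>y - c\<bar>"
      using D(1) unfolding has_field_derivative_def has_derivative_at_alt by (auto simp: real_norm_def)
    have r: "\<bar>r y\<bar> \<le> e * \<bar>y - c\<bar>" if y: "\<bar>y - c\<bar> < d" for y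
    proof -
      let ?n = "length zs" and ?a = "(!) (y # zs)"
      have "r y = simplex_integral ?n (\<lambda>t. \<Phi> t - lin t) ?a"
        unfolding r_def simplex_mean_def simplex_integral_def
        using Bochner_Integration.integral_diff[OF integrable_simplex_continuous[OF cont] integrable_simplex_continuous[OF lin_cont], of ?n ?a ?a]
        by (simp add: right_diff_distrib)
      also have "\<bar>\<dots>\<bar> \<le> e * \<bar>y - c\<bar>"
      proof (rule simplex_integral_bound)
        show "integrable (cube_measure {1..?n}) (\<lambda>x. indicator (ordered_simplex ?n) x * (\<Phi> (bary ?n ?a x) - lin (bary ?n ?a x)))"
          by (rule integrable_simplex_continuous) (intro continuous_on_diff cont lin_cont)
        fix x assume "x \<in> ordered_simplex ?n"
        then have b: "\<bar>bary ?n ?a x - c\<bar> \<le> \<bar>y - c\<bar>"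
          using bary_perturb[of x ?n ?a c] zs by (auto simp: nth_Cons')
        then have "\<bar>\<Phi> (bary ?n ?a x) - lin (bary ?n ?a x)\<bar> \<le> e * \<bar>bary ?n ?a x - c\<bar>"
          using d(2)[of "bary ?n ?a x"] y unfolding lin_def by (simp add: algebra_simps)
        also have "\<dots> \<le> e * \<bar>y - c\<bar>" using b e by (intro mult_left_mono) auto
        finally show "\<bar>\<Phi> (bary ?n ?a x) - lin (bary ?n ?a x)\<bar> \<le> e * \<bar>y - c\<bar>" .
      qed (use e in auto)
      finally show ?thesis .
    qed
    have "r c = 0" using r[of c] d(1) by simp
    then show "\<exists>d>0. \<forall>y. norm (y - c) < d \<longrightarrow> norm (r y - r c - 0 * (y - c)) \<le> e * norm (y - c)"
      using r d(1) by (intro exI[of _ d]) (auto simp: real_norm_def)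
  qed
  ultimately have "((\<lambda>x. r x + simplex_mean lin (x # zs)) has_real_derivative 0 + simplex_mean \<phi> (c # c # zs)) (at c)"
    by (intro DERIV_add) auto
  then show ?thesis by (simp add: r_def)
qed

text \<open>
  At the top order only a locally integrable derivative is available, so the recursion for continuous
  derivatives does not apply when the two end points coincide; an interior point different from them
  is split off first.
\<close>

lemma div_diff_eq_simplex_mean_top:
  assumes diff: "\<And>k x. k < N \<Longrightarrow> nth_deriv k g field_differentiable at x"
    and prim: "has_primitive (nth_deriv (Suc N) g) (nth_deriv N g)"
    and len: "length xs = Suc (Suc N)"
    and const: "(\<And>x. x \<in> set xs \<Longrightarrow> x = hd xs) \<Longrightarrow> nth_deriv N g field_differentiable at (hd xs)"
  shows "div_diff g xs = simplex_mean (nth_deriv (Suc N) g) xs"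
proof -
  let ?\<Phi> = "nth_deriv N g" and ?\<phi> = "nth_deriv (Suc N) g"
  note cont = has_primitiveD(2)[OF prim]
  obtain a b as where xs: "xs = a # b # as" "length as = N" using len by (auto simp: length_Suc_conv)
  define ys l zs where "ys = b # as" and "l = last ys" and "zs = butlast ys"
  have len: "length ys = Suc N" "length (x # zs) = Suc N" for x using xs by (auto simp: ys_def zs_def)
  have ys: "mset ys = mset (l # zs)" unfolding l_def zs_def by (rule butlast_last_perm) (simp add: ys_def)
  obtain \<Psi> where \<Psi>: "has_primitive ?\<Phi> \<Psi>" using continuous_has_primitive[OF cont] by blast
  have perm: "simplex_mean ?\<phi> xs = simplex_mean ?\<phi> (a # l # zs)"
    by (rule simplex_mean_perm[OF prim]) (simp add: xs ys_def[symmetric] ys)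
  have lower: "div_diff g ys = simplex_mean ?\<Phi> (l # zs)"
    "div_diff g (x # zs) = simplex_mean ?\<Phi> (x # zs)" for x
    using div_diff_eq_simplex_mean[OF diff cont len(1)] div_diff_eq_simplex_mean[OF diff cont len(2)]
      simplex_mean_perm[OF \<Psi> ys] by auto
  have step: "div_diff g xs = (if a \<noteq> l then (div_diff g ys - div_diff g (a # zs)) / (l - a)
      else deriv (\<lambda>x. div_diff g (x # zs)) a)"
    by (simp only: xs ys_def l_def zs_def div_diff.simps)
  have "set ys = set (l # zs)" using ys by (metis set_mset_mset)
  then have setxs: "set xs = {a, l} \<union> set zs" by (simp add: xs ys_def[symmetric])
  consider "a \<noteq> l" | "a = l" "\<And>z. z \<in> set zs \<Longrightarrow> z = a" | c where "a = l" "c \<in> set zs" "c \<noteq> a" by blast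
  then show ?thesis
  proof cases
    case 1
    then show ?thesis unfolding step perm lower
      using simplex_mean_recurrence[OF prim, of l a zs] by (simp add: field_simps)
  next
    case 2
    have "?\<Phi> field_differentiable at a" using const setxs 2 xs by auto
    then have "(?\<Phi> has_real_derivative ?\<phi> a) (at a)" by (simp add: DERIV_deriv_iff_field_differentiable)
    then have "((\<lambda>x. simplex_mean ?\<Phi> (x # zs)) has_real_derivative simplex_mean ?\<phi> (a # a # zs)) (at a)"
      by (rule simplex_mean_has_derivative_const[OF cont _ refl 2(2)])
    then show ?thesis unfolding step perm lower using 2(1) DERIV_imp_deriv by auto
  next
    case 3
    obtain us vs where "zs = us @ c # vs" using split_list[OF 3(2)] by blast
    then obtain ws where ws: "mset zs = mset (c # ws)" by (intro that[of "us @ vs"]) simp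
    have "zs \<noteq> []" using 3(2) by auto
    then obtain N' where N': "N = Suc N'" using len(2) by (cases N) auto
    let ?\<Psi> = "nth_deriv N' g"
    have prim': "has_primitive ?\<Phi> ?\<Psi>"
      using nth_deriv_has_primitive(2)[OF diff cont, of N'] N' by simp
    \<comment> \<open>F comes from the derivative of order N - 1, whose own derivative is
      continuous, so F is differentiable at a. The mean of \<Phi> is a difference quotient of F, to
      which the quotient rule applies.\<close>
    define F where "F x = simplex_mean ?\<Psi> (x # ws)" for x
    have mean: "simplex_mean ?\<Phi> (x # zs) = simplex_mean ?\<Phi> (x # c # ws)" for x
      by (rule simplex_mean_perm[OF prim']) (simp add: ws)
    have rec: "simplex_mean ?\<Phi> (x # zs) = (F c - F x) / (c - x)" if "x \<noteq> c" for x
      unfolding mean F_def using simplex_mean_recurrence[OF prim', of c x ws] that by (simp add: field_simps)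
    have F: "(F has_real_derivative simplex_mean ?\<Phi> (a # a # ws)) (at a)"
      unfolding F_def by (rule simplex_mean_has_derivative[OF prim' cont])
    let ?D = "(simplex_mean ?\<Phi> (a # zs) - simplex_mean ?\<Phi> (a # a # ws)) / (c - a)"
    have "((\<lambda>x. (F c - F x) / (c - x)) has_real_derivative
        ((0 - simplex_mean ?\<Phi> (a # a # ws)) * (c - a) - (F c - F a) * (0 - 1)) / ((c - a) * (c - a))) (at a)"
      using 3(3) by (intro DERIV_divide DERIV_diff F DERIV_const DERIV_ident) auto
    moreover have "((0 - simplex_mean ?\<Phi> (a # a # ws)) * (c - a) - (F c - F a) * (0 - 1)) / ((c - a) * (c - a)) = ?D"
    proof -
      have "F c - F a = simplex_mean ?\<Phi> (a # zs) * (c - a)" using rec[of a] 3(3) by (simp add: field_simps)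
      then have "(0 - simplex_mean ?\<Phi> (a # a # ws)) * (c - a) - (F c - F a) * (0 - 1)
          = (simplex_mean ?\<Phi> (a # zs) - simplex_mean ?\<Phi> (a # a # ws)) * (c - a)"
        by (simp add: algebra_simps)
      then show ?thesis using 3(3) by simp
    qed
    ultimately have "((\<lambda>x. (F c - F x) / (c - x)) has_real_derivative ?D) (at a)" by simp
    then have "((\<lambda>x. simplex_mean ?\<Phi> (x # zs)) has_real_derivative ?D) (at a)"
    \<comment> \<open>The quotient represents the mean for x \<noteq> c, which holds near a.\<close>
    proof (rule DERIV_cong_ev[THEN iffD1, rotated -1, OF _ refl _ refl])
      have "\<forall>\<^sub>F x in nhds a. x \<noteq> c" using 3(3) by (intro t1_space_nhds) auto
      then show "\<forall>\<^sub>F x in nhds a. (F c - F x) / (c - x) = simplex_mean ?\<Phi> (x # zs)"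
        by eventually_elim (simp add: rec)
    qed
    then have "div_diff g xs = ?D" unfolding step lower using 3(1) DERIV_imp_deriv by auto
    \<comment> \<open>With c in front, the quotient is the recurrence at the top order for the
      distinct arguments a and c.\<close>
    also have "simplex_mean ?\<Phi> (a # zs) = simplex_mean ?\<Phi> (c # a # ws)"
      by (rule simplex_mean_perm[OF prim']) (simp add: ws)
    also have "(simplex_mean ?\<Phi> (c # a # ws) - simplex_mean ?\<Phi> (a # a # ws)) / (c - a) = simplex_mean ?\<phi> (a # c # a # ws)"
      using simplex_mean_recurrence[OF prim, of c a "a # ws"] 3(3) by (simp add: field_simps)
    also have "\<dots> = simplex_mean ?\<phi> xs"
      unfolding perm using 3(1) ws by (intro simplex_mean_perm[OF prim]) simp
    finally show ?thesis .
  qed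
qed

section \<open>Lattice combinations on the cube\<close>

interpretation lborel_prod: product_sigma_finite "\<lambda>_::nat. lborel :: real measure"
  by standard

text \<open>Both sides are compared on boxes: conditioning on a product set acts on each factor
  separately.\<close>

lemma uniform_measure_unit_cube:
  "uniform_measure (lebesgue_n n) (unit_cube n) = cube_measure {1..n}"
proof (rule unif_prod.PiM_eqI)
  have sets: "sets (lebesgue_n n) = sets (cube_measure {1..n})"
    unfolding lebesgue_n_def by (intro sets_PiM_cong) auto
  then show "sets (uniform_measure (lebesgue_n n) (unit_cube n)) = sets (cube_measure {1..n})"
    by simp
  fix A :: "nat \<Rightarrow> real set" assume "\<And>i. i \<in> {1..n} \<Longrightarrow> A i \<in> sets unif"
  then have A: "A i \<in> sets borel" if "i \<in> {1..n}" for i using that by simp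
  have cube: "unit_cube n \<in> sets (lebesgue_n n)" "PiE {1..n} A \<in> sets (lebesgue_n n)"
    unfolding unit_cube_def lebesgue_n_def by (rule sets_PiM_I_finite; use A in simp)+
  have "emeasure (lebesgue_n n) (unit_cube n) = 1"
    unfolding unit_cube_def lebesgue_n_def by (subst lborel_prod.emeasure_PiM) auto
  moreover have "unit_cube n \<inter> PiE {1..n} A = PiE {1..n} (\<lambda>i. {0..1} \<inter> A i)"
    unfolding unit_cube_def by (rule PiE_Int)
  moreover have "emeasure (lebesgue_n n) (PiE {1..n} (\<lambda>i. {0..1} \<inter> A i)) = (\<Prod>i\<in>{1..n}. emeasure lborel ({0..1} \<inter> A i))"
    unfolding lebesgue_n_def using A by (intro lborel_prod.emeasure_PiM) auto
  moreover have "emeasure lborel ({0..1} \<inter> A i) = emeasure unif (A i)" if "i \<in> {1..n}" for i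
    unfolding unif_def using A[OF that] by (subst emeasure_uniform_measure) (auto simp: divide_ennreal_def)
  ultimately show "emeasure (uniform_measure (lebesgue_n n) (unit_cube n)) (PiE {1..n} A) = (\<Prod>i\<in>{1..n}. emeasure unif (A i))"
    using cube by (simp add: emeasure_uniform_measure divide_ennreal_def)
qed simp

text \<open>Carries the simplex belonging to \<sigma> to the one ordered simplex, so that a single
  integral formula serves all permutations.\<close>

definition perm_coord :: "nat \<Rightarrow> (nat \<Rightarrow> nat) \<Rightarrow> (nat \<Rightarrow> real) \<Rightarrow> (nat \<Rightarrow> real)" where
  "perm_coord n \<sigma> x = (\<lambda>i\<in>{1..n}. x (\<sigma> i))"

lemma
  assumes "\<sigma> permutes {1..n}"
  shows distr_perm_coord: "distr (cube_measure {1..n}) (cube_measure {1..n}) (perm_coord n \<sigma>) = cube_measure {1..n}"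
    and measurable_perm_coord: "perm_coord n \<sigma> \<in> measurable (cube_measure {1..n}) (cube_measure {1..n})"
proof -
  have \<sigma>: "inj_on \<sigma> {1..n}" "\<sigma> \<in> {1..n} \<rightarrow> {1..n}"
    using permutes_inj_on[OF assms] permutes_in_image[OF assms] by auto
  show "distr (cube_measure {1..n}) (cube_measure {1..n}) (perm_coord n \<sigma>) = cube_measure {1..n}"
    using distr_PiM_reindex[of "{1..n}" "\<lambda>_. unif" \<sigma> "{1..n}"] prob_space_unif \<sigma>
    by (simp add: perm_coord_def[abs_def])
  show "perm_coord n \<sigma> \<in> measurable (cube_measure {1..n}) (cube_measure {1..n})"
    unfolding perm_coord_def[abs_def]
    by (rule measurable_restrict, rule measurable_component_singleton) (use \<sigma> in auto)
qed

section \<open>Sorting the coordinates almost surely\<close>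

lemma AE_cube_in_unit: "AE x in cube_measure {1..n}. \<forall>i\<in>{1..n}. x i \<in> {0..1}"
proof (intro AE_finite_allI)
  fix i assume i: "i \<in> {1..n}"
  have "AE t in unif. t \<in> {0..1}" unfolding unif_def by (rule AE_uniform_measureI) auto
  with i show "AE x in cube_measure {1..n}. x i \<in> {0..1}"
    by (intro AE_PiM_component[of "{1..n}" "\<lambda>_. unif"] prob_space_unif)
qed simp

text \<open>With the other coordinates fixed, \<open>x i = x j\<close> restricts coordinate i to a
  single point, which is a null set.\<close>

lemma AE_cube_neq:
  assumes ij: "i \<in> {1..n}" "j \<in> {1..n}" "i \<noteq> j"
  shows "AE x in cube_measure {1..n}. x i \<noteq> x j"
proof -
  have comp [measurable]: "(\<lambda>x. x k) \<in> borel_measurable (cube_measure {1..n})" if "k \<in> {1..n}" for k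
    using measurable_component_singleton[OF that, of "\<lambda>_. unif"] by (simp add: measurable_cong_sets[OF refl sets_unif])
  let ?f = "\<lambda>x. if x i = x j then 1 else 0 :: ennreal"
  have meas: "?f \<in> borel_measurable (cube_measure {1..n})"
    using ij by measurable
  have ins: "insert i ({1..n} - {i}) = {1..n}" using ij by auto
  have "(\<integral>\<^sup>+x. ?f x \<partial>cube_measure {1..n}) = (\<integral>\<^sup>+z. (\<integral>\<^sup>+t. ?f (z(i := t)) \<partial>unif) \<partial>cube_measure ({1..n} - {i}))"
  proof (rule unif_prod.product_nn_integral_insert[of "{1..n} - {i}" i, unfolded ins])
  qed (use meas in auto)
  also have "\<dots> = (\<integral>\<^sup>+z. 0 \<partial>cube_measure ({1..n} - {i}))"
  proof (rule nn_integral_cong)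
    fix z
    have "(\<integral>\<^sup>+t. ?f (z(i := t)) \<partial>unif) = (\<integral>\<^sup>+t. indicator {z j} t \<partial>unif)"
      using ij by (intro nn_integral_cong) (auto simp: indicator_def)
    also have "\<dots> = emeasure unif {z j}" by simp
    also have "\<dots> = 0" unfolding unif_def by (subst emeasure_uniform_measure) (auto simp: Int_insert_right)
    finally show "(\<integral>\<^sup>+t. ?f (z(i := t)) \<partial>unif) = 0" .
  qed
  also have "\<dots> = 0" by simp
  finally have "AE x in cube_measure {1..n}. ?f x = 0" using nn_integral_0_iff_AE[OF meas] by (simp only:)
  then show ?thesis by eventually_elim (auto split: if_splits)
qed

lemma AE_cube_inj: "AE x in cube_measure {1..n}. inj_on x {1..n}"
proof -
  have "AE x in cube_measure {1..n}. \<forall>i\<in>{1..n}. \<forall>j\<in>{1..n} - {i}. x i \<noteq> x j"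
    by (intro AE_finite_allI AE_cube_neq) auto
  then show ?thesis by eventually_elim (auto simp: inj_on_def)
qed

definition sorts_desc :: "nat \<Rightarrow> (nat \<Rightarrow> nat) \<Rightarrow> (nat \<Rightarrow> real) \<Rightarrow> bool" where
  "sorts_desc n \<sigma> x \<longleftrightarrow> (\<forall>i\<in>{1..n}. \<forall>k\<in>{1..n}. i \<le> k \<longrightarrow> x (\<sigma> k) \<le> x (\<sigma> i))"

lemma perm_coord_in_ordered_simplex_iff:
  assumes "\<sigma> permutes {1..n}" "\<forall>i\<in>{1..n}. x i \<in> {0..1}"
  shows "perm_coord n \<sigma> x \<in> ordered_simplex n \<longleftrightarrow> sorts_desc n \<sigma> x"
proof
  assume L: "perm_coord n \<sigma> x \<in> ordered_simplex n"
  show "sorts_desc n \<sigma> x" unfolding sorts_desc_def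
  proof (intro ballI impI)
    fix i k assume ik: "i \<in> {1..n}" "k \<in> {1..n}" "i \<le> k"
    then show "x (\<sigma> k) \<le> x (\<sigma> i)"
      using extend_antimono[OF L ik(3)] by (simp add: extend_def perm_coord_def)
  qed
next
  assume R: "sorts_desc n \<sigma> x"
  have x: "x (\<sigma> i) \<in> {0..1}" if "i \<in> {1..n}" for i
    using assms(2) permutes_in_image[OF assms(1), of i] that by blast
  show "perm_coord n \<sigma> x \<in> ordered_simplex n" unfolding ordered_simplex_def
  proof (intro CollectI allI impI)
    fix i assume i: "i \<le> n"
    consider "i = 0" "n = 0" | "i = 0" "n > 0" | "i > 0" "i < n" | "i > 0" "i = n" using i by linarith
    then show "extend n (perm_coord n \<sigma> x) (Suc i) \<le> extend n (perm_coord n \<sigma> x) i"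
    proof cases
      case 3
      then show ?thesis using R unfolding sorts_desc_def by (auto simp: extend_def perm_coord_def)
    qed (use x[of 1] x[of n] in \<open>auto simp: extend_def perm_coord_def\<close>)
  qed
qed

text \<open>
  The sorting permutation is the inverse of the rank function \<open>k \<mapsto> card {l. x l \<ge> x k}\<close>.
\<close>

lemma ex1_sorting_permutation:
  assumes inj: "inj_on x {1..n}"
  shows "\<exists>!\<sigma>. \<sigma> permutes {1..n} \<and> sorts_desc n \<sigma> x"
proof -
  define \<tau> where "\<tau> k = card {l\<in>{1..n}. x l \<ge> x k}" for k
  have \<tau>_less: "\<tau> k < \<tau> l" if "k \<in> {1..n}" "l \<in> {1..n}" "x l < x k" for k l
    unfolding \<tau>_def
  proof (rule psubset_card_mono)
    have "l \<in> {i\<in>{1..n}. x l \<le> x i}" "l \<notin> {i\<in>{1..n}. x k \<le> x i}" using that by auto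
    moreover have "{i\<in>{1..n}. x k \<le> x i} \<subseteq> {i\<in>{1..n}. x l \<le> x i}" using that by auto
    ultimately show "{i\<in>{1..n}. x k \<le> x i} \<subset> {i\<in>{1..n}. x l \<le> x i}" by blast
  qed simp
  have \<tau>_inj: "inj_on \<tau> {1..n}"
  proof (rule inj_onI)
    fix k l assume kl: "k \<in> {1..n}" "l \<in> {1..n}" "\<tau> k = \<tau> l"
    then have "x k = x l" using \<tau>_less[of k l] \<tau>_less[of l k] by (metis less_irrefl linorder_cases)
    then show "k = l" using inj_onD[OF inj] kl(1,2) by blast
  qed
  have \<tau>_mem: "\<tau> ` {1..n} \<subseteq> {1..n}"
  proof (intro image_subsetI)
    fix k assume k: "k \<in> {1..n}"
    have "\<tau> k \<le> card {1..n}" unfolding \<tau>_def by (rule card_mono) auto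
    moreover have "\<tau> k > 0" unfolding \<tau>_def using k by (subst card_gt_0_iff) auto
    ultimately show "\<tau> k \<in> {1..n}" by simp
  qed
  \<comment> \<open>\<open>permutes\<close> demands the identity outside
    \<open>{1..n}\<close>.\<close>
  define \<pi> where "\<pi> k = (if k \<in> {1..n} then \<tau> k else k)" for k
  have "bij_betw \<tau> {1..n} {1..n}"
    unfolding bij_betw_def using \<tau>_inj endo_inj_surj[OF _ \<tau>_mem \<tau>_inj] by simp
  then have "bij_betw \<pi> {1..n} {1..n}" by (subst bij_betw_cong[of _ _ \<tau>]) (auto simp: \<pi>_def)
  then have \<pi>: "\<pi> permutes {1..n}" by (rule bij_imp_permutes) (auto simp: \<pi>_def)
  show ?thesis
  proof (intro ex1I conjI)
    show \<sigma>: "inv \<pi> permutes {1..n}" by (rule permutes_inv[OF \<pi>])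
    show "sorts_desc n (inv \<pi>) x" unfolding sorts_desc_def
    proof (intro ballI impI, rule ccontr)
      fix i k assume ik: "i \<in> {1..n}" "k \<in> {1..n}" "i \<le> k" "\<not> x (inv \<pi> k) \<le> x (inv \<pi> i)"
      have mem: "inv \<pi> i \<in> {1..n}" "inv \<pi> k \<in> {1..n}" using permutes_in_image[OF \<sigma>] ik by blast+
      have "\<pi> (inv \<pi> i) = i" "\<pi> (inv \<pi> k) = k" using permutes_inverses(1)[OF \<pi>] by auto
      then have "\<tau> (inv \<pi> i) = i" "\<tau> (inv \<pi> k) = k" using mem by (auto simp: \<pi>_def)
      then show False using \<tau>_less[OF mem(2) mem(1)] ik by simp
    qed
    fix \<rho> assume "\<rho> permutes {1..n} \<and> sorts_desc n \<rho> x"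
    then have \<rho>: "\<rho> permutes {1..n}" "sorts_desc n \<rho> x" by auto
    have "\<pi> (\<rho> i) = i" for i
    proof (cases "i \<in> {1..n}")
      case True
      \<comment> \<open>Under a sorting \<rho> the coordinates at least as large as the i-th are
        exactly the first i, so the rank of \<open>\<rho> i\<close> is i, and \<rho> inverts the
        rank.\<close>
      have "{l\<in>{1..n}. x l \<ge> x (\<rho> i)} = \<rho> ` {1..i}"
      proof (intro equalityI subsetI)
        fix l assume l: "l \<in> {l\<in>{1..n}. x l \<ge> x (\<rho> i)}"
        then have "l \<in> \<rho> ` {1..n}" using permutes_image[OF \<rho>(1)] by simp
        then obtain k where k: "l = \<rho> k" "k \<in> {1..n}" by blast
        have "k \<le> i"
        proof (rule ccontr)
          assume "\<not> k \<le> i"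
          then have "x (\<rho> k) \<le> x (\<rho> i)" using \<rho>(2) True k by (auto simp: sorts_desc_def)
          then have "x (\<rho> k) = x (\<rho> i)" using l k by simp
          moreover have "\<rho> k \<in> {1..n}" "\<rho> i \<in> {1..n}" using permutes_in_image[OF \<rho>(1)] True k(2) by blast+
          ultimately have "\<rho> k = \<rho> i" using inj_onD[OF inj] by blast
          then have "k = i" using injD[OF permutes_inj[OF \<rho>(1)]] by blast
          then show False using \<open>\<not> k \<le> i\<close> by simp
        qed
        then show "l \<in> \<rho> ` {1..i}" using k by auto
      next
        fix l assume "l \<in> \<rho> ` {1..i}"
        then obtain k where k: "k \<in> {1..i}" "l = \<rho> k" by blast
        then have kn: "k \<in> {1..n}" using True by auto
        then have "x (\<rho> i) \<le> x (\<rho> k)" using \<rho>(2) True k unfolding sorts_desc_def by auto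
        then show "l \<in> {l\<in>{1..n}. x l \<ge> x (\<rho> i)}" using permutes_in_image[OF \<rho>(1), of k] kn k by auto
      qed
      then have "\<tau> (\<rho> i) = i"
        unfolding \<tau>_def using card_image[of \<rho> "{1..i}"] permutes_inj_on[OF \<rho>(1)] by simp
      then show ?thesis using permutes_in_image[OF \<rho>(1), of i] True by (simp add: \<pi>_def)
    next
      case False
      then show ?thesis using permutes_not_in[OF \<rho>(1)] permutes_not_in[OF \<pi>] by simp
    qed
    then show "\<rho> = inv \<pi>" by (metis ext permutes_inverses(2)[OF \<pi>])
  qed
qed

text \<open>Away from ties exactly one permutation sorts x, so the simplices overlap in a null set
  only.\<close>

lemma AE_sum_simplices:
  "AE x in cube_measure {1..n}.
    (\<Sum>\<sigma> | \<sigma> permutes {1..n}. indicator (ordered_simplex n) (perm_coord n \<sigma> x)) = (1 :: real)"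
  using AE_cube_in_unit AE_cube_inj
proof eventually_elim
  case (elim x)
  obtain \<rho> where \<rho>: "\<rho> permutes {1..n}" "sorts_desc n \<rho> x"
    "\<And>\<sigma>. \<sigma> permutes {1..n} \<Longrightarrow> sorts_desc n \<sigma> x \<Longrightarrow> \<sigma> = \<rho>"
    using ex1_sorting_permutation[OF elim(2)] by blast
  have "(\<Sum>\<sigma> | \<sigma> permutes {1..n}. indicator (ordered_simplex n) (perm_coord n \<sigma> x))
      = (\<Sum>\<sigma> | \<sigma> permutes {1..n}. if \<sigma> = \<rho> then 1 else 0 :: real)"
  proof (rule sum.cong[OF refl])
    fix \<sigma> assume "\<sigma> \<in> {\<sigma>. \<sigma> permutes {1..n}}"
    then have \<sigma>: "\<sigma> permutes {1..n}" by simp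
    have "perm_coord n \<sigma> x \<in> ordered_simplex n \<longleftrightarrow> \<sigma> = \<rho>"
      unfolding perm_coord_in_ordered_simplex_iff[OF \<sigma> elim(1)] using \<rho>(2) \<rho>(3)[OF \<sigma>] by blast
    then show "indicator (ordered_simplex n) (perm_coord n \<sigma> x) = (if \<sigma> = \<rho> then 1 else 0 :: real)"
      by (simp add: indicator_def)
  qed
  also have "\<dots> = 1" using \<rho>(1) by (subst sum.delta) (auto simp: finite_permutations)
  finally show ?case .
qed

text \<open>On the simplex of \<sigma> the coordinates form a chain in a fixed order, so
  \<open>min\<close> and \<open>max\<close> always choose the same coordinate; the index r is
  independent of x.\<close>

lemma lattice_polynomial_sorted:
  assumes "lattice_polynomial n p" and \<sigma>: "\<sigma> permutes {1..n}"
  shows "\<exists>r\<in>{1..n}. \<forall>x. sorts_desc n \<sigma> x \<longrightarrow> p x = x (\<sigma> r)"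
  using assms(1)
proof induction
  case (var i)
  then have "i \<in> \<sigma> ` {1..n}" using permutes_image[OF \<sigma>] by simp
  then obtain r where "r \<in> {1..n}" "i = \<sigma> r" by blast
  then show ?case by blast
next
  case (meet p q)
  then obtain r s where rs: "r \<in> {1..n}" "s \<in> {1..n}"
    "\<And>x. sorts_desc n \<sigma> x \<Longrightarrow> p x = x (\<sigma> r)" "\<And>x. sorts_desc n \<sigma> x \<Longrightarrow> q x = x (\<sigma> s)" by blast
  \<comment> \<open>The order is descending, so the minimum sits at the larger index.\<close>
  have "min (p x) (q x) = x (\<sigma> (max r s))" if "sorts_desc n \<sigma> x" for x
  proof -
    have "r \<le> s \<Longrightarrow> x (\<sigma> s) \<le> x (\<sigma> r)" "s \<le> r \<Longrightarrow> x (\<sigma> r) \<le> x (\<sigma> s)"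
      using that rs(1,2) by (auto simp: sorts_desc_def)
    then show ?thesis using rs(3,4)[OF that] by (cases "r \<le> s") (auto simp: min_def max_def)
  qed
  then show ?case using rs(1,2) by (intro bexI[of _ "max r s"]) (auto simp: max_def)
next
  case (join p q)
  then obtain r s where rs: "r \<in> {1..n}" "s \<in> {1..n}"
    "\<And>x. sorts_desc n \<sigma> x \<Longrightarrow> p x = x (\<sigma> r)" "\<And>x. sorts_desc n \<sigma> x \<Longrightarrow> q x = x (\<sigma> s)" by blast
  have "max (p x) (q x) = x (\<sigma> (min r s))" if "sorts_desc n \<sigma> x" for x
  proof -
    have "r \<le> s \<Longrightarrow> x (\<sigma> s) \<le> x (\<sigma> r)" "s \<le> r \<Longrightarrow> x (\<sigma> r) \<le> x (\<sigma> s)"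
      using that rs(1,2) by (auto simp: sorts_desc_def)
    then show ?thesis using rs(3,4)[OF that] by (cases "r \<le> s") (auto simp: min_def max_def)
  qed
  then show ?case using rs(1,2) by (intro bexI[of _ "min r s"]) (auto simp: min_def)
qed

text \<open>These are the vertex values of the r-th coordinate; the sum telescopes from r to the
  sentinel 0.\<close>

lemma bary_step:
  assumes r: "r \<in> {1..n}"
  shows "bary n (\<lambda>i. if r \<le> i then 1 else 0) y = y r"
proof -
  have "(\<Sum>i\<le>k. (if r \<le> i then 1 else 0) * (e i - e (Suc i))) = (if r \<le> k then e r - e (Suc k) else 0)"
    for k and e :: "nat \<Rightarrow> real"
    by (induction k) (auto simp: le_Suc_eq)
  then have "bary n (\<lambda>i. if r \<le> i then 1 else 0) y = extend n y r - extend n y (Suc n)"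
    unfolding bary_def using r by simp
  then show ?thesis using r by (simp add: extend_def)
qed

lemma char_vec_in_unit_cube: "char_vec n A \<in> unit_cube n"
  by (auto simp: char_vec_def unit_cube_def indicator_def)

lemma char_vec_image:
  assumes "\<sigma> permutes {1..n}" "r \<in> {1..n}"
  shows "char_vec n (\<sigma> ` {1..i}) (\<sigma> r) = (if r \<le> i then 1 else 0)"
proof -
  have "\<sigma> r \<in> \<sigma> ` {1..i} \<longleftrightarrow> r \<in> {1..i}"
    using permutes_inj[OF assms(1)] by (simp add: inj_image_mem_iff)
  moreover have "\<sigma> r \<in> {1..n}" using permutes_in_image[OF assms(1)] assms(2) by simp
  ultimately show ?thesis using assms(2) by (auto simp: char_vec_def indicator_def)
qed

text \<open>On the simplex h is a linear combination of coordinates. The vertices belong to this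
  simplex, so the same formula gives the vertex values as combinations of step functions, and
  linearity of \<open>bary\<close> in these values leaves \<open>bary_step\<close>.\<close>

lemma lattice_combination_on_simplex:
  assumes h: "lattice_combination n h" and \<sigma>: "\<sigma> permutes {1..n}"
  shows "x \<in> unit_cube n \<Longrightarrow> sorts_desc n \<sigma> x \<Longrightarrow>
      h x = bary n (vertex_value n h \<sigma>) (perm_coord n \<sigma> x)"
    and "vertex_value n h \<sigma> 0 = 0"
proof -
  obtain m :: nat and c p where p: "\<And>k. k \<in> {1..m} \<Longrightarrow> lattice_polynomial n (p k)"
    "\<And>x. x \<in> unit_cube n \<Longrightarrow> h x = (\<Sum>k=1..m. c k * p k x)"
    using h unfolding lattice_combination_def by blast
  obtain r where r: "\<And>k. k \<in> {1..m} \<Longrightarrow> r k \<in> {1..n}"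
    "\<And>k x. k \<in> {1..m} \<Longrightarrow> sorts_desc n \<sigma> x \<Longrightarrow> p k x = x (\<sigma> (r k))"
    using lattice_polynomial_sorted[OF p(1) \<sigma>] by metis
  have lin: "h x = (\<Sum>k=1..m. c k * x (\<sigma> (r k)))" if "x \<in> unit_cube n" "sorts_desc n \<sigma> x" for x
    using p(2)[OF that(1)] r(2)[OF _ that(2)] by simp
  have vertex: "vertex_value n h \<sigma> i = (\<Sum>k=1..m. c k * (if r k \<le> i then 1 else 0))" for i
  proof -
    have "sorts_desc n \<sigma> (char_vec n (\<sigma> ` {1..i}))"
      unfolding sorts_desc_def using char_vec_image[OF \<sigma>] by simp
    then show ?thesis
      unfolding vertex_value_def using lin[OF char_vec_in_unit_cube] char_vec_image[OF \<sigma> r(1)] by simp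
  qed
  \<comment> \<open>Every index \<open>r k\<close> is at least 1, so all step functions vanish at
    0.\<close>
  show "vertex_value n h \<sigma> 0 = 0"
    unfolding vertex using r(1) by (intro sum.neutral) force
  assume x: "x \<in> unit_cube n" "sorts_desc n \<sigma> x"
  have "bary n (vertex_value n h \<sigma>) (perm_coord n \<sigma> x)
      = (\<Sum>k=1..m. c k * bary n (\<lambda>i. if r k \<le> i then 1 else 0) (perm_coord n \<sigma> x))"
    unfolding bary_def vertex sum_distrib_left sum_distrib_right
    by (subst sum.swap) (simp add: mult.assoc)
  also have "\<dots> = (\<Sum>k=1..m. c k * x (\<sigma> (r k)))"
    using r(1) by (intro sum.cong refl) (simp add: bary_step perm_coord_def)
  finally show "h x = bary n (vertex_value n h \<sigma>) (perm_coord n \<sigma> x)" using lin[OF x] by simp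
qed

lemma borel_measurable_lattice_polynomial:
  "lattice_polynomial n p \<Longrightarrow> p \<in> borel_measurable (cube_measure {1..n})"
proof (induction rule: lattice_polynomial.induct)
  case (var i)
  then show ?case using measurable_component_singleton[of i "{1..n}" "\<lambda>_. unif"]
    by (simp add: measurable_cong_sets[OF refl sets_unif])
qed auto


theorem theorem2:
  fixes n :: nat
    and h :: "(nat \<Rightarrow> real) \<Rightarrow> real"
    and M :: "'w measure"
    and X :: "'w \<Rightarrow> nat \<Rightarrow> real"
    and g :: "real \<Rightarrow> real"
  assumes "n \<ge> 1"
    and "lattice_combination n h"
    and "prob_space M"
    and "uniform_on_cube n M X"
    and "g \<in> class_A n"
    and "nth_deriv_defined_at_atom n h g"
  shows "integrable M (\<lambda>\<omega>. nth_deriv n g (h (X \<omega>))) \<and>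
    prob_space.expectation M (\<lambda>\<omega>. nth_deriv n g (h (X \<omega>))) =
      (\<Sum>\<sigma> | \<sigma> permutes {1..n}. div_diff g (map (vertex_value n h \<sigma>) [0..<n + 1]))"
proof -
  obtain N where n: "n = Suc N" using assms(1) by (cases n) auto
  define \<Phi> \<phi> where "\<Phi> = nth_deriv N g" and "\<phi> = nth_deriv n g"
  have \<phi>_eq: "\<phi> = deriv \<Phi>" by (simp add: \<phi>_def \<Phi>_def n)
  have diff: "nth_deriv k g field_differentiable at x" if "k < N" for k x
    using assms(5) that by (simp add: class_A_def n)
  have "abs_continuous_on_interval a b \<Phi>" if "a \<le> b" for a b
    using assms(5) that by (simp add: class_A_def n \<Phi>_def)
  then have prim: "has_primitive \<phi> \<Phi>" unfolding \<phi>_eq by (rule abs_continuous_has_primitive)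
  have \<phi>_meas [measurable]: "\<phi> \<in> borel_measurable borel" by (rule has_primitiveD(1)[OF prim])
  let ?P = "{\<sigma>. \<sigma> permutes {1..n}}" and ?v = "vertex_value n h"
  let ?F = "\<lambda>\<sigma> y. indicator (ordered_simplex n) y * \<phi> (bary n (?v \<sigma>) y)"

  have F_int: "integrable (cube_measure {1..n}) (?F \<sigma>)" if \<sigma>: "\<sigma> permutes {1..n}" for \<sigma>
  proof (cases "\<exists>p\<le>n. ?v \<sigma> p \<noteq> ?v \<sigma> 0")
    case True
    then show ?thesis using integrable_simplex[OF prim] by blast
  next
    case False
    \<comment> \<open>Here \<phi> is evaluated at one point only, so the constant function with this
      value may replace it.\<close>
    have "bary n (?v \<sigma>) y = bary n (\<lambda>_. ?v \<sigma> 0) y" for y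
      by (rule bary_cong) (use False in blast)
    then have "bary n (?v \<sigma>) y = ?v \<sigma> 0" for y
      unfolding bary_const .
    then show ?thesis
      using integrable_simplex_continuous[of "\<lambda>_. \<phi> (?v \<sigma> 0)" n "?v \<sigma>"] by (simp only: continuous_on_const)
  qed
  have F_mean: "(\<integral>y. ?F \<sigma> y \<partial>cube_measure {1..n}) = div_diff g (map (?v \<sigma>) [0..<n + 1])"
    if \<sigma>: "\<sigma> permutes {1..n}" for \<sigma>
  proof -
    let ?xs = "map (?v \<sigma>) [0..<n + 1]"
    \<comment> \<open>As h vanishes at the origin, coinciding arguments can only all be 0; this ties
      the case of equal arguments to the hypothesis on the atom.\<close>
    have hd: "hd ?xs = 0"
      using lattice_combination_on_simplex(2)[OF assms(2) \<sigma>] by (simp add: upt_conv_Cons del: upt_Suc)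
    have "div_diff g ?xs = simplex_mean (nth_deriv (Suc N) g) ?xs"
    proof (rule div_diff_eq_simplex_mean_top[OF diff])
      show "has_primitive (nth_deriv (Suc N) g) (nth_deriv N g)" using prim by (simp only: \<phi>_def \<Phi>_def n)
      assume const: "\<And>x. x \<in> set ?xs \<Longrightarrow> x = hd ?xs"
      have "?v \<sigma> i = 0" if i: "i \<in> {0..n}" for i
      proof -
        have "?v \<sigma> i \<in> set ?xs" using i by (auto simp del: upt_Suc)
        from const[OF this] show ?thesis unfolding hd .
      qed
      then show "nth_deriv N g field_differentiable at (hd ?xs)"
        using assms(6) \<sigma> unfolding hd nth_deriv_defined_at_atom_def by (auto simp: n)
    qed (simp_all add: n)
    also have "\<dots> = simplex_integral n \<phi> ((!) ?xs)"
      unfolding simplex_mean_def by (simp add: \<phi>_def n)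
    also have "\<dots> = simplex_integral n \<phi> (?v \<sigma>)"
      by (rule simplex_integral_cong) (simp del: upt_Suc)
    finally show ?thesis by (simp add: simplex_integral_def)
  qed

  obtain m :: nat and c p where p: "\<And>k. k \<in> {1..m} \<Longrightarrow> lattice_polynomial n (p k)"
    "\<And>x. x \<in> unit_cube n \<Longrightarrow> h x = (\<Sum>k=1..m. c k * p k x)"
    using assms(2) unfolding lattice_combination_def by blast
  \<comment> \<open>h is arbitrary off the cube and possibly not measurable; H agrees with it on the
    cube and is measurable.\<close>
  define H where "H x = (\<Sum>k=1..m. c k * p k x)" for x
  have H_meas [measurable]: "H \<in> borel_measurable (cube_measure {1..n})"
    unfolding H_def[abs_def]
    by (intro borel_measurable_sum borel_measurable_times borel_measurable_const borel_measurable_lattice_polynomial p(1))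
  have \<phi>H_meas: "(\<lambda>x. \<phi> (H x)) \<in> borel_measurable (cube_measure {1..n})" by measurable

  have split: "AE x in cube_measure {1..n}. (\<Sum>\<sigma>\<in>?P. ?F \<sigma> (perm_coord n \<sigma> x)) = \<phi> (H x)"
    \<comment> \<open>\<open>AE_space\<close> supplies the extensionality that membership in
      \<open>unit_cube\<close> requires.\<close>
    using AE_sum_simplices AE_cube_in_unit AE_space
  proof eventually_elim
    case (elim x)
    have x: "x \<in> unit_cube n"
      using elim(2,3) by (auto simp: unit_cube_def space_PiM PiE_iff)
    have "(\<Sum>\<sigma>\<in>?P. ?F \<sigma> (perm_coord n \<sigma> x)) = (\<Sum>\<sigma>\<in>?P. indicator (ordered_simplex n) (perm_coord n \<sigma> x) * \<phi> (H x))"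
    proof (rule sum.cong[OF refl])
      fix \<sigma> assume "\<sigma> \<in> ?P"
      then have \<sigma>: "\<sigma> permutes {1..n}" by simp
      show "?F \<sigma> (perm_coord n \<sigma> x) = indicator (ordered_simplex n) (perm_coord n \<sigma> x) * \<phi> (H x)"
      proof (cases "perm_coord n \<sigma> x \<in> ordered_simplex n")
        case True
        then have "sorts_desc n \<sigma> x" using perm_coord_in_ordered_simplex_iff[OF \<sigma> elim(2)] by simp
        then have "H x = bary n (?v \<sigma>) (perm_coord n \<sigma> x)"
          using lattice_combination_on_simplex(1)[OF assms(2) \<sigma> x] p(2)[OF x] by (simp add: H_def)
        then show ?thesis by simp
      qed simp
    qed
    also have "\<dots> = \<phi> (H x)" using elim(1) by (simp add: sum_distrib_right[symmetric])
    finally show ?case .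
  qed
  have term_int: "integrable (cube_measure {1..n}) (\<lambda>x. ?F \<sigma> (perm_coord n \<sigma> x))"
    and term_eq: "(\<integral>x. ?F \<sigma> (perm_coord n \<sigma> x) \<partial>cube_measure {1..n}) = div_diff g (map (?v \<sigma>) [0..<n + 1])"
    if \<sigma>: "\<sigma> permutes {1..n}" for \<sigma>
  proof -
    \<comment> \<open>Permuting coordinates preserves the measure, so each term reduces to the
      ordered simplex.\<close>
    note F_meas = borel_measurable_integrable[OF F_int[OF \<sigma>]]
    show "integrable (cube_measure {1..n}) (\<lambda>x. ?F \<sigma> (perm_coord n \<sigma> x))"
      using integrable_distr_eq[OF measurable_perm_coord[OF \<sigma>] F_meas] F_int[OF \<sigma>]
      unfolding distr_perm_coord[OF \<sigma>] by blast
    show "(\<integral>x. ?F \<sigma> (perm_coord n \<sigma> x) \<partial>cube_measure {1..n}) = div_diff g (map (?v \<sigma>) [0..<n + 1])"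
      using integral_distr[OF measurable_perm_coord[OF \<sigma>] F_meas] F_mean[OF \<sigma>]
      unfolding distr_perm_coord[OF \<sigma>] by (simp only:)
  qed
  have sum_int: "integrable (cube_measure {1..n}) (\<lambda>x. \<Sum>\<sigma>\<in>?P. ?F \<sigma> (perm_coord n \<sigma> x))"
    by (rule Bochner_Integration.integrable_sum) (use term_int in blast)
  have cube_int: "integrable (cube_measure {1..n}) (\<lambda>x. \<phi> (H x))"
    using integrable_cong_AE[OF borel_measurable_integrable[OF sum_int] \<phi>H_meas split] sum_int by blast
  have cube_eq: "(\<integral>x. \<phi> (H x) \<partial>cube_measure {1..n}) = (\<Sum>\<sigma>\<in>?P. div_diff g (map (?v \<sigma>) [0..<n + 1]))"
  proof -
    have "(\<integral>x. \<phi> (H x) \<partial>cube_measure {1..n}) = (\<integral>x. (\<Sum>\<sigma>\<in>?P. ?F \<sigma> (perm_coord n \<sigma> x)) \<partial>cube_measure {1..n})"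
      using integral_cong_AE[OF borel_measurable_integrable[OF sum_int] \<phi>H_meas split] by (rule sym)
    also have "\<dots> = (\<Sum>\<sigma>\<in>?P. \<integral>x. ?F \<sigma> (perm_coord n \<sigma> x) \<partial>cube_measure {1..n})"
      by (rule Bochner_Integration.integral_sum) (use term_int in blast)
    also have "\<dots> = (\<Sum>\<sigma>\<in>?P. div_diff g (map (?v \<sigma>) [0..<n + 1]))"
      by (rule sum.cong[OF refl], rule term_eq) simp
    finally show ?thesis .
  qed

  have X: "X \<in> measurable M (lebesgue_n n)" "\<And>\<omega>. \<omega> \<in> space M \<Longrightarrow> X \<omega> \<in> unit_cube n"
    "distr M (lebesgue_n n) X = cube_measure {1..n}"
    using assms(4) unfolding uniform_on_cube_def uniform_measure_unit_cube by auto
  have "sets (lebesgue_n n) = sets (cube_measure {1..n})"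
    unfolding lebesgue_n_def by (intro sets_PiM_cong) auto
  then have \<phi>H_meas': "(\<lambda>x. \<phi> (H x)) \<in> borel_measurable (lebesgue_n n)"
    using \<phi>H_meas measurable_cong_sets by blast
  \<comment> \<open>X lies in the cube everywhere, so h may be replaced by H without an exceptional
    set.\<close>
  have hH: "nth_deriv n g (h (X \<omega>)) = \<phi> (H (X \<omega>))" if "\<omega> \<in> space M" for \<omega>
    using p(2)[OF X(2)[OF that]] by (simp add: \<phi>_def H_def)
  have "integrable M (\<lambda>\<omega>. \<phi> (H (X \<omega>)))"
    using integrable_distr_eq[OF X(1) \<phi>H_meas'] cube_int unfolding X(3) by blast
  then have "integrable M (\<lambda>\<omega>. nth_deriv n g (h (X \<omega>)))"
    by (subst Bochner_Integration.integrable_cong[OF refl hH])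
  moreover have "(\<integral>\<omega>. nth_deriv n g (h (X \<omega>)) \<partial>M) = (\<Sum>\<sigma>\<in>?P. div_diff g (map (?v \<sigma>) [0..<n + 1]))"
  proof -
    have "(\<integral>\<omega>. nth_deriv n g (h (X \<omega>)) \<partial>M) = (\<integral>\<omega>. \<phi> (H (X \<omega>)) \<partial>M)"
      by (rule Bochner_Integration.integral_cong[OF refl], rule hH)
    also have "\<dots> = (\<integral>x. \<phi> (H x) \<partial>cube_measure {1..n})"
      using integral_distr[OF X(1) \<phi>H_meas'] unfolding X(3) by (rule sym)
    finally show ?thesis unfolding cube_eq .
  qed
  ultimately show ?thesis by (rule conjI)
qed

end
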